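(* Let $\Delta$ be a connected graph with $\operatorname{rk}\Delta=2$ and let $v$ be a vertex of $\Delta$. For $j=1,2$ let $p_j:\Lambda_j\to\Delta$ be a covering of connected graphs with $p_j(u_j)=v$ for a chosen vertex $u_j$ of $\Lambda_j$, with $\operatorname{rk}\Lambda_j<\infty$ and $\Lambda_j$ not simply connected. Let $\mathcal{H}_j:=\mathcal{H}(\Lambda_{u_j}\to\Delta_v)$ and $n_{ji}:=n_i(\Lambda_{u_j}\to\Delta_v)$ be the quantities defined in the context (for a fixed spanning tree $T$ of $\Delta$ and a fixed labelling of the edge loops of $\Delta/T$, the same for $j=1,2$). Then for each $i=1,2$, $$\sum_{\Omega}(\operatorname{rk}\Omega-1)\ \leq\ (\operatorname{rk}\Lambda_1-1)(\operatorname{rk}\Lambda_2-1)+\mathcal{H}_1\mathcal{H}_2-(\mathcal{H}_1-n_{1i})(\mathcal{H}_2-n_{2i}),$$ where the sum is over all non simply connected (connected) components $\Omega$ of the (unpointed) pullback $\Lambda_1\prod_\Delta\Lambda_2$.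
   Context: A graph is a set $\Gamma$ with an involution $^{-1}$ and an idempotent $s:\Gamma\to V_\Gamma$, where $V_\Gamma$ (vertices) is the fixed point set of $^{-1}$ and $E_\Gamma=\Gamma\setminus V_\Gamma$ is the set of (oriented) edges, $s(v)=v$ for vertices; an edge $e$ starts at $s(e)$ and ends at $t(e)=s(e^{-1})$; an arc is a pair $\{e,e^{-1}\}$, $e\neq e^{-1}$. Topological notions (connected, fundamental group, homology, simply connected) refer to the geometric realization, a $1$-dimensional CW complex. A graph map commutes with $s$ and $^{-1}$ and sends vertices to vertices; it is dimension preserving if it sends edges to edges. A covering is a dimension preserving map $f:\Lambda\to\Delta$ of connected graphs which for each vertex $x$ of $\Lambda$ is a bijection from the edges starting at $x$ to the edges starting at $f(x)$. $\Lambda_u$ denotes $\Lambda$ pointed at the vertex $u$. The rank $\operatorname{rk}\Lambda$ of a connected graph is $\operatorname{rk}_{\mathbb Z}H_1(\Lambda)$. A path is reduced if it never successively traverses an edge and its inverse. Pullback: for graph maps $p_j:\Lambda_j\to\Delta$, $\Lambda_1\prod_\Delta\Lambda_2$ has vertices (resp. edges) the pairs $x_1\times x_2$ of vertices (resp. edges) $x_j$ of $\Lambda_j$ with $p_1(x_1)=p_2(x_2)$, with $s(x_1\times x_2)=s(x_1)\times s(x_2)$ and $(x_1\times x_2)^{-1}=x_1^{-1}\times x_2^{-1}$. Spine: for $\Lambda$ connected with vertex $u$, the spine $\widehat{\Lambda}_u$ is the union in $\Lambda$ of all closed reduced paths starting at $u$. The coboundary $\delta\Gamma$ of a subgraph $\Gamma$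 is the set of edges $e$ with $s(e)\in\Gamma$, $t(e)\notin\Gamma$. The quantities $\mathcal H$ and $n_i$: let $f:\Lambda_u\to\Delta_v$ be a covering with $\operatorname{rk}\Delta=2$, $\operatorname{rk}\Lambda<\infty$ and $\Lambda$ not simply connected. Let $T\subset\Delta$ be a spanning tree; then $f^{-1}(T)$ is a forest whose component trees $T_k$ each map isomorphically to $T$, and collapsing $T$ and each $T_k$ to a vertex gives an induced covering $\Lambda':=\Lambda/T_k\to\Delta/T$, with $\Delta/T$ a single vertexed graph with two edge loops $x_1^{\pm1},x_2^{\pm1}$. Let $u'$ be the image of $u$ in $\Lambda'$ and let $\widehat{\Lambda'}_{u'}$ be the spine of $\Lambda'$ at $u'$; it is finite. Define $\mathcal H(\Lambda_u\to\Delta_v)$ to be the number of vertices of $\widehat{\Lambda'}_{u'}$. Let the extended spine $\Gamma$ be the subgraph obtained by adding to $\widehat{\Lambda'}_{u'}$ all the edges (with their inverses and end vertices) in its coboundary $\delta\widehat{\Lambda'}_{u'}$. Every vertex of $\Gamma$ starts either zero or three edges of $\delta\Gamma$; those starting three are called boundary vertices. For a boundary vertex $v_1$, the unique edge of $\Gamma$ starting at $v_1$ covers $x_i$ or $x_i^{-1}$ for some $i$; following from $v_1$ the successive edges of $\Lambda'$ that cover this same edge, one traverses a path $\gamma$ in $\Gamma$ ending at another boundary vertex $v_2$, at which the next edge leaves $\Gamma$. The unordered pair $\{v_1,v_2\}$ is called an $x_i$-pair, and $n_i(\Lambda_u\to\Delta_v)$ is the number of $x_i$-pairs in $\Gamma$.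 *)

theory Defs
  imports Main "HOL-Library.Poly_Mapping" "HOL-Library.Extended_Nat"
begin

text \<open>
  Vertices and edges are both cells of a graph; the vertices are the fixed cells of the involution.
  Topological notions are those of the geometric realization, a one-dimensional CW complex with
  one 1-cell for each pair of an edge and its inverse. They are expressed through the cellular
  chain complex (homology) and through edge paths up to insertion and deletion of
  backtrackings (connectedness, fundamental group).
\<close>

record 'a graph =
  cells :: "'a set"
  inv_of :: "'a \<Rightarrow> 'a"
  src :: "'a \<Rightarrow> 'a"

definition verts :: "'a graph \<Rightarrow> 'a set" where
  "verts G = {x \<in> cells G. inv_of G x = x}"

definition edges :: "'a graph \<Rightarrow> 'a set" where
  "edges G = cells G - verts G"

definition tgt :: "'a graph \<Rightarrow> 'a \<Rightarrow> 'a" where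
  "tgt G e = src G (inv_of G e)"

definition is_graph :: "'a graph \<Rightarrow> bool" where
  "is_graph G \<longleftrightarrow>
     (\<forall>x \<in> cells G. inv_of G x \<in> cells G \<and> inv_of G (inv_of G x) = x) \<and>
     (\<forall>x \<in> cells G. src G x \<in> verts G) \<and>
     (\<forall>v \<in> verts G. src G v = v)"

text \<open>Subgraphs are represented by their sets of cells.\<close>

definition subgraph :: "'a set \<Rightarrow> 'a graph \<Rightarrow> bool" where
  "subgraph S G \<longleftrightarrow> S \<subseteq> cells G \<and> (\<forall>x \<in> S. inv_of G x \<in> S \<and> src G x \<in> S)"

definition restrict_graph :: "'a graph \<Rightarrow> 'a set \<Rightarrow> 'a graph" where
  "restrict_graph G S = G\<lparr>cells := S\<rparr>"

subsection \<open>Paths and topological notions\<close>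

fun edge_path :: "'a graph \<Rightarrow> 'a \<Rightarrow> 'a list \<Rightarrow> 'a \<Rightarrow> bool" where
  "edge_path G u [] v \<longleftrightarrow> u \<in> verts G \<and> u = v"
| "edge_path G u (e # es) v \<longleftrightarrow> e \<in> edges G \<and> src G e = u \<and> edge_path G (tgt G e) es v"

definition reduced :: "'a graph \<Rightarrow> 'a list \<Rightarrow> bool" where
  "reduced G es \<longleftrightarrow> successively (\<lambda>e e'. e' \<noteq> inv_of G e) es"

definition connected_graph :: "'a graph \<Rightarrow> bool" where
  "connected_graph G \<longleftrightarrow>
     verts G \<noteq> {} \<and> (\<forall>u \<in> verts G. \<forall>v \<in> verts G. \<exists>es. edge_path G u es v)"

text \<open>The connected component containing a cell, as a set of cells, and all components, as graphs.\<close>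

definition component_of :: "'a graph \<Rightarrow> 'a \<Rightarrow> 'a set" where
  "component_of G x = {y \<in> cells G. \<exists>es. edge_path G (src G x) es (src G y)}"

definition graph_components :: "'a graph \<Rightarrow> 'a graph set" where
  "graph_components G = (\<lambda>x. restrict_graph G (component_of G x)) ` cells G"

text \<open>Homotopy, relative to the end points, of edge paths from \<open>u\<close> to \<open>v\<close>.\<close>

definition insert_backtrack :: "'a graph \<Rightarrow> 'a \<Rightarrow> 'a \<Rightarrow> 'a list \<Rightarrow> 'a list \<Rightarrow> bool" where
  "insert_backtrack G u v p q \<longleftrightarrow> edge_path G u p v \<and> edge_path G u q v \<and>
     (\<exists>a e b. e \<in> edges G \<and> p = a @ b \<and> q = a @ [e, inv_of G e] @ b)"

definition homotopic_paths :: "'a graph \<Rightarrow> 'a \<Rightarrow> 'a \<Rightarrow> 'a list \<Rightarrow> 'a list \<Rightarrow> bool" where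
  "homotopic_paths G u v = equivclp (insert_backtrack G u v)"

definition simply_connected_graph :: "'a graph \<Rightarrow> bool" where
  "simply_connected_graph G \<longleftrightarrow> connected_graph G \<and>
     (\<forall>u \<in> verts G. \<forall>es. edge_path G u es u \<longrightarrow> homotopic_paths G u u es [])"

text \<open>
  A cellular 1-chain has one coefficient for each arc once an orientation is chosen, and the
  opposite coefficient for the opposite orientation; without choosing an orientation, it is a
  finitely supported antisymmetric function on the edges. Under this identification the
  cellular boundary, which sends an oriented arc \<open>e\<close> to its target minus its source, is
  the linear extension of the target map. There are no 2-cells, so the first homology
  group is the group of 1-cycles.
\<close>

definition chains1 :: "'a graph \<Rightarrow> ('a \<Rightarrow>\<^sub>0 int) set" where
  "chains1 G = {c. Poly_Mapping.keys c \<subseteq> edges G \<and>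
     (\<forall>e \<in> edges G. Poly_Mapping.lookup c (inv_of G e) = - Poly_Mapping.lookup c e)}"

definition boundary1 :: "'a graph \<Rightarrow> ('a \<Rightarrow>\<^sub>0 int) \<Rightarrow> ('a \<Rightarrow>\<^sub>0 int)" where
  "boundary1 G = frag_extend (\<lambda>e. frag_of (tgt G e))"

definition H1 :: "'a graph \<Rightarrow> ('a \<Rightarrow>\<^sub>0 int) set" where
  "H1 G = {c \<in> chains1 G. boundary1 G c = 0}"

definition rk :: "'a graph \<Rightarrow> enat" where
  "rk G = (SUP B \<in> {B. finite B \<and> B \<subseteq> H1 G \<and> \<not> module.dependent frag_cmul B}. enat (card B))"

subsection \<open>Coverings and pullbacks\<close>

definition graph_map :: "('a \<Rightarrow> 'b) \<Rightarrow> 'a graph \<Rightarrow> 'b graph \<Rightarrow> bool" where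
  "graph_map f G H \<longleftrightarrow>
     f ` cells G \<subseteq> cells H \<and> f ` verts G \<subseteq> verts H \<and>
     (\<forall>x \<in> cells G. f (src G x) = src H (f x) \<and> f (inv_of G x) = inv_of H (f x))"

definition dimension_preserving :: "('a \<Rightarrow> 'b) \<Rightarrow> 'a graph \<Rightarrow> 'b graph \<Rightarrow> bool" where
  "dimension_preserving f G H \<longleftrightarrow> graph_map f G H \<and> f ` edges G \<subseteq> edges H"

definition star :: "'a graph \<Rightarrow> 'a \<Rightarrow> 'a set" where
  "star G v = {e \<in> edges G. src G e = v}"

definition covering :: "('a \<Rightarrow> 'b) \<Rightarrow> 'a graph \<Rightarrow> 'b graph \<Rightarrow> bool" where
  "covering f G H \<longleftrightarrow>
     is_graph G \<and> connected_graph G \<and> is_graph H \<and> connected_graph H \<and>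
     dimension_preserving f G H \<and>
     (\<forall>x \<in> verts G. bij_betw f (star G x) (star H (f x)))"

definition pullback ::
  "'a graph \<Rightarrow> ('a \<Rightarrow> 'c) \<Rightarrow> 'b graph \<Rightarrow> ('b \<Rightarrow> 'c) \<Rightarrow> ('a \<times> 'b) graph" where
  "pullback G1 p1 G2 p2 =
     \<lparr> cells = {(x1, x2). (x1, x2) \<in> verts G1 \<times> verts G2 \<union> edges G1 \<times> edges G2 \<and> p1 x1 = p2 x2},
       inv_of = map_prod (inv_of G1) (inv_of G2),
       src = map_prod (src G1) (src G2) \<rparr>"

subsection \<open>Collapsing the components of a subgraph\<close>

definition spanning_tree :: "'a set \<Rightarrow> 'a graph \<Rightarrow> bool" where
  "spanning_tree T G \<longleftrightarrow>
     subgraph T G \<and> verts G \<subseteq> T \<and> simply_connected_graph (restrict_graph G T)"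

text \<open>
  In the quotient, a cell outside \<open>F\<close> becomes a singleton class, and each connected
  component of \<open>F\<close>, with all its vertices and edges, becomes a single class, which is a vertex.
\<close>

definition collapse_rel :: "'a graph \<Rightarrow> 'a set \<Rightarrow> ('a \<times> 'a) set" where
  "collapse_rel G F = {(x, y). x \<in> cells G \<and> y \<in> cells G \<and>
     (x = y \<or> x \<in> F \<and> y \<in> component_of (restrict_graph G F) x)}"

definition collapse :: "'a graph \<Rightarrow> 'a set \<Rightarrow> 'a set graph" where
  "collapse G F =
     \<lparr> cells = cells G // collapse_rel G F,
       inv_of = (\<lambda>X. inv_of G ` X),
       src = (\<lambda>X. collapse_rel G F `` (src G ` X)) \<rparr>"

definition preimage :: "('a \<Rightarrow> 'b) \<Rightarrow> 'a graph \<Rightarrow> 'b set \<Rightarrow> 'a set" where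
  "preimage f G T = {x \<in> cells G. f x \<in> T}"

text \<open>The map induced by \<open>f\<close> on the collapsed graphs; its source is the graph given by
  \<open>collapse L (preimage f L T)\<close> and its target \<open>collapse D T\<close>.\<close>

definition induced_map :: "('a \<Rightarrow> 'b) \<Rightarrow> 'b graph \<Rightarrow> 'b set \<Rightarrow> 'a set \<Rightarrow> 'b set" where
  "induced_map f D T X = collapse_rel D T `` (f ` X)"

subsection \<open>Spines, extended spines and pairs\<close>

definition spine :: "'a graph \<Rightarrow> 'a \<Rightarrow> 'a set" where
  "spine G u = {u} \<union>
     (\<Union>es \<in> {es. edge_path G u es u \<and> reduced G es}.
        \<Union>e \<in> set es. {e, inv_of G e, src G e, tgt G e})"

definition coboundary :: "'a graph \<Rightarrow> 'a set \<Rightarrow> 'a set" where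
  "coboundary G S = {e \<in> edges G. src G e \<in> S \<and> tgt G e \<notin> S}"

definition extended_spine :: "'a graph \<Rightarrow> 'a \<Rightarrow> 'a set" where
  "extended_spine G u = spine G u \<union>
     (\<Union>e \<in> coboundary G (spine G u). {e, inv_of G e, src G e, tgt G e})"

definition boundary_verts :: "'a graph \<Rightarrow> 'a set \<Rightarrow> 'a set" where
  "boundary_verts G S = {w \<in> verts G \<inter> S. card {e \<in> coboundary G S. src G e = w} = 3}"

text \<open>
  The pairs for the loop \<open>y\<close>, where \<open>g\<close> is the covering of the single vertexed graph \<open>R\<close>: the
  path \<open>es\<close> lies in the extended spine \<open>S\<close>, all of its edges cover the same one of \<open>y\<close> and
  its inverse, and the next edge covering it leaves \<open>S\<close>.
\<close>

definition loop_pairs :: "'a graph \<Rightarrow> 'a set \<Rightarrow> ('a \<Rightarrow> 'b) \<Rightarrow> 'b graph \<Rightarrow> 'b \<Rightarrow> 'a set set" where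
  "loop_pairs G S g R y = {{v1, v2} | v1 v2.
     v1 \<in> boundary_verts G S \<and> v2 \<in> boundary_verts G S \<and> v1 \<noteq> v2 \<and>
     (\<exists>z \<in> {y, inv_of R y}. \<exists>es. edge_path G v1 es v2 \<and> set es \<subseteq> S \<and>
        (\<forall>e \<in> set es. g e = z) \<and>
        (\<exists>e \<in> coboundary G S. src G e = v2 \<and> g e = z))}"

text \<open>
  For a covering \<open>f\<close> from \<open>L\<close>, pointed at \<open>u\<close>, to \<open>D\<close> with spanning tree \<open>T\<close>: the number of
  vertices of the spine of the collapsed graph, and the number of its pairs for a loop \<open>y\<close>
  of \<open>collapse D T\<close>.
\<close>

definition spine_size :: "'a graph \<Rightarrow> 'a \<Rightarrow> ('a \<Rightarrow> 'b) \<Rightarrow> 'b set \<Rightarrow> nat" where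
  "spine_size L u f T =
     (let F = preimage f L T; L' = collapse L F; u' = collapse_rel L F `` {u}
      in card (verts L' \<inter> spine L' u'))"

definition num_pairs ::
  "'a graph \<Rightarrow> 'a \<Rightarrow> ('a \<Rightarrow> 'b) \<Rightarrow> 'b graph \<Rightarrow> 'b set \<Rightarrow> 'b set \<Rightarrow> nat" where
  "num_pairs L u f D T y =
     (let F = preimage f L T; L' = collapse L F; u' = collapse_rel L F `` {u}
      in card (loop_pairs L' (extended_spine L' u') (induced_map f D T) (collapse D T) y))"

text \<open>The loops \<open>x 1\<close> and \<open>x 2\<close>, with their inverses, are the edges of the graph \<open>R\<close>.\<close>

definition loop_labelling :: "(nat \<Rightarrow> 'a) \<Rightarrow> 'a graph \<Rightarrow> bool" where
  "loop_labelling x R \<longleftrightarrow>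
     edges R = {x 1, inv_of R (x 1), x 2, inv_of R (x 2)} \<and> x 2 \<notin> {x 1, inv_of R (x 1)}"

end

theory Submission
  imports Defs
begin

text \<open>
  Collapse the spanning tree and its preimages. The coverings become coverings \<open>G\<^sub>1\<close>, \<open>G\<^sub>2\<close> of a graph
  with one vertex and two loops, the distinguished loop \<open>y\<close> and the other loop \<open>y'\<close>, and the spines
  become finite connected graphs \<open>S\<^sub>1\<close>, \<open>S\<^sub>2\<close> whose edges are labelled by \<open>y\<close> and \<open>y'\<close>. Write \<open>H\<^sub>j\<close>,
  \<open>a\<^sub>j\<close>, \<open>b\<^sub>j\<close> for the numbers of vertices, \<open>y\<close>-edges and \<open>y'\<close>-edges of \<open>S\<^sub>j\<close>.

  The \<open>y\<close>-edges decompose the vertices of \<open>S\<^sub>j\<close> into cycles and segments, and each segment extends at both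
  ends by an edge that leaves the spine, so the segments are the pairs: \<open>n\<^sub>j = H\<^sub>j - a\<^sub>j\<close>
  (\<open>card_loop_pairs\<close>). The Euler characteristic of \<open>S\<^sub>j\<close> then gives \<open>b\<^sub>j - n\<^sub>j = a\<^sub>j + b\<^sub>j - H\<^sub>j \<le> rk \<Lambda>\<^sub>j - 1\<close>
  (\<open>euler_le_rk\<close>, \<open>rk_collapse_le\<close>).

  A cycle of the pullback runs through edges that lie on cyclically reduced closed paths. These
  project to cyclically reduced closed paths, which stay in the spines (\<open>closed_path_in_spine\<close>). So all
  cycles live in the finite product of the spines, and since the spines are convex for reduced paths
  (\<open>spine_convex\<close>), so is the product; hence the cycles of one component \<open>\<Omega>\<close> live in one connected
  component \<open>K\<close> of the product. In \<open>K\<close> there are at most as many \<open>y\<close>-edges as vertices, because every vertex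
  starts at most one \<open>y\<close>-edge. The Euler characteristic of \<open>K\<close> therefore bounds \<open>rk \<Omega> - 1\<close> by the number of
  its \<open>y'\<close>-edges (\<open>card_independent_le\<close>). Summing over all \<open>\<Omega>\<close> gives at most the number \<open>b\<^sub>1 b\<^sub>2\<close> of all
  \<open>y'\<close>-edges of the product, and \<open>b\<^sub>1 b\<^sub>2\<close> is at most the right hand side by arithmetic (\<open>final_estimate\<close>):
  if \<open>b\<^sub>j - n\<^sub>j = rk \<Lambda>\<^sub>j - 1\<close>, the right hand side is \<open>b\<^sub>1 b\<^sub>2 + (H\<^sub>1 - b\<^sub>1) n\<^sub>2 + (H\<^sub>2 - b\<^sub>2) n\<^sub>1\<close>.

  The facts about spines rest on one argument. A reduced path either is simple or contains a simple
  closed path, and the chain of a simple reduced path does not vanish (\<open>simple_segment\<close>,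
  \<open>coeff_path_chain_hd\<close>). Hence a connected subgraph that contains all cycles contains every reduced
  path between its vertices (\<open>reduced_path_in_core\<close>): a detour outside would produce a new cycle.
\<close>

section \<open>Edge paths\<close>

lemma edge_in_cells: "e \<in> edges G \<Longrightarrow> e \<in> cells G"
  by (simp add: edges_def)

lemma vert_in_cells: "v \<in> verts G \<Longrightarrow> v \<in> cells G"
  by (simp add: verts_def)

lemma cells_split: "cells G = verts G \<union> edges G"
  by (auto simp: edges_def verts_def)

lemma verts_edges_disjoint: "v \<in> verts G \<Longrightarrow> v \<notin> edges G"
  by (simp add: edges_def)

lemma inv_inv: "is_graph G \<Longrightarrow> x \<in> cells G \<Longrightarrow> inv_of G (inv_of G x) = x"
  by (simp add: is_graph_def)

lemma inv_in_cells: "is_graph G \<Longrightarrow> x \<in> cells G \<Longrightarrow> inv_of G x \<in> cells G"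
  by (simp add: is_graph_def)

lemma inv_inv_edge: "is_graph G \<Longrightarrow> e \<in> edges G \<Longrightarrow> inv_of G (inv_of G e) = e"
  by (simp add: inv_inv edge_in_cells)

lemma inv_vert: "v \<in> verts G \<Longrightarrow> inv_of G v = v"
  by (simp add: verts_def)

lemma src_vert: "is_graph G \<Longrightarrow> v \<in> verts G \<Longrightarrow> src G v = v"
  by (simp add: is_graph_def)

lemma src_in_verts: "is_graph G \<Longrightarrow> x \<in> cells G \<Longrightarrow> src G x \<in> verts G"
  by (simp add: is_graph_def)

lemma tgt_in_verts: "is_graph G \<Longrightarrow> x \<in> cells G \<Longrightarrow> tgt G x \<in> verts G"
  by (simp add: tgt_def src_in_verts inv_in_cells)

lemma inv_in_edges: "is_graph G \<Longrightarrow> e \<in> edges G \<Longrightarrow> inv_of G e \<in> edges G"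
  by (auto simp: edges_def verts_def is_graph_def)

lemma inv_neq: "e \<in> edges G \<Longrightarrow> inv_of G e \<noteq> e"
  by (auto simp: edges_def verts_def)

lemma src_inv: "src G (inv_of G e) = tgt G e"
  by (simp add: tgt_def)

lemma tgt_inv: "is_graph G \<Longrightarrow> e \<in> cells G \<Longrightarrow> tgt G (inv_of G e) = src G e"
  by (simp add: tgt_def inv_inv)

lemmas graph_simps = inv_inv_edge inv_in_edges src_inv tgt_inv edge_in_cells
  src_in_verts tgt_in_verts

lemma edge_path_start: "is_graph G \<Longrightarrow> edge_path G u p v \<Longrightarrow> u \<in> verts G"
  by (cases p) (auto simp: src_in_verts edge_in_cells)

lemma edge_path_end: "edge_path G u p v \<Longrightarrow> v \<in> verts G"
  by (induction p arbitrary: u) auto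

lemma edge_path_edges: "edge_path G u p v \<Longrightarrow> set p \<subseteq> edges G"
  by (induction p arbitrary: u) auto

lemma edge_path_append:
  "is_graph G \<Longrightarrow> edge_path G u (p @ q) v \<longleftrightarrow> (\<exists>w. edge_path G u p w \<and> edge_path G w q v)"
  by (induction p arbitrary: u) (auto dest: edge_path_start)

lemma edge_path_appendI:
  "is_graph G \<Longrightarrow> edge_path G u p w \<Longrightarrow> edge_path G w q v \<Longrightarrow> edge_path G u (p @ q) v"
  by (auto simp: edge_path_append)

lemma edge_path_last: "edge_path G u p v \<Longrightarrow> p \<noteq> [] \<Longrightarrow> tgt G (last p) = v"
  by (induction p arbitrary: u) auto

lemma edge_path_snoc:
  "is_graph G \<Longrightarrow> edge_path G u (p @ [e]) v \<longleftrightarrow>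
     edge_path G u p (src G e) \<and> e \<in> edges G \<and> tgt G e = v"
  by (auto simp: edge_path_append graph_simps)

lemma dimension_preservingD:
  assumes "dimension_preserving f G H"
  shows "x \<in> cells G \<Longrightarrow> f x \<in> cells H" "v \<in> verts G \<Longrightarrow> f v \<in> verts H"
    "e \<in> edges G \<Longrightarrow> f e \<in> edges H" "x \<in> cells G \<Longrightarrow> f (src G x) = src H (f x)"
    "x \<in> cells G \<Longrightarrow> f (inv_of G x) = inv_of H (f x)"
    "is_graph G \<Longrightarrow> x \<in> cells G \<Longrightarrow> f (tgt G x) = tgt H (f x)"
  using assms by (auto simp: dimension_preserving_def graph_map_def tgt_def inv_in_cells)

lemma edge_path_map:
  assumes "is_graph G" "dimension_preserving f G H" "edge_path G u p v"
  shows "edge_path H (f u) (map f p) (f v)"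
  using assms(3)
proof (induction p arbitrary: u)
  case (Cons e p)
  have "f (tgt G e) = tgt H (f e)"
    using Cons.prems assms(1,2) by (auto intro!: dimension_preservingD(6) edge_in_cells)
  then show ?case
    using Cons dimension_preservingD[OF assms(2)] by (auto simp: edge_in_cells) metis
qed (auto simp: dimension_preservingD[OF assms(2)])

definition reverse_path :: "'a graph \<Rightarrow> 'a list \<Rightarrow> 'a list" where
  "reverse_path G p = rev (map (inv_of G) p)"

lemma edge_path_reverse:
  assumes "is_graph G" "edge_path G u p v"
  shows "edge_path G v (reverse_path G p) u"
  using assms(2)
  by (induction p arbitrary: u)
     (auto simp: reverse_path_def edge_path_snoc assms(1) graph_simps)

lemma set_reverse_path: "set (reverse_path G p) = inv_of G ` set p"
  by (simp add: reverse_path_def)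

lemma reduced_append:
  "reduced G (p @ q) \<longleftrightarrow>
     reduced G p \<and> reduced G q \<and> (p \<noteq> [] \<longrightarrow> q \<noteq> [] \<longrightarrow> hd q \<noteq> inv_of G (last p))"
  by (auto simp: reduced_def successively_append_iff)

lemma reduced_Cons:
  "reduced G (e # p) \<longleftrightarrow> reduced G p \<and> (p \<noteq> [] \<longrightarrow> hd p \<noteq> inv_of G e)"
  by (cases p) (auto simp: reduced_def)

lemma reduced_Nil [simp]: "reduced G []"
  by (simp add: reduced_def)

lemma reduced_single [simp]: "reduced G [e]"
  by (simp add: reduced_def)

lemma reduced_reverse:
  assumes "is_graph G" "set p \<subseteq> edges G" "reduced G p"
  shows "reduced G (reverse_path G p)"
  using assms(2,3)
proof (induction p)
  case (Cons e p)
  have "last (reverse_path G p) = inv_of G (hd p)" if "p \<noteq> []"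
    using that by (simp add: reverse_path_def last_rev hd_map)
  moreover have "hd p \<in> edges G" if "p \<noteq> []" using Cons.prems that by (auto simp: subset_iff)
  ultimately show ?case
    using Cons by (auto simp: reverse_path_def reduced_append reduced_Cons assms(1) graph_simps)
qed (simp add: reverse_path_def)

text \<open>Keeping track of the edges lets a path be reduced inside a subgraph, or while it avoids an arc.\<close>

lemma reduce_path:
  assumes "is_graph G" "edge_path G u p v"
  obtains q where "edge_path G u q v" "reduced G q" "set q \<subseteq> set p"
proof -
  have "\<exists>q. edge_path G u q v \<and> reduced G q \<and> set q \<subseteq> set p"
    using assms(2)
  proof (induction p arbitrary: u)
    case (Cons e p)
    then obtain q where q: "edge_path G (tgt G e) q v" "reduced G q" "set q \<subseteq> set p" by auto
    have e: "e \<in> edges G" "src G e = u" using Cons.prems by auto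
    show ?case
    proof (cases "q \<noteq> [] \<and> hd q = inv_of G e")
      case True
      then obtain q' where "q = inv_of G e # q'" by (cases q) auto
      then have "edge_path G u q' v \<and> reduced G q' \<and> set q' \<subseteq> set (e # p)"
        using q e assms(1) by (auto simp: graph_simps reduced_Cons)
      then show ?thesis by blast
    next
      case False
      then have "edge_path G u (e # q) v \<and> reduced G (e # q) \<and> set (e # q) \<subseteq> set (e # p)"
        using q e by (auto simp: reduced_Cons)
      then show ?thesis by blast
    qed
  qed (auto intro!: exI[of _ "[]"])
  then show ?thesis using that by blast
qed

subsection \<open>Subgraphs\<close>

lemma restrict_graph_simps [simp]:
  "cells (restrict_graph G S) = S" "inv_of (restrict_graph G S) = inv_of G"
  "src (restrict_graph G S) = src G" "tgt (restrict_graph G S) = tgt G"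
  by (auto simp: restrict_graph_def tgt_def)

lemma verts_restrict: "S \<subseteq> cells G \<Longrightarrow> verts (restrict_graph G S) = verts G \<inter> S"
  by (auto simp: verts_def)

lemma edges_restrict: "S \<subseteq> cells G \<Longrightarrow> edges (restrict_graph G S) = edges G \<inter> S"
  by (auto simp: verts_def edges_def)

lemma subgraph_cells: "subgraph S G \<Longrightarrow> S \<subseteq> cells G"
  by (simp add: subgraph_def)

lemma subgraph_tgt: "subgraph S G \<Longrightarrow> e \<in> S \<Longrightarrow> tgt G e \<in> S"
  by (simp add: subgraph_def tgt_def)

lemma subgraph_inv_iff: "is_graph G \<Longrightarrow> subgraph S G \<Longrightarrow> e \<in> cells G \<Longrightarrow> inv_of G e \<in> S \<longleftrightarrow> e \<in> S"
  by (metis inv_inv subgraph_def)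

lemma is_graph_restrict: "is_graph G \<Longrightarrow> subgraph S G \<Longrightarrow> is_graph (restrict_graph G S)"
  using verts_restrict[of S G] by (auto simp: is_graph_def subgraph_def subset_iff)

lemma edge_path_restrict:
  assumes "subgraph S G"
  shows "edge_path (restrict_graph G S) u p v \<longleftrightarrow> edge_path G u p v \<and> u \<in> S \<and> set p \<subseteq> S"
proof -
  have S: "S \<subseteq> cells G" using assms by (simp add: subgraph_def)
  have "src G e \<in> S" "tgt G e \<in> S" if "e \<in> S" for e
    using assms that by (auto simp: subgraph_def tgt_def)
  then show ?thesis
    by (induction p arbitrary: u) (auto simp: verts_restrict[OF S] edges_restrict[OF S])
qed

lemma reduced_restrict [simp]: "reduced (restrict_graph G S) p = reduced G p"
  by (simp add: reduced_def)

lemma edge_path_in_subgraph: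
  "subgraph S G \<Longrightarrow> edge_path G u p v \<Longrightarrow> u \<in> S \<Longrightarrow> set p \<subseteq> S \<Longrightarrow> v \<in> S"
  by (induction p arbitrary: u) (auto simp: subgraph_tgt)

lemma connected_restrictI:
  assumes G: "is_graph G" and S: "subgraph S G" and u: "u \<in> verts G" "u \<in> S"
    and p: "\<And>x. x \<in> verts G \<Longrightarrow> x \<in> S \<Longrightarrow> \<exists>p. edge_path G u p x \<and> set p \<subseteq> S"
  shows "connected_graph (restrict_graph G S)"
proof -
  have v: "verts (restrict_graph G S) = verts G \<inter> S" using S by (simp add: verts_restrict subgraph_cells)
  have "\<exists>p. edge_path (restrict_graph G S) a p b" if ab: "a \<in> verts G \<inter> S" "b \<in> verts G \<inter> S" for a b
  proof -
    obtain q r where qr: "edge_path G u q a" "set q \<subseteq> S" "edge_path G u r b" "set r \<subseteq> S"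
      using p[of a] p[of b] ab by auto
    have "set (reverse_path G q) \<subseteq> S" using qr S by (auto simp: set_reverse_path subgraph_def)
    moreover have "edge_path G a (reverse_path G q @ r) b"
      using qr G by (auto intro: edge_path_appendI edge_path_reverse)
    ultimately show ?thesis
      using ab qr by (intro exI[of _ "reverse_path G q @ r"]) (simp add: edge_path_restrict[OF S])
  qed
  then show ?thesis using u unfolding connected_graph_def v by blast
qed

lemma subgraph_component:
  assumes "is_graph G"
  shows "subgraph (component_of G x) G"
  unfolding subgraph_def
proof (intro conjI ballI)
  fix y assume "y \<in> component_of G x"
  then obtain p where y: "y \<in> cells G" and p: "edge_path G (src G x) p (src G y)"
    by (auto simp: component_of_def)
  show "src G y \<in> component_of G x"
    using y p assms by (auto simp: component_of_def src_vert src_in_verts intro: vert_in_cells)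
  show "inv_of G y \<in> component_of G x"
  proof (cases "y \<in> edges G")
    case True
    then have "edge_path G (src G x) (p @ [y]) (src G (inv_of G y))"
      using p assms by (simp add: edge_path_snoc graph_simps)
    then show ?thesis using y assms by (auto simp: component_of_def inv_in_cells)
  next
    case False
    then show ?thesis using y p by (auto simp: edges_def verts_def component_of_def)
  qed
qed (auto simp: component_of_def)

lemma component_self: "is_graph G \<Longrightarrow> x \<in> cells G \<Longrightarrow> x \<in> component_of G x"
  by (auto simp: component_of_def src_in_verts intro!: exI[of _ "[]"])

lemma component_eq:
  assumes "is_graph G" "y \<in> component_of G x"
  shows "component_of G y = component_of G x"
proof -
  obtain p where p: "edge_path G (src G x) p (src G y)"
    using assms by (auto simp: component_of_def)
  have "edge_path G (src G y) (reverse_path G p) (src G x)"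
    using assms(1) p by (rule edge_path_reverse)
  with p show ?thesis
    using assms(1) by (auto simp: component_of_def intro: edge_path_appendI)
qed

lemma edge_path_in_component:
  assumes "is_graph G" "u \<in> component_of G x" "edge_path G u p v"
  shows "set p \<subseteq> component_of G x"
  using assms(2,3)
proof (induction p arbitrary: u)
  case (Cons e p)
  have e: "e \<in> edges G" "src G e = u" using Cons.prems by auto
  have u: "u \<in> verts G" using e assms(1) by (auto simp: graph_simps)
  have "e \<in> component_of G x"
    using Cons.prems(1) e assms(1) src_vert[OF assms(1) u] by (auto simp: component_of_def graph_simps)
  moreover have "tgt G e \<in> component_of G x"
    using subgraph_tgt[OF subgraph_component[OF assms(1)]] calculation by auto
  ultimately show ?case using Cons by auto
qed simp

lemma connected_component:
  assumes "is_graph G" "x \<in> cells G"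
  shows "connected_graph (restrict_graph G (component_of G x))"
proof -
  let ?C = "component_of G x"
  have S: "subgraph ?C G" using assms(1) by (rule subgraph_component)
  have v: "verts (restrict_graph G ?C) = verts G \<inter> ?C"
    using S by (simp add: verts_restrict subgraph_cells)
  have "src G x \<in> verts G \<inter> ?C"
    using S component_self[OF assms] assms by (auto simp: subgraph_def src_in_verts)
  moreover have "\<exists>p. edge_path (restrict_graph G ?C) a p b" if "a \<in> verts G \<inter> ?C" "b \<in> verts G \<inter> ?C" for a b
  proof -
    have "b \<in> component_of G a" using that component_eq[OF assms(1)] by blast
    then have "\<exists>p. edge_path G a p b"
      using that assms(1) by (auto simp: component_of_def src_vert)
    then obtain p where "edge_path G a p b" by blast
    then show ?thesis
      using that edge_path_in_component[OF assms(1), of a x p b] by (auto simp: edge_path_restrict[OF S])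
  qed
  ultimately show ?thesis unfolding connected_graph_def v by blast
qed

section \<open>Cycles carried by paths\<close>

abbreviation coeff :: "('a \<Rightarrow>\<^sub>0 int) \<Rightarrow> 'a \<Rightarrow> int" where
  "coeff \<equiv> Poly_Mapping.lookup"

text \<open>The edge path \<open>p\<close> as a cellular chain: an antisymmetric chain has to carry the inverse of every
  edge with the opposite sign.\<close>

definition arc_chain :: "'a graph \<Rightarrow> 'a \<Rightarrow> ('a \<Rightarrow>\<^sub>0 int)" where
  "arc_chain G e = frag_of e - frag_of (inv_of G e)"

definition path_chain :: "'a graph \<Rightarrow> 'a list \<Rightarrow> ('a \<Rightarrow>\<^sub>0 int)" where
  "path_chain G p = sum_list (map (arc_chain G) p)"

lemma path_chain_simps [simp]:
  "path_chain G [] = 0" "path_chain G (e # p) = arc_chain G e + path_chain G p"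
  "path_chain G (p @ q) = path_chain G p + path_chain G q"
  by (simp_all add: path_chain_def)

lemma arc_chain_inv: "is_graph G \<Longrightarrow> e \<in> edges G \<Longrightarrow> arc_chain G (inv_of G e) = - arc_chain G e"
  by (simp add: arc_chain_def graph_simps)

lemma coeff_arc_chain:
  "coeff (arc_chain G e) f = (if f = e then 1 else 0) - (if f = inv_of G e then 1 else 0)"
  by (simp add: arc_chain_def lookup_minus)

lemma keys_path_chain: "Poly_Mapping.keys (path_chain G p) \<subseteq> set p \<union> inv_of G ` set p"
proof (induction p)
  case (Cons e p)
  have "Poly_Mapping.keys (arc_chain G e) \<subseteq> {e, inv_of G e}"
    by (auto simp: in_keys_iff coeff_arc_chain split: if_splits)
  then show ?case
    using Cons Poly_Mapping.keys_add[of "arc_chain G e" "path_chain G p"] by auto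
qed simp

lemma path_chain_chains1:
  assumes "is_graph G" "set p \<subseteq> edges G"
  shows "path_chain G p \<in> chains1 G"
proof -
  have "coeff (path_chain G p) (inv_of G f) = - coeff (path_chain G p) f" if "f \<in> edges G" for f
    using assms(2)
  proof (induction p)
    case (Cons e p)
    have "inv_of G f = inv_of G e \<longleftrightarrow> f = e" "inv_of G f = e \<longleftrightarrow> f = inv_of G e"
      using Cons.prems that assms(1) by (auto simp: graph_simps) (metis inv_inv_edge)+
    then show ?case using Cons
      by (auto simp: lookup_add coeff_arc_chain)
  qed simp
  moreover have "Poly_Mapping.keys (path_chain G p) \<subseteq> edges G"
    using keys_path_chain[of G p] assms inv_in_edges[OF assms(1)] by fastforce
  ultimately show ?thesis by (simp add: chains1_def)
qed

lemma boundary_path_chain: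
  assumes "is_graph G" "edge_path G u p v"
  shows "boundary1 G (path_chain G p) = frag_of v - frag_of u"
  using assms(2)
  by (induction p arbitrary: u)
     (auto simp: boundary1_def frag_extend_add frag_extend_diff arc_chain_def assms(1) graph_simps)

lemma closed_path_chain_H1:
  assumes "is_graph G" "edge_path G u p u"
  shows "path_chain G p \<in> H1 G"
  using boundary_path_chain[OF assms] path_chain_chains1[OF assms(1) edge_path_edges[OF assms(2)]]
  by (simp add: H1_def)

text \<open>The inverse of the first edge cannot occur and cancel it: it starts where the second edge
  starts, so it would be the second edge, which reducedness forbids.\<close>

lemma coeff_path_chain_hd:
  assumes "is_graph G" "edge_path G u p v" "reduced G p" "distinct (map (src G) p)" "p \<noteq> []"
  shows "coeff (path_chain G p) (hd p) = 1"
proof -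
  obtain e q where p: "p = e # q" using assms(5) by (cases p) auto
  have e: "e \<in> edges G" "edge_path G (tgt G e) q v" using assms(2) p by auto
  have ne: "e \<notin> set q" using assms(4) p by auto
  have "inv_of G e \<notin> set q"
  proof
    assume i: "inv_of G e \<in> set q"
    then obtain f r where q: "q = f # r" by (cases q) auto
    have "src G f = src G (inv_of G e)" using e q by (simp add: src_inv)
    moreover have "inj_on (src G) (set q)" using assms(4) p by (simp add: distinct_map)
    ultimately have "f = inv_of G e" using i q by (auto simp: inj_on_def)
    then show False using assms(3) p q by (simp add: reduced_Cons)
  qed
  have "inv_of G e \<noteq> e" using e(1) by (rule inv_neq)
  have "coeff (path_chain G q) e = 0" if "e \<notin> set q" "e \<notin> inv_of G ` set q"
    using that keys_path_chain[of G q] by (auto simp: in_keys_iff)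
  moreover have "e \<notin> inv_of G ` set q"
  proof
    assume "e \<in> inv_of G ` set q"
    then obtain g where g: "g \<in> set q" "e = inv_of G g" by auto
    have "g \<in> edges G" using g edge_path_edges[OF e(2)] by auto
    then have "inv_of G e = g" using g assms(1) by (simp add: inv_inv_edge)
    then show False using g \<open>inv_of G e \<notin> set q\<close> by simp
  qed
  ultimately show "coeff (path_chain G p) (hd p) = 1"
    using p ne \<open>inv_of G e \<noteq> e\<close> by (simp add: lookup_add coeff_arc_chain)
qed

lemma maximal_prefix:
  assumes "P []"
  shows "\<exists>s t. r = s @ t \<and> P s \<and> (t = [] \<or> \<not> P (s @ [hd t]))"
proof (induction r rule: rev_induct)
  case (snoc x r)
  then obtain s t where st: "r = s @ t" "P s" "t = [] \<or> \<not> P (s @ [hd t])" by blast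
  show ?case
  proof (cases "t = []")
    case True
    show ?thesis
    proof (cases "P (r @ [x])")
      case True
      then show ?thesis by (intro exI[of _ "r @ [x]"] exI[of _ "[]"]) simp
    next
      case False
      then show ?thesis using st True by (intro exI[of _ r] exI[of _ "[x]"]) simp
    qed
  next
    case False
    then show ?thesis using st by (intro exI[of _ s] exI[of _ "t @ [x]"]) simp
  qed
qed (use assms in simp)

text \<open>Follow the path until it first meets \<open>K\<close> or one of its own earlier vertices. In the second case
  the part since that earlier vertex is closed. No source repeats in the resulting path, so that its
  chain does not vanish.\<close>

lemma simple_segment:
  assumes G: "is_graph G" and p: "edge_path G u p v" "reduced G p" "p \<noteq> []"
    and K: "subgraph K G" "hd p \<notin> K" "v \<in> K \<or> v = u"
  obtains a w b where "edge_path G a w b" "reduced G w" "distinct (map (src G) w)" "w \<noteq> []"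
    "set w \<subseteq> set p - K" "a = b \<or> a = u \<and> b \<in> K"
proof -
  let ?P = "\<lambda>s. distinct (map (src G) s) \<and> set s \<inter> K = {}"
  obtain s t where st: "p = s @ t" "?P s" "t = [] \<or> \<not> ?P (s @ [hd t])"
    using maximal_prefix[of ?P p] by auto
  have s: "s \<noteq> []"
  proof
    assume "s = []"
    then show False using st p K by (cases t) auto
  qed
  obtain b where b: "edge_path G u s b" "edge_path G b t v"
    using p st G by (auto simp: edge_path_append)
  have red: "reduced G s" using p st by (simp add: reduced_append)
  consider (stop) "t = []" | (K) f t' where "t = f # t'" "f \<in> K"
    | (rep) f t' where "t = f # t'" "src G f \<in> src G ` set s"
    using st by (cases t) auto
  then show ?thesis
  proof cases
    case stop
    then have "v = b" using b by simp
    then show ?thesis using that[of u s b] b red s st K(3) by auto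
  next
    case K
    then have "b \<in> K" using b K(2) assms(5) by (auto simp: subgraph_def)
    then show ?thesis using that[of u s b] b red s st by auto
  next
    case rep
    then obtain g where g: "g \<in> set s" "src G g = b" using b by auto
    then obtain s1 s2 where s12: "s = s1 @ g # s2" by (meson split_list)
    then have "edge_path G b (g # s2) b"
      using b(1) g G by (auto simp: edge_path_append)
    moreover have "reduced G (g # s2)" using red s12 by (simp add: reduced_append)
    moreover have "distinct (map (src G) (g # s2))" "set (g # s2) \<inter> K = {}"
      using st(2) s12 by auto
    moreover have "set (g # s2) \<subseteq> set p" using st(1) s12 by auto
    ultimately show ?thesis using that[of b "g # s2" b] by blast
  qed
qed

text \<open>Inserting a backtracking does not change the chain of a path.\<close>

lemma simply_connected_closed_chain:
  assumes "simply_connected_graph G" "edge_path G u p u" "is_graph G"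
  shows "path_chain G p = 0"
proof -
  have u: "u \<in> verts G" using assms(3,2) by (rule edge_path_start)
  have "homotopic_paths G u u p []"
    using assms u by (auto simp: simply_connected_graph_def)
  moreover have "path_chain G q = path_chain G r" if "homotopic_paths G u u q r" for q r
    using that unfolding homotopic_paths_def
  proof (induction rule: equivclp_induct)
    case (step y z)
    have "path_chain G y = path_chain G z" if "insert_backtrack G u u y z" for y z
      using that assms(3) by (auto simp: insert_backtrack_def arc_chain_inv)
    then show ?case using step by metis
  qed simp
  ultimately show ?thesis by fastforce
qed

lemma simple_closed_path_chain:
  assumes "is_graph G" "edge_path G u p u" "reduced G p" "p \<noteq> []"
  obtains a w where "edge_path G a w a" "path_chain G w \<noteq> 0" "set w \<subseteq> set p"
proof -
  have "subgraph {} G" by (simp add: subgraph_def)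
  then obtain a w b where w: "edge_path G a w b" "reduced G w" "distinct (map (src G) w)" "w \<noteq> []"
    "set w \<subseteq> set p - {}" "a = b \<or> a = u \<and> b \<in> {}"
    using simple_segment[OF assms, of "{}"] by blast
  then have "path_chain G w \<noteq> 0"
    using coeff_path_chain_hd[OF assms(1) w(1-4)] by auto
  then show ?thesis using that w by auto
qed

text \<open>Otherwise the path would contain a simple closed path with nonzero chain. Comparing chains takes the
  place of the uniqueness of reduced forms of homotopic paths.\<close>

lemma simply_connected_reduced_closed:
  assumes "simply_connected_graph G" "is_graph G" "edge_path G u p u" "reduced G p"
  shows "p = []"
  using simple_closed_path_chain[OF assms(2-4)] simply_connected_closed_chain[OF assms(1)] assms(2)
  by metis

text \<open>A closed path that is not null-homotopic is homotopic to a nonempty reduced one, which contains a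
  simple closed path.\<close>

lemma not_simply_connected_H1:
  assumes "is_graph G" "connected_graph G" "\<not> simply_connected_graph G"
  obtains c where "c \<in> H1 G" "c \<noteq> 0"
proof -
  obtain u p where p: "edge_path G u p u" "\<not> homotopic_paths G u u p []"
    using assms by (auto simp: simply_connected_graph_def)
  have reds: "\<exists>q. reduced G q \<and> edge_path G a q b \<and> homotopic_paths G a b r q"
    if "edge_path G a r b" for a r b
    using that
  proof (induction r arbitrary: a)
    case Nil
    then show ?case by (auto intro!: exI[of _ "[]"] simp: homotopic_paths_def)
  next
    case (Cons e r)
    then obtain q where q: "reduced G q" "edge_path G (tgt G e) q b"
      "homotopic_paths G (tgt G e) b r q" by auto
    have e: "e \<in> edges G" "src G e = a" using Cons.prems by auto
    have "homotopic_paths G a b (e # r) (e # q)"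
      using q(3) unfolding homotopic_paths_def
    proof (induction rule: equivclp_induct)
      case (step y z)
      have "insert_backtrack G a b (e # y) (e # z)" if bt: "insert_backtrack G (tgt G e) b y z" for y z
      proof -
        obtain l f r' where "f \<in> edges G" "y = l @ r'" "z = l @ [f, inv_of G f] @ r'"
          using bt by (auto simp: insert_backtrack_def)
        then have "e # y = (e # l) @ r'" "e # z = (e # l) @ [f, inv_of G f] @ r'" by auto
        then show ?thesis
          using bt e \<open>f \<in> edges G\<close> unfolding insert_backtrack_def
          by (metis edge_path.simps(2))
      qed
      then show ?case using step by (meson equivclp_into_equivclp)
    qed simp
    show ?case
    proof (cases "q \<noteq> [] \<and> hd q = inv_of G e")
      case True
      then obtain q' where q': "q = inv_of G e # q'" by (cases q) auto
      have p': "edge_path G a q' b" using q q' e assms(1) by (auto simp: graph_simps)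
      have "insert_backtrack G a b q' (e # q)"
        using p' q q' e unfolding insert_backtrack_def by (auto intro!: exI[of _ "[]"])
      then have "homotopic_paths G a b (e # r) q'"
        using \<open>homotopic_paths G a b (e # r) (e # q)\<close> unfolding homotopic_paths_def
        by (meson equivclp_into_equivclp)
      then show ?thesis using p' q q' by (auto simp: reduced_Cons)
    next
      case False
      then have "reduced G (e # q)" "edge_path G a (e # q) b" using q e by (auto simp: reduced_Cons)
      then show ?thesis using \<open>homotopic_paths G a b (e # r) (e # q)\<close> by blast
    qed
  qed
  obtain q where q: "reduced G q" "edge_path G u q u" "homotopic_paths G u u p q"
    using reds[OF p(1)] by blast
  then have "q \<noteq> []" using p(2) by auto
  then obtain a w where "edge_path G a w a" "path_chain G w \<noteq> 0"
    using simple_closed_path_chain[OF assms(1) q(2,1)] by blast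
  then show ?thesis using that closed_path_chain_H1[OF assms(1)] by blast
qed

lemma H1_antisym: "c \<in> H1 G \<Longrightarrow> e \<in> edges G \<Longrightarrow> coeff c (inv_of G e) = - coeff c e"
  by (simp add: H1_def chains1_def)

lemma H1_keys: "c \<in> H1 G \<Longrightarrow> Poly_Mapping.keys c \<subseteq> edges G"
  by (simp add: H1_def chains1_def)

lemma H1_restrict:
  assumes "is_graph G" "subgraph S G"
  shows "H1 (restrict_graph G S) = {c \<in> H1 G. Poly_Mapping.keys c \<subseteq> S}"
proof -
  have "chains1 (restrict_graph G S) = {c \<in> chains1 G. Poly_Mapping.keys c \<subseteq> S}"
  proof -
    have "coeff c (inv_of G e) = - coeff c e"
      if "Poly_Mapping.keys c \<subseteq> S" "\<forall>e\<in>edges G \<inter> S. coeff c (inv_of G e) = - coeff c e" "e \<in> edges G" for c e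
    proof (cases "e \<in> S")
      case False
      then have "inv_of G e \<notin> S" using assms that by (simp add: subgraph_inv_iff edge_in_cells)
      then have "coeff c e = 0" "coeff c (inv_of G e) = 0"
        using that(1) False by (auto simp: in_keys_iff subset_iff)
      then show ?thesis by simp
    qed (use that in auto)
    then show ?thesis
      using assms by (auto simp: chains1_def edges_restrict subgraph_cells)
  qed
  then show ?thesis by (auto simp: H1_def boundary1_def)
qed

lemma frag_extend_frag_extend:
  "frag_extend f (frag_extend g c) = frag_extend (\<lambda>x. frag_extend f (g x)) c"
proof -
  have "Poly_Mapping.keys c \<subseteq> UNIV" by simp
  then show ?thesis
    by (induction c rule: frag_induction) (auto simp: frag_extend_diff)
qed

lemma coeff_frag_extend:
  "coeff (frag_extend f c) y = (\<Sum>x\<in>Poly_Mapping.keys c. coeff c x * coeff (f x) y)"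
  by (simp add: frag_extend_def lookup_sum)

text \<open>Otherwise the boundary, summed over the vertices that can be reached from the end of
  \<open>e\<close> without crossing this arc, would be the coefficient of \<open>e\<close>: all other arcs at these
  vertices have both ends among them and cancel.\<close>

lemma cycle_edge_not_bridge:
  assumes G: "is_graph G" and c: "c \<in> H1 G" and e: "e \<in> Poly_Mapping.keys c"
  obtains p where "edge_path G (tgt G e) p (src G e)" "e \<notin> set p" "inv_of G e \<notin> set p"
proof -
  define X where "X = {w. \<exists>p. edge_path G (tgt G e) p w \<and> e \<notin> set p \<and> inv_of G e \<notin> set p}"
  let ?k = "Poly_Mapping.keys c"
  have ee: "e \<in> edges G" using H1_keys[OF c] e by auto
  have "src G e \<in> X"
  proof (rule ccontr)
    assume nX: "src G e \<notin> X"
    have tX: "tgt G e \<in> X" using ee G by (auto simp: X_def graph_simps intro!: exI[of _ "[]"])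
    have fe: "f = e" if f: "f \<in> ?k" "tgt G f \<in> X" "src G f \<notin> X" for f
    proof (rule ccontr)
      assume "f \<noteq> e"
      have fE: "f \<in> edges G" using f H1_keys[OF c] by auto
      obtain p where p: "edge_path G (tgt G e) p (tgt G f)" "e \<notin> set p" "inv_of G e \<notin> set p"
        using f by (auto simp: X_def)
      have "edge_path G (tgt G e) (p @ [inv_of G f]) (src G f)"
        using p fE G by (simp add: edge_path_snoc graph_simps)
      then have "inv_of G f = e \<or> inv_of G f = inv_of G e"
        using f(3) p by (auto simp: X_def)
      then have "inv_of G f = e"
        using \<open>f \<noteq> e\<close> fE ee G by (metis inv_inv_edge)
      then have "src G e = tgt G f" by (simp add: tgt_def)
      then show False using f nX by simp
    qed
    let ?A = "{f \<in> ?k. tgt G f \<in> X \<and> src G f \<in> X}"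
    have "(\<Sum>f\<in>?A. coeff c f) = (\<Sum>f\<in>?A. coeff c (inv_of G f))"
    proof (rule sum.reindex_bij_witness[of _ "inv_of G" "inv_of G"])
      fix f assume f: "f \<in> ?A"
      then have fE: "f \<in> edges G" using H1_keys[OF c] by auto
      show "inv_of G (inv_of G f) = f" "inv_of G (inv_of G f) = f" using fE G by (simp_all add: graph_simps)
      show "inv_of G f \<in> ?A" "inv_of G f \<in> ?A"
        using f fE G H1_antisym[OF c fE] by (auto simp: graph_simps in_keys_iff)
      show "coeff c (inv_of G (inv_of G f)) = coeff c f" using fE G by (simp add: graph_simps)
    qed
    also have "\<dots> = (\<Sum>f\<in>?A. - coeff c f)"
      using H1_antisym[OF c] H1_keys[OF c] by (intro sum.cong) auto
    finally have A0: "(\<Sum>f\<in>?A. coeff c f) = 0" by (simp add: sum_negf)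
    \<comment> \<open>The sum over \<open>X\<close> of the coefficients of a 0-chain is its image under a map to the chains of a point.\<close>
    let ?chi = "\<lambda>w. if w \<in> X then frag_of () else 0"
    have "frag_extend ?chi (boundary1 G c) = 0" using c by (simp add: H1_def)
    then have "frag_extend (\<lambda>f. ?chi (tgt G f)) c = 0"
      by (simp add: boundary1_def frag_extend_frag_extend)
    then have "coeff (frag_extend (\<lambda>f. ?chi (tgt G f)) c) () = 0" by simp
    then have "0 = (\<Sum>f\<in>?k. coeff c f * coeff (?chi (tgt G f)) ())"
      by (simp only: coeff_frag_extend)
    also have "\<dots> = (\<Sum>f\<in>insert e ?A. coeff c f)"
    proof (rule sum.mono_neutral_cong_right)
      show "insert e ?A \<subseteq> ?k" using e by auto
      show "\<forall>f\<in>?k - insert e ?A. coeff c f * coeff (?chi (tgt G f)) () = 0"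
        using fe by (auto split: if_splits)
      show "coeff c f * coeff (?chi (tgt G f)) () = coeff c f" if "f \<in> insert e ?A" for f
        using that tX by auto
    qed simp
    also have "\<dots> = coeff c e"
      using A0 nX by (subst sum.insert) auto
    finally show False using e by (simp add: in_keys_iff)
  qed
  then show ?thesis using that by (auto simp: X_def)
qed

text \<open>Close \<open>e\<close> up by a reduced path that avoids its arc. Reducedness of \<open>w @ w\<close> says that \<open>w\<close> is
  cyclically reduced.\<close>

lemma cycle_edge_on_closed_path:
  assumes G: "is_graph G" and c: "c \<in> H1 G" and e: "e \<in> Poly_Mapping.keys c"
  obtains w where "edge_path G (src G e) w (src G e)" "reduced G (w @ w)" "e \<in> set w"
proof -
  have ee: "e \<in> edges G" using H1_keys[OF c] e by auto
  obtain p where p: "edge_path G (tgt G e) p (src G e)" "e \<notin> set p" "inv_of G e \<notin> set p"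
    using cycle_edge_not_bridge[OF assms] by blast
  obtain q where q: "edge_path G (tgt G e) q (src G e)" "reduced G q" "set q \<subseteq> set p"
    using reduce_path[OF G p(1)] by blast
  have 1: "hd q \<noteq> inv_of G e" "e \<noteq> inv_of G (last q)" if "q \<noteq> []"
  proof -
    show "hd q \<noteq> inv_of G e" using that p q by (metis hd_in_set subsetD)
    have "last q \<in> set p" "last q \<in> edges G" using that q edge_path_edges[OF q(1)] by auto
    then show "e \<noteq> inv_of G (last q)" using p G by (metis inv_inv_edge)
  qed
  have "reduced G ((e # q) @ (e # q))"
    using 1 q(2) inv_neq[OF ee]
    by (cases "q = []") (auto simp: reduced_append reduced_Cons)
  then show ?thesis using that[of "e # q"] ee q by auto
qed

section \<open>Subgraphs that carry all cycles are convex\<close>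

text \<open>A detour outside \<open>K\<close> contains a simple closed path outside \<open>K\<close>, or is itself simple and can be closed
  up inside \<open>K\<close>. Both give a cycle with an edge outside \<open>K\<close>.\<close>

lemma reduced_path_in_core:
  assumes G: "is_graph G" and K: "subgraph K G" "connected_graph (restrict_graph G K)"
    and H: "\<And>c. c \<in> H1 G \<Longrightarrow> Poly_Mapping.keys c \<subseteq> K"
    and p: "edge_path G u p v" "reduced G p" "u \<in> K" "v \<in> K"
  shows "set p \<subseteq> K"
proof (rule ccontr)
  assume "\<not> set p \<subseteq> K"
  then have "\<exists>x\<in>set p. x \<notin> K" by auto
  then obtain p0 e p1 where sp: "p = p0 @ e # p1" "e \<notin> K" "\<forall>x\<in>set p0. x \<in> K"
    using split_list_first_prop[of p "\<lambda>x. x \<notin> K"] by blast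
  have p0: "edge_path G u p0 (src G e)" "edge_path G (src G e) (e # p1) v"
    using p sp G by (auto simp: edge_path_append)
  have sK: "src G e \<in> K"
    using edge_path_in_subgraph[OF K(1) p0(1) p(3)] sp by auto
  have "reduced G (e # p1)" using p sp by (simp add: reduced_append)
  then obtain a w b where w: "edge_path G a w b" "reduced G w" "distinct (map (src G) w)" "w \<noteq> []"
    "set w \<subseteq> set (e # p1) - K" "a = b \<or> a = src G e \<and> b \<in> K"
    using simple_segment[OF G p0(2) _ _ K(1)] sp p(4) by auto
  have vab: "a \<in> verts G" "b \<in> verts G"
    using w(1) G edge_path_start edge_path_end by metis+
  have "\<exists>k. edge_path G b k a \<and> set k \<subseteq> K"
  proof (cases "a = b")
    case True
    then show ?thesis using vab by (intro exI[of _ "[]"]) auto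
  next
    case False
    then have "a \<in> K" "b \<in> K" using w sK by auto
    then have "\<exists>k. edge_path (restrict_graph G K) b k a"
      using K vab unfolding connected_graph_def by (simp add: verts_restrict subgraph_cells)
    then show ?thesis by (auto simp: edge_path_restrict[OF K(1)])
  qed
  then obtain k where k: "edge_path G b k a" "set k \<subseteq> K" by blast
  have "path_chain G (w @ k) \<in> H1 G"
    using w(1) k(1) G by (intro closed_path_chain_H1) (auto intro: edge_path_appendI)
  moreover have "hd w \<notin> K" using w(4,5) hd_in_set[of w] by (meson DiffD2 subsetD)
  moreover have "coeff (path_chain G k) (hd w) = 0"
  proof -
    have "inv_of G ` set k \<subseteq> K" using k K(1) by (auto simp: subgraph_def)
    then show ?thesis using keys_path_chain[of G k] k(2) \<open>hd w \<notin> K\<close>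
      by (metis Un_iff in_keys_iff subsetD)
  qed
  then have "coeff (path_chain G (w @ k)) (hd w) = 1"
    using coeff_path_chain_hd[OF G w(1-4)] by (simp add: lookup_add)
  then have "hd w \<in> Poly_Mapping.keys (path_chain G (w @ k))" by (simp add: in_keys_iff)
  ultimately show False using H by blast
qed

section \<open>The spine\<close>

lemma subgraph_spine:
  assumes "is_graph G" "u \<in> verts G"
  shows "subgraph (spine G u) G"
proof -
  have arc: "{e, inv_of G e, src G e, tgt G e} \<subseteq> cells G \<and>
      (\<forall>x\<in>{e, inv_of G e, src G e, tgt G e}.
         inv_of G x \<in> {e, inv_of G e, src G e, tgt G e} \<and> src G x \<in> {e, inv_of G e, src G e, tgt G e})"
    if "e \<in> edges G" for e
    using that assms(1)
    by (simp add: graph_simps vert_in_cells inv_in_cells inv_vert src_vert)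
  have E: "e \<in> edges G" if "edge_path G u es u" "e \<in> set es" for e es
    using edge_path_edges[OF that(1)] that(2) by auto
  have "u \<in> cells G \<and> inv_of G u = u \<and> src G u = u"
    using assms by (simp add: vert_in_cells inv_vert src_vert)
  then show ?thesis
    unfolding subgraph_def spine_def using arc E by (safe; blast)
qed

lemma base_in_spine: "u \<in> spine G u"
  by (simp add: spine_def)

lemma path_in_spine: "edge_path G u p u \<Longrightarrow> reduced G p \<Longrightarrow> set p \<subseteq> spine G u"
  by (auto simp: spine_def)

lemma spine_reachable:
  assumes "is_graph G" "u \<in> verts G" "x \<in> spine G u"
  shows "\<exists>p. edge_path G u p (src G x) \<and> set p \<subseteq> spine G u"
proof (cases "x = u")
  case True
  then show ?thesis using assms by (intro exI[of _ "[]"]) (simp add: src_vert)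
next
  case False
  then obtain es e where e: "edge_path G u es u" "reduced G es" "e \<in> set es"
    "x \<in> {e, inv_of G e, src G e, tgt G e}"
    using assms by (auto simp: spine_def)
  obtain a b where ab: "es = a @ e # b" using e(3) by (meson split_list)
  have eE: "e \<in> edges G" using edge_path_edges[OF e(1)] e(3) by auto
  have "src G x = src G e \<or> src G x = tgt G e"
    using e(4) eE assms by (auto simp: graph_simps src_vert)
  moreover have "edge_path G u a (src G e)" "edge_path G u (a @ [e]) (tgt G e)"
    using e(1) ab assms by (auto simp: edge_path_append intro: edge_path_end edge_path_start)
  moreover have "set (a @ [e]) \<subseteq> spine G u" using path_in_spine[OF e(1,2)] ab by auto
  ultimately show ?thesis
    by (metis Un_subset_iff set_append)
qed

lemma connected_spine:
  assumes "is_graph G" "u \<in> verts G"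
  shows "connected_graph (restrict_graph G (spine G u))"
proof (rule connected_restrictI[OF assms(1) subgraph_spine[OF assms] assms(2) base_in_spine])
  fix x assume "x \<in> verts G" "x \<in> spine G u"
  then show "\<exists>p. edge_path G u p x \<and> set p \<subseteq> spine G u"
    using spine_reachable[OF assms, of x] assms(1) by (simp add: src_vert)
qed

text \<open>A shortest path \<open>h\<close> from the base point to \<open>w\<close> meets \<open>w\<close> only at its end, so running along \<open>h\<close>,
  around \<open>w\<close> and back is reduced.\<close>

lemma closed_path_in_spine:
  assumes G: "is_graph G" "connected_graph G" "u \<in> verts G"
    and w: "edge_path G a w a" "reduced G (w @ w)"
  shows "set w \<subseteq> spine G u"
proof (cases "w = []")
  case False
  let ?V = "src G ` set w"
  let ?P = "\<lambda>h. reduced G h \<and> (\<exists>b\<in>?V. edge_path G u h b)"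
  have "src G (hd w) \<in> ?V" "src G (hd w) \<in> verts G"
    using False edge_path_edges[OF w(1)] G by (auto simp: graph_simps subset_iff)
  moreover obtain h0 where "edge_path G u h0 (src G (hd w))"
    using G calculation unfolding connected_graph_def by blast
  then obtain h1 where "edge_path G u h1 (src G (hd w))" "reduced G h1"
    using reduce_path[OF G(1)] by blast
  ultimately have "\<exists>h. ?P h" by blast
  then obtain h where h: "?P h" and hmin: "\<And>h'. ?P h' \<Longrightarrow> length h \<le> length h'"
    using ex_has_least_nat[of ?P _ length] by blast
  obtain f where f: "f \<in> set w" "edge_path G u h (src G f)" using h by auto
  obtain w1 w2 where w12: "w = w1 @ f # w2" using f(1) by (meson split_list)
  define w' where "w' = f # w2 @ w1"
  have sw: "set w' = set w" and ne: "w' \<noteq> []" by (auto simp: w'_def w12)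
  have pw: "edge_path G (src G f) w' (src G f)"
    using w(1) G(1) by (auto simp: w'_def w12 edge_path_append)
  have "w @ w = w1 @ w' @ f # w2" by (simp add: w12 w'_def)
  then have rw: "reduced G w'" using w(2) by (simp add: reduced_append)
  have tV: "tgt G (hd w') \<in> ?V"
  proof (cases "w2 @ w1")
    case Nil
    then show ?thesis using pw f by (auto simp: w'_def)
  next
    case (Cons g r)
    then have "tgt G f = src G g" "g \<in> set w" using pw sw by (auto simp: w'_def)
    then show ?thesis by (simp add: w'_def)
  qed
  have lV: "src G (last w') \<in> ?V" using last_in_set[OF ne] sw by auto
  have dV: "src G (last h) \<notin> ?V" if "h \<noteq> []"
  proof
    assume d: "src G (last h) \<in> ?V"
    have "h = butlast h @ [last h]" using that by simp
    then have "reduced G (butlast h)" "edge_path G u (butlast h) (src G (last h))"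
      using h f(2) G(1) by (metis reduced_append, metis edge_path_snoc)
    then have "length h \<le> length (butlast h)" using d by (intro hmin) blast
    then show False using that by (cases h rule: rev_cases) auto
  qed
  have hE: "set h \<subseteq> edges G" using f(2) by (rule edge_path_edges)
  have "reduced G (h @ w' @ reverse_path G h)"
    unfolding reduced_append
  proof (intro conjI impI)
    show "reduced G h" using h by simp
    show "reduced G (reverse_path G h)" using h hE G by (intro reduced_reverse) auto
    show "reduced G w'" by (rule rw)
    { assume hn: "reverse_path G h \<noteq> []"
      then have hn': "h \<noteq> []" by (auto simp: reverse_path_def)
      have "hd (reverse_path G h) = inv_of G (last h)" using hn' by (simp add: reverse_path_def hd_rev last_map)
      moreover have "last h \<in> edges G" "last w' \<in> edges G"
        using hE hn' edge_path_edges[OF pw] last_in_set[OF ne] by auto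
      ultimately show "hd (reverse_path G h) \<noteq> inv_of G (last w')"
        using dV[OF hn'] lV G(1) by (metis inv_inv_edge) }
    { assume hn': "h \<noteq> []"
      have "last h \<in> edges G" using hE hn' by auto
      then have "tgt G (inv_of G (last h)) = src G (last h)" using G(1) by (simp add: graph_simps)
      then show "hd (w' @ reverse_path G h) \<noteq> inv_of G (last h)"
        using dV[OF hn'] tV ne by auto }
  qed
  moreover have "edge_path G u (h @ w' @ reverse_path G h) u"
    using f(2) pw edge_path_reverse[OF G(1) f(2)] G(1) by (auto intro: edge_path_appendI)
  ultimately have "set (h @ w' @ reverse_path G h) \<subseteq> spine G u" by (intro path_in_spine)
  then show ?thesis using sw by auto
qed simp

lemma cycles_in_spine:
  assumes G: "is_graph G" "connected_graph G" "u \<in> verts G" and c: "c \<in> H1 G"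
  shows "Poly_Mapping.keys c \<subseteq> spine G u"
proof
  fix e assume "e \<in> Poly_Mapping.keys c"
  then show "e \<in> spine G u"
    using cycle_edge_on_closed_path[OF G(1) c] closed_path_in_spine[OF G] by (metis subsetD)
qed

text \<open>The complement of the spine consists of trees; convexity expresses this as: a reduced path that
  enters one of them does not return.\<close>

lemma spine_convex:
  assumes "is_graph G" "connected_graph G" "u \<in> verts G"
    and "edge_path G a p b" "reduced G p" "a \<in> spine G u" "b \<in> spine G u"
  shows "set p \<subseteq> spine G u"
  using reduced_path_in_core[OF assms(1) subgraph_spine connected_spine cycles_in_spine] assms
  by blast

section \<open>Rank\<close>

lemma module_frag: "module frag_cmul"
  by unfold_locales (auto simp: frag_cmul_distrib frag_cmul_distrib2)

abbreviation independent :: "('a \<Rightarrow>\<^sub>0 int) set \<Rightarrow> bool" where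
  "independent B \<equiv> \<not> module.dependent frag_cmul B"

lemma independent_iff:
  assumes "finite B"
  shows "independent B \<longleftrightarrow> (\<forall>m. (\<Sum>b\<in>B. frag_cmul (m b) b) = 0 \<longrightarrow> (\<forall>b\<in>B. m b = 0))"
  using module.dependent_finite[OF module_frag assms] by auto

lemma independentD:
  "finite B \<Longrightarrow> independent B \<Longrightarrow> (\<Sum>b\<in>B. frag_cmul (m b) b) = 0 \<Longrightarrow> b \<in> B \<Longrightarrow> m b = 0"
  using independent_iff by blast

lemma independent_empty: "independent {}"
  by (simp add: independent_iff)

text \<open>Dependence is defined for sets, so a family must be shown to be injective before its values can be
  counted; a repeated value would be a relation.\<close>

lemma independent_image:
  assumes "finite A" and ind: "\<And>m b. (\<Sum>a\<in>A. frag_cmul (m a) (f a)) = 0 \<Longrightarrow> b \<in> A \<Longrightarrow> m b = 0"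
  shows "inj_on f A" "independent (f ` A)"
proof -
  show inj: "inj_on f A"
  proof (rule inj_onI, rule ccontr)
    fix x y assume xy: "x \<in> A" "y \<in> A" "f x = f y" "x \<noteq> y"
    let ?m = "\<lambda>a. if a = x then 1 else if a = y then - 1 else (0::int)"
    have "(\<Sum>a\<in>A. frag_cmul (?m a) (f a)) = (\<Sum>a\<in>{x, y}. frag_cmul (?m a) (f a))"
      using xy assms(1) by (intro sum.mono_neutral_right) auto
    also have "\<dots> = 0" using xy by simp
    finally show False using ind[of ?m x] xy by simp
  qed
  show "independent (f ` A)"
    unfolding independent_iff[OF finite_imageI[OF assms(1)]]
  proof (intro allI impI ballI)
    fix m b assume m: "(\<Sum>b\<in>f ` A. frag_cmul (m b) b) = 0" "b \<in> f ` A"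
    then obtain a where a: "a \<in> A" "b = f a" by auto
    have "(\<Sum>a\<in>A. frag_cmul (m (f a)) (f a)) = 0"
      using m(1) inj by (simp add: sum.reindex)
    then show "m b = 0" using ind[of "\<lambda>a. m (f a)" a] a by simp
  qed
qed

lemma coeff_combination:
  "coeff (\<Sum>b\<in>B. frag_cmul (m b) (f b)) e = (\<Sum>b\<in>B. m b * coeff (f b) e)"
  by (simp add: lookup_sum)

lemma independent_insert_pivot:
  assumes B: "finite B" "independent B" "\<And>b. b \<in> B \<Longrightarrow> coeff b e = 0" and c: "coeff c e \<noteq> 0"
  shows "c \<notin> B" "independent (insert c B)"
proof -
  show cB: "c \<notin> B" using B c by auto
  show "independent (insert c B)"
    unfolding independent_iff[OF finite.insertI[OF B(1)]]
  proof (intro allI impI)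
    fix m assume s: "(\<Sum>b\<in>insert c B. frag_cmul (m b) b) = 0"
    have "(\<Sum>b\<in>insert c B. m b * coeff b e) = 0"
      using arg_cong[OF s, of "\<lambda>c. coeff c e"] by (simp add: coeff_combination)
    then have mc: "m c = 0" using B cB c by simp
    then have "(\<Sum>b\<in>B. frag_cmul (m b) b) = 0" using s B(1) cB by simp
    then show "\<forall>b\<in>insert c B. m b = 0" using independentD[OF B(1,2)] mc by auto
  qed
qed

text \<open>One step of fraction-free Gaussian elimination: requiring the coefficient of one edge to vanish
  lowers the rank by at most one.\<close>

lemma independent_eliminate:
  assumes B: "finite B" "independent B" "B \<subseteq> Z"
    and Z: "\<And>m n x y. x \<in> Z \<Longrightarrow> y \<in> Z \<Longrightarrow> frag_cmul m x - frag_cmul n y \<in> Z"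
  obtains B' where "finite B'" "independent B'" "B' \<subseteq> Z" "card B \<le> Suc (card B')"
    "\<And>b. b \<in> B' \<Longrightarrow> coeff b e = 0"
proof (cases "\<forall>b\<in>B. coeff b e = 0")
  case True
  then show ?thesis using that[of B] B by auto
next
  case False
  then obtain c where c: "c \<in> B" "coeff c e \<noteq> 0" by blast
  let ?f = "\<lambda>b. frag_cmul (coeff c e) b - frag_cmul (coeff b e) c"
  let ?A = "B - {c}"
  have fA: "finite ?A" using B by simp
  have ind: "m b = 0" if m: "(\<Sum>a\<in>?A. frag_cmul (m a) (?f a)) = 0" "b \<in> ?A" for m b
  proof -
    \<comment> \<open>A relation between the eliminated elements is a relation of \<open>B\<close> in which \<open>c\<close> takes up the rest.\<close>
    let ?w = "\<lambda>a. if a = c then - (\<Sum>a\<in>?A. m a * coeff a e) else m a * coeff c e"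
    have "(\<Sum>a\<in>B. frag_cmul (?w a) a) = frag_cmul (?w c) c + (\<Sum>a\<in>?A. frag_cmul (?w a) a)"
      using B(1) c(1) by (rule sum.remove)
    also have "\<dots> = 0"
    proof (rule poly_mapping_eqI)
      fix k
      have "0 = (\<Sum>a\<in>?A. m a * (coeff c e * coeff a k - coeff a e * coeff c k))"
        using arg_cong[OF m(1), of "\<lambda>c. coeff c k"] by (simp add: coeff_combination lookup_minus)
      also have "\<dots> = (\<Sum>a\<in>?A. m a * coeff c e * coeff a k) - (\<Sum>a\<in>?A. m a * coeff a e) * coeff c k"
        by (simp add: sum_subtractf sum_distrib_right right_diff_distrib mult.assoc)
      finally show "coeff (frag_cmul (?w c) c + (\<Sum>a\<in>?A. frag_cmul (?w a) a)) k = coeff 0 k"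
        by (simp add: lookup_add coeff_combination)
    qed
    finally have "?w b = 0" using independentD[OF B(1,2), of ?w b] m(2) by blast
    then show "m b = 0" using m(2) c by auto
  qed
  have im: "inj_on ?f ?A" "independent (?f ` ?A)"
    using independent_image[OF fA, of ?f] ind by blast+
  have "card (?f ` ?A) = card ?A" using im(1) by (rule card_image)
  moreover have "?f ` ?A \<subseteq> Z" using B(3) c(1) by (intro image_subsetI Z) auto
  moreover have "card B = Suc (card ?A)" using card.remove[OF B(1) c(1)] by simp
  moreover have "coeff b e = 0" if "b \<in> ?f ` ?A" for b
    using that by (auto simp: lookup_minus)
  moreover have "finite (?f ` ?A)" using fA by simp
  moreover have "card B \<le> Suc (card (?f ` ?A))" using calculation(1,3) by linarith
  ultimately show ?thesis using that[of "?f ` ?A"] im(2) by blast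
qed

lemma H1_combination:
  assumes "finite A" "\<And>a. a \<in> A \<Longrightarrow> f a \<in> H1 G"
  shows "(\<Sum>a\<in>A. frag_cmul (m a) (f a)) \<in> H1 G"
  using assms
proof (induction A rule: finite_induct)
  case empty
  show ?case by (simp add: H1_def chains1_def boundary1_def)
next
  case (insert a A)
  have 1: "x + frag_cmul n y \<in> H1 G" if "x \<in> H1 G" "y \<in> H1 G" for x y n
    using that Poly_Mapping.keys_add[of x "frag_cmul n y"] keys_cmul[of n y]
    by (auto simp: H1_def chains1_def boundary1_def frag_extend_add frag_extend_cmul lookup_add)
  show ?case using insert 1[of "\<Sum>a\<in>A. frag_cmul (m a) (f a)" "f a" "m a"] by (simp add: add.commute)
qed

lemma H1_diff: "x \<in> H1 G \<Longrightarrow> y \<in> H1 G \<Longrightarrow> frag_cmul m x - frag_cmul n y \<in> H1 G"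
  using Poly_Mapping.keys_diff[of "frag_cmul m x" "frag_cmul n y"] keys_cmul[of n y] keys_cmul[of m x]
  by (auto simp: H1_def chains1_def boundary1_def frag_extend_diff frag_extend_cmul lookup_minus)

lemma independent_frag_extend:
  assumes B: "finite B" "independent B" "B \<subseteq> H1 G"
    and inj: "\<And>c. c \<in> H1 G \<Longrightarrow> frag_extend f c = 0 \<Longrightarrow> c = 0"
  shows "inj_on (frag_extend f) B" "independent (frag_extend f ` B)"
proof -
  have "m b = 0" if m: "(\<Sum>a\<in>B. frag_cmul (m a) (frag_extend f a)) = 0" "b \<in> B" for m b
  proof -
    have "frag_extend f (\<Sum>a\<in>B. frag_cmul (m a) a) = 0"
      using m(1) B(1) by (simp add: frag_extend_sum frag_extend_cmul)
    then have "(\<Sum>a\<in>B. frag_cmul (m a) a) = 0"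
      using inj H1_combination[OF B(1), of "\<lambda>a. a" G m] B(3) by blast
    then show ?thesis using independentD B m by blast
  qed
  then show "inj_on (frag_extend f) B" "independent (frag_extend f ` B)"
    using independent_image[OF B(1), of "frag_extend f"] by blast+
qed

lemma card_le_rk: "finite B \<Longrightarrow> B \<subseteq> H1 G \<Longrightarrow> independent B \<Longrightarrow> enat (card B) \<le> rk G"
  unfolding rk_def by (rule SUP_upper) simp

lemma rk_le: "(\<And>B. finite B \<Longrightarrow> B \<subseteq> H1 G \<Longrightarrow> independent B \<Longrightarrow> enat (card B) \<le> n) \<Longrightarrow> rk G \<le> n"
  unfolding rk_def by (rule SUP_least) simp

lemma rk_mono_frag_extend:
  assumes "\<And>c. c \<in> H1 G \<Longrightarrow> frag_extend f c \<in> H1 G'"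
    and "\<And>c. c \<in> H1 G \<Longrightarrow> frag_extend f c = 0 \<Longrightarrow> c = 0"
  shows "rk G \<le> rk G'"
proof (rule rk_le)
  fix B assume B: "finite B" "B \<subseteq> H1 G" "independent B"
  have ind: "inj_on (frag_extend f) B" "independent (frag_extend f ` B)"
    using independent_frag_extend[OF B(1,3,2), of f] assms(2) by blast+
  have "card (frag_extend f ` B) = card B" using ind(1) by (rule card_image)
  moreover have "frag_extend f ` B \<subseteq> H1 G'" using B assms(1) by auto
  ultimately show "enat (card B) \<le> rk G'"
    using card_le_rk[of "frag_extend f ` B" G'] ind(2) B(1) by simp
qed

lemma rk_pos:
  assumes "c \<in> H1 G" "c \<noteq> 0"
  shows "1 \<le> rk G"
proof -
  have "independent {c}" using assms by (simp add: independent_iff)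
  then show ?thesis using card_le_rk[of "{c}" G] assms by (simp add: one_enat_def)
qed

text \<open>An independent set with \<open>rk\<close> elements uses all edges that occur in cycles, for a cycle
  with a new edge could be added to it.\<close>

lemma cycle_edges_finite:
  assumes "rk G < \<infinity>"
  obtains F where "finite F" "F \<subseteq> edges G" "\<And>c. c \<in> H1 G \<Longrightarrow> Poly_Mapping.keys c \<subseteq> F"
proof -
  obtain r where r: "rk G = enat r" using assms by auto
  let ?P = "\<lambda>B. finite B \<and> B \<subseteq> H1 G \<and> independent B"
  have bd: "card B \<le> r" if "?P B" for B using card_le_rk[of B G] that r by simp
  have "?P {}" by (simp add: independent_empty)
  then obtain B where B: "?P B" "\<And>B'. ?P B' \<Longrightarrow> card B' \<le> card B"
    using ex_has_greatest_nat[of ?P "{}" card "Suc r"] bd by (metis le_imp_less_Suc)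
  let ?F = "\<Union>b\<in>B. Poly_Mapping.keys b"
  have "Poly_Mapping.keys c \<subseteq> ?F" if c: "c \<in> H1 G" for c
  proof (rule ccontr)
    assume "\<not> Poly_Mapping.keys c \<subseteq> ?F"
    then obtain e where "e \<in> Poly_Mapping.keys c" "\<forall>b\<in>B. e \<notin> Poly_Mapping.keys b" by auto
    then have e: "e \<in> Poly_Mapping.keys c" "\<forall>b\<in>B. coeff b e = 0" by (simp_all add: in_keys_iff)
    then have "c \<notin> B" "independent (insert c B)"
      using independent_insert_pivot[of B e c] B by (auto simp: in_keys_iff)
    then show False using B(2)[of "insert c B"] B(1) c by simp
  qed
  moreover have "finite ?F" using B by simp
  moreover have "?F \<subseteq> edges G" using B(1) H1_keys by blast
  ultimately show ?thesis using that by blast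
qed

section \<open>Euler characteristic\<close>

text \<open>Exactly the finite connected subgraphs that contain \<open>u\<close>, in a form that allows induction.\<close>

inductive grown :: "'a graph \<Rightarrow> 'a \<Rightarrow> 'a set \<Rightarrow> bool" for G u where
  base: "grown G u {u}"
| step: "grown G u K \<Longrightarrow> e \<in> edges G \<Longrightarrow> src G e \<in> K \<Longrightarrow>
    grown G u (insert e (insert (inv_of G e) (insert (tgt G e) K)))"

lemma grown_base: "grown G u K \<Longrightarrow> u \<in> K"
  by (induction rule: grown.induct) auto

lemma grown_finite: "grown G u K \<Longrightarrow> finite K"
  by (induction rule: grown.induct) auto

lemma grown_subgraph:
  assumes "is_graph G" "u \<in> verts G" "grown G u K"
  shows "subgraph K G"
  using assms(3)
proof (induction rule: grown.induct)
  case base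
  then show ?case using assms by (simp add: subgraph_def vert_in_cells inv_vert src_vert)
next
  case (step K e)
  then show ?case using assms(1)
    by (simp add: subgraph_def graph_simps inv_in_cells vert_in_cells inv_vert src_vert)
qed

lemma grown_connected:
  assumes G: "is_graph G" "u \<in> verts G" and K: "grown G u K"
  shows "connected_graph (restrict_graph G K)"
proof (rule connected_restrictI[OF G(1) grown_subgraph[OF assms] G(2) grown_base[OF K]])
  fix x assume "x \<in> verts G" "x \<in> K"
  with K show "\<exists>p. edge_path G u p x \<and> set p \<subseteq> K"
  proof (induction arbitrary: x rule: grown.induct)
    case base
    then show ?case by (intro exI[of _ "[]"]) simp
  next
    case (step K e)
    have "x \<noteq> e" "x \<noteq> inv_of G e" 
      using step.prems(1) step.hyps(2) inv_in_edges[OF G(1)] verts_edges_disjoint by metis+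
    then consider "x \<in> K" | "x = tgt G e" using step.prems by auto
    then show ?case
    proof cases
      case 1
      then show ?thesis using step.IH[OF step.prems(1)] by blast
    next
      case 2
      obtain p where "edge_path G u p (src G e)" "set p \<subseteq> K"
        using step.IH[of "src G e"] step.hyps G by (auto simp: graph_simps)
      then show ?thesis using 2 step.hyps G
        by (intro exI[of _ "p @ [e]"]) (auto simp: edge_path_snoc)
    qed
  qed
qed

lemma edge_path_exit:
  "edge_path G u p v \<Longrightarrow> u \<in> A \<Longrightarrow> v \<notin> A \<Longrightarrow> \<exists>e\<in>set p. src G e \<in> A \<and> tgt G e \<notin> A"
  by (induction p arbitrary: u) auto

lemma connected_subgraph_grown:
  assumes G: "is_graph G" "u \<in> verts G" and K: "subgraph K G" "finite K" "u \<in> K"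
    and c: "connected_graph (restrict_graph G K)"
  shows "grown G u K"
proof -
  let ?P = "\<lambda>A. grown G u A \<and> A \<subseteq> K"
  have "?P {u}" using K by (simp add: grown.base)
  then obtain A where A: "?P A" "\<And>B. ?P B \<Longrightarrow> card B \<le> card A"
    using ex_has_greatest_nat[of ?P "{u}" card "Suc (card K)"] card_mono[OF K(2)]
    by (metis le_imp_less_Suc)
  have SA: "subgraph A G" using grown_subgraph[OF G] A by blast
  have "K \<subseteq> A"
  proof (rule ccontr)
    assume "\<not> K \<subseteq> A"
    then obtain x where x: "x \<in> K" "x \<notin> A" by blast
    have xc: "x \<in> cells G" using x K subgraph_cells by blast
    have "\<exists>e. e \<in> edges G \<inter> K \<and> src G e \<in> A \<and> e \<notin> A"
    proof (cases "src G x \<in> A")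
      case True
      have "x \<in> edges G"
        using True x xc G(1) src_vert[OF G(1), of x] cells_split[of G] by auto
      then show ?thesis using x True by blast
    next
      case False
      have "src G x \<in> verts G \<inter> K" using x K xc G(1) by (auto simp: subgraph_def src_in_verts)
      then obtain p where p: "edge_path (restrict_graph G K) u p (src G x)"
        using c G K unfolding connected_graph_def by (auto simp: verts_restrict subgraph_cells)
      then have p': "edge_path G u p (src G x)" "set p \<subseteq> K"
        by (auto simp: edge_path_restrict[OF K(1)])
      have "u \<in> A" using grown_base[of G u A] A by blast
      then obtain e where e: "e \<in> set p" "src G e \<in> A" "tgt G e \<notin> A"
        using edge_path_exit[OF p'(1) _ False] by blast
      have "e \<notin> A" using e(3) subgraph_tgt[OF SA] by blast
      then show ?thesis using e p'(2) edge_path_edges[OF p'(1)] by blast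
    qed
    then obtain e where e: "e \<in> edges G" "e \<in> K" "src G e \<in> A" "e \<notin> A" by blast
    let ?B = "insert e (insert (inv_of G e) (insert (tgt G e) A))"
    have "?P ?B" using A e K(1) by (auto intro: grown.step subgraph_tgt simp: subgraph_def)
    moreover have "card A < card ?B"
      using e grown_finite[of G u ?B] calculation by (intro psubset_card_mono) auto
    ultimately show False using A(2)[of ?B] by simp
  qed
  then show ?thesis using A by auto
qed

lemma grown_path:
  assumes "grown G u K" "edge_path G a p b" "a \<in> K"
  shows "\<exists>K'. grown G u K' \<and> K \<subseteq> K' \<and> set p \<subseteq> K'"
  using assms
proof (induction p arbitrary: a K)
  case (Cons e p)
  let ?K = "insert e (insert (inv_of G e) (insert (tgt G e) K))"
  have "grown G u ?K" using Cons.prems by (auto intro: grown.step)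
  then obtain K' where "grown G u K'" "?K \<subseteq> K'" "set p \<subseteq> K'"
    using Cons.IH[of ?K "tgt G e"] Cons.prems by auto
  then show ?case by auto
qed auto

lemma grown_superset:
  assumes "is_graph G" "connected_graph G" "u \<in> verts G" "finite F" "F \<subseteq> edges G"
  shows "\<exists>K. grown G u K \<and> F \<subseteq> K"
  using assms(4,5)
proof (induction F rule: finite_induct)
  case empty
  then show ?case using grown.base[of G u] by blast
next
  case (insert e F)
  then obtain K where K: "grown G u K" "F \<subseteq> K" by auto
  have e: "e \<in> edges G" using insert by auto
  then obtain p where "edge_path G u p (src G e)"
    using assms(1-3) unfolding connected_graph_def by (metis edge_in_cells src_in_verts)
  then have "edge_path G u (p @ [e]) (tgt G e)" using e assms(1) by (simp add: edge_path_snoc)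
  then obtain K' where "grown G u K'" "K \<subseteq> K'" "set (p @ [e]) \<subseteq> K'"
    using grown_path[OF K(1)] grown_base[OF K(1)] by blast
  then show ?case using K by auto
qed

text \<open>The cycles in \<open>K\<close> have rank \<open>1 - \<chi>(K)\<close>. An arc with a new end vertex changes neither side, since no
  cycle can use it. An arc between old vertices lowers \<open>\<chi>\<close> by one; it gives a new cycle, independent of
  the old ones, and by elimination the rank does not grow by more than one.\<close>

lemma grown_rank:
  assumes G: "is_graph G" "u \<in> verts G" and K: "grown G u K"
  shows "(\<exists>B. finite B \<and> independent B \<and> B \<subseteq> {c \<in> H1 G. Poly_Mapping.keys c \<subseteq> K} \<and>
      card (edges G \<inter> K) + 2 = 2 * card B + 2 * card (verts G \<inter> K)) \<and>
    (\<forall>B. finite B \<longrightarrow> independent B \<longrightarrow> B \<subseteq> {c \<in> H1 G. Poly_Mapping.keys c \<subseteq> K} \<longrightarrow>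
      2 * card B + 2 * card (verts G \<inter> K) \<le> card (edges G \<inter> K) + 2)"
  using K
proof (induction rule: grown.induct)
  case base
  have "edges G \<inter> {u} = {}" "verts G \<inter> {u} = {u}" using G(2) by (auto simp: edges_def)
  moreover have "B = {}" if "independent B" "B \<subseteq> {c \<in> H1 G. Poly_Mapping.keys c \<subseteq> {u}}" for B
  proof -
    have "c = 0" if "c \<in> B" for c
    proof -
      have "Poly_Mapping.keys c \<subseteq> edges G \<inter> {u}" using that \<open>B \<subseteq> _\<close> H1_keys[of c G] by auto
      then show ?thesis using \<open>edges G \<inter> {u} = {}\<close> by simp
    qed
    then show ?thesis using that(1) module.dependent_zero[OF module_frag, of B] by blast
  qed
  ultimately show ?case by (auto simp: independent_empty intro!: exI[of _ "{}"])
next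
  case (step K e)
  let ?K = "insert e (insert (inv_of G e) (insert (tgt G e) K))"
  let ?Z = "\<lambda>K. {c \<in> H1 G. Poly_Mapping.keys c \<subseteq> K}"
  have S: "subgraph K G" using grown_subgraph[OF G step.hyps(1)] .
  have fin: "finite K" using grown_finite[OF step.hyps(1)] .
  note e = step.hyps(2)
  have ie: "inv_of G e \<in> edges G" "inv_of G e \<noteq> e" using e G inv_neq[OF e] by (simp_all add: graph_simps)
  have te: "tgt G e \<in> verts G" "src G e \<in> verts G" using e G by (simp_all add: graph_simps)
  show ?case
  proof (cases "e \<in> K")
    case True
    then have "?K = K" using S subgraph_tgt[OF S] by (auto simp: subgraph_def)
    then show ?thesis using step.IH by simp
  next
    case False
    then have iK: "inv_of G e \<notin> K" using subgraph_inv_iff[OF G(1) S] e by (simp add: graph_simps)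
    have "edges G \<inter> ?K = insert e (insert (inv_of G e) (edges G \<inter> K))"
      using e ie te by (auto simp: edges_def)
    then have cE: "card (edges G \<inter> ?K) = card (edges G \<inter> K) + 2"
      using False iK ie fin by simp
    have V: "verts G \<inter> ?K = insert (tgt G e) (verts G \<inter> K)"
      using e ie te by (auto simp: edges_def)
    have drop: "c \<in> ?Z K" if "c \<in> ?Z ?K" "coeff c e = 0" for c
    proof -
      have "coeff c (inv_of G e) = 0" using that H1_antisym[of c G e] e by simp
      then have "e \<notin> Poly_Mapping.keys c" "inv_of G e \<notin> Poly_Mapping.keys c" 
        using that by (simp_all add: in_keys_iff)
      moreover have "tgt G e \<notin> Poly_Mapping.keys c" using H1_keys[of c G] that te by (auto simp: edges_def)
      ultimately show ?thesis using that by auto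
    qed
    obtain B where B: "finite B" "independent B" "B \<subseteq> ?Z K"
      "card (edges G \<inter> K) + 2 = 2 * card B + 2 * card (verts G \<inter> K)" using step.IH by blast
    have ub: "2 * card B + 2 * card (verts G \<inter> K) \<le> card (edges G \<inter> K) + 2"
      if "finite B" "independent B" "B \<subseteq> ?Z K" for B using step.IH that by blast
    show ?thesis
    proof (cases "tgt G e \<in> K")
      case False
      then have cV: "card (verts G \<inter> ?K) = card (verts G \<inter> K) + 1"
        unfolding V using fin by simp
      have zero: "coeff c e = 0" if c: "c \<in> ?Z ?K" for c
      proof -
        have "0 = coeff (boundary1 G c) (tgt G e)" using c by (simp add: H1_def)
        also have "\<dots> = (\<Sum>f\<in>Poly_Mapping.keys c. coeff c f * coeff (frag_of (tgt G f)) (tgt G e))"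
          by (simp only: boundary1_def coeff_frag_extend)
        also have "\<dots> = (\<Sum>f\<in>Poly_Mapping.keys c. if f = e then coeff c e else 0)"
        proof (rule sum.cong[OF refl])
          fix f assume f: "f \<in> Poly_Mapping.keys c"
          have fE: "f \<in> edges G" "f \<in> ?K" using f c H1_keys[of c G] by auto
          have "tgt G f \<noteq> tgt G e" if "f \<noteq> e"
          proof -
            have "f \<noteq> tgt G e" using fE(1) te by (auto simp: edges_def)
            then have "f \<in> K \<or> f = inv_of G e" using fE that by auto
            then have "tgt G f \<in> K"
              using subgraph_tgt[OF S] step.hyps(3) G e by (auto simp: graph_simps)
            then show ?thesis using False by auto
          qed
          then show "coeff c f * coeff (frag_of (tgt G f)) (tgt G e) = (if f = e then coeff c e else 0)"
            by auto
        qed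
        also have "\<dots> = coeff c e" by (auto simp: in_keys_iff)
        finally show ?thesis by simp
      qed
      have "B \<subseteq> ?Z ?K" using B(3) by auto
      moreover have "card (edges G \<inter> ?K) + 2 = 2 * card B + 2 * card (verts G \<inter> ?K)"
        using B(4) cE cV by simp
      moreover have "2 * card B + 2 * card (verts G \<inter> ?K) \<le> card (edges G \<inter> ?K) + 2"
        if "finite B" "independent B" "B \<subseteq> ?Z ?K" for B
      proof -
        have "B \<subseteq> ?Z K" using that(3) drop zero by blast
        then show ?thesis using ub[OF that(1,2)] cE cV by simp
      qed
      ultimately show ?thesis using B(1,2) by blast
    next
      case True
      then have cV: "card (verts G \<inter> ?K) = card (verts G \<inter> K)"
        unfolding V using te by (simp add: insert_absorb)
      have "\<exists>k. edge_path (restrict_graph G K) (tgt G e) k (src G e)"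
        using grown_connected[OF G step.hyps(1)] te True step.hyps(3) S
        unfolding connected_graph_def by (auto simp: verts_restrict subgraph_cells)
      then obtain k where k: "edge_path G (tgt G e) k (src G e)" "set k \<subseteq> K"
        by (auto simp: edge_path_restrict[OF S])
      let ?c = "path_chain G (e # k)"
      have kk: "Poly_Mapping.keys (path_chain G k) \<subseteq> K"
        using keys_path_chain[of G k] k(2) S by (auto simp: subgraph_def)
      have cH: "?c \<in> H1 G" using k e G by (intro closed_path_chain_H1) auto
      have ce: "coeff ?c e = 1"
        using kk False ie by (auto simp: lookup_add coeff_arc_chain in_keys_iff subset_iff)
      have "Poly_Mapping.keys ?c \<subseteq> insert e (insert (inv_of G e) K)"
        using keys_path_chain[of G "e # k"] k(2) S by (auto simp: subgraph_def)
      then have cZ: "?c \<in> ?Z ?K" using cH by auto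
      have B0: "coeff b e = 0" if "b \<in> B" for b
        using B(3) that False by (auto simp: in_keys_iff subset_iff)
      have piv: "?c \<notin> B" "independent (insert ?c B)"
        using independent_insert_pivot[OF B(1,2) B0, of ?c] ce by auto
      have "insert ?c B \<subseteq> ?Z ?K" using B(3) cZ by auto
      moreover have "card (edges G \<inter> ?K) + 2 = 2 * card (insert ?c B) + 2 * card (verts G \<inter> ?K)"
        using B(1,4) piv(1) cE cV by simp
      moreover have "2 * card B + 2 * card (verts G \<inter> ?K) \<le> card (edges G \<inter> ?K) + 2"
        if BK: "finite B" "independent B" "B \<subseteq> ?Z ?K" for B
      proof -
        have Zd: "frag_cmul m x - frag_cmul n y \<in> ?Z ?K" if "x \<in> ?Z ?K" "y \<in> ?Z ?K" for m n x y
          using that H1_diff[of x G y m n] Poly_Mapping.keys_diff[of "frag_cmul m x" "frag_cmul n y"]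
            keys_cmul[of n y] keys_cmul[of m x] by blast
        obtain B' where B': "finite B'" "independent B'" "B' \<subseteq> ?Z ?K" "card B \<le> Suc (card B')"
          "\<And>b. b \<in> B' \<Longrightarrow> coeff b e = 0"
          using independent_eliminate[OF BK Zd, of e] by blast
        have "B' \<subseteq> ?Z K" using B'(3,5) drop by blast
        then show ?thesis using ub[OF B'(1,2)] B'(4) cE cV by simp
      qed
      ultimately show ?thesis using B(1) piv(2) by blast
    qed
  qed
qed

lemma independent_cycles_le:
  assumes G: "is_graph G" "u \<in> verts G" and K: "subgraph K G" "finite K" "u \<in> K"
    "connected_graph (restrict_graph G K)"
    and B: "finite B" "independent B" "B \<subseteq> H1 G" "\<And>c. c \<in> B \<Longrightarrow> Poly_Mapping.keys c \<subseteq> K"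
  shows "2 * card B + 2 * card (verts G \<inter> K) \<le> card (edges G \<inter> K) + 2"
  using grown_rank[OF G connected_subgraph_grown[OF G K]] B by blast

lemma euler_le_rk:
  assumes G: "is_graph G" "u \<in> verts G" and K: "subgraph K G" "finite K" "u \<in> K"
    "connected_graph (restrict_graph G K)" and rk: "rk G < \<infinity>"
  shows "card (edges G \<inter> K) + 2 \<le> 2 * the_enat (rk G) + 2 * card (verts G \<inter> K)"
proof -
  obtain B where B: "finite B" "independent B" "B \<subseteq> H1 G"
      "card (edges G \<inter> K) + 2 = 2 * card B + 2 * card (verts G \<inter> K)"
    using grown_rank[OF G connected_subgraph_grown[OF G K]] by blast
  moreover have "card B \<le> the_enat (rk G)"
    using card_le_rk[OF B(1,3,2)] rk by auto
  ultimately show ?thesis by simp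
qed

text \<open>A finite connected subgraph around the finitely many edges that occur in cycles is convex, so it
  contains all reduced closed paths at the base point.\<close>

lemma finite_spine:
  assumes G: "is_graph G" "connected_graph G" "u \<in> verts G" and rk: "rk G < \<infinity>"
  shows "finite (spine G u)"
proof -
  obtain F where F: "finite F" "F \<subseteq> edges G" "\<And>c. c \<in> H1 G \<Longrightarrow> Poly_Mapping.keys c \<subseteq> F"
    using cycle_edges_finite[OF rk] by blast
  obtain K where K: "grown G u K" "F \<subseteq> K" using grown_superset[OF G F(1,2)] by blast
  have S: "subgraph K G" using grown_subgraph[OF G(1,3) K(1)] .
  have "set p \<subseteq> K" if "edge_path G u p u" "reduced G p" for p
    using reduced_path_in_core[OF G(1) S grown_connected[OF G(1,3) K(1)] _ that] F(3) K
      grown_base[OF K(1)] by blast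
  then have "spine G u \<subseteq> K"
    using grown_base[OF K(1)] S subgraph_tgt[OF S] unfolding spine_def subgraph_def by blast
  then show ?thesis using grown_finite[OF K(1)] finite_subset by blast
qed

section \<open>Collapsing a subgraph that contains all vertices\<close>

definition wide_subgraph :: "'a set \<Rightarrow> 'a graph \<Rightarrow> bool" where
  "wide_subgraph F G \<longleftrightarrow> subgraph F G \<and> verts G \<subseteq> F"

text \<open>The image of a cell under the quotient map. The operations of the collapsed graph are defined on whole
  classes; everything below is computed on representatives through this map.\<close>

definition cls :: "'a graph \<Rightarrow> 'a set \<Rightarrow> 'a \<Rightarrow> 'a set" where
  "cls G F x = collapse_rel G F `` {x}"

lemma cls_subset_cells: "cls G F x \<subseteq> cells G"
  by (auto simp: cls_def collapse_rel_def)

lemma wide_subgraphD: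
  "wide_subgraph F G \<Longrightarrow> subgraph F G" "wide_subgraph F G \<Longrightarrow> verts G \<subseteq> F"
  "wide_subgraph F G \<Longrightarrow> F \<subseteq> cells G"
  by (auto simp: wide_subgraph_def subgraph_def)

lemma cls_inside:
  assumes "is_graph G" "wide_subgraph F G" "x \<in> F"
  shows "cls G F x = component_of (restrict_graph G F) x"
proof -
  note F = wide_subgraphD[OF assms(2)]
  have "is_graph (restrict_graph G F)" using assms(1) F(1) by (rule is_graph_restrict)
  then have "x \<in> component_of (restrict_graph G F) x" using assms(3) by (simp add: component_self)
  moreover have "component_of (restrict_graph G F) x \<subseteq> F" by (auto simp: component_of_def)
  ultimately show ?thesis using assms(3) F(3) by (auto simp: cls_def collapse_rel_def)
qed

lemma cls_outside: "x \<in> cells G \<Longrightarrow> x \<notin> F \<Longrightarrow> cls G F x = {x}"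
  by (auto simp: cls_def collapse_rel_def)

lemma self_in_cls: "x \<in> cells G \<Longrightarrow> x \<in> cls G F x"
  by (auto simp: cls_def collapse_rel_def)

lemma cls_eq:
  assumes "is_graph G" "wide_subgraph F G" "x \<in> cells G" "y \<in> cls G F x"
  shows "cls G F y = cls G F x"
proof (cases "x \<in> F")
  case True
  note F = wide_subgraphD[OF assms(2)]
  have y: "y \<in> component_of (restrict_graph G F) x" using assms(4) cls_inside[OF assms(1,2)] True by simp
  then have "y \<in> F" by (simp add: component_of_def)
  then show ?thesis
    using component_eq[OF is_graph_restrict[OF assms(1) F(1)] y] cls_inside[OF assms(1,2)] True by simp
next
  case False
  then show ?thesis using assms by (simp add: cls_outside)
qed

text \<open>The source map and induced maps apply a function to a class and then saturate the result. One class
  comes out as soon as the image is nonempty and does not leave it.\<close>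

lemma collapse_rel_image:
  assumes "is_graph G" "wide_subgraph F G" "x \<in> cells G" "A \<subseteq> cls G F x" "A \<noteq> {}"
  shows "collapse_rel G F `` A = cls G F x"
proof -
  have "collapse_rel G F `` A = (\<Union>a\<in>A. cls G F a)" by (auto simp: cls_def)
  also have "\<dots> = (\<Union>a\<in>A. cls G F x)"
    by (rule SUP_cong[OF refl], rule cls_eq[OF assms(1-3)]) (use assms(4) in blast)
  also have "\<dots> = cls G F x" using assms(5) by simp
  finally show ?thesis .
qed

lemma cls_mem_F_iff:
  assumes "is_graph G" "wide_subgraph F G" "x \<in> cells G" "y \<in> cls G F x"
  shows "y \<in> F \<longleftrightarrow> x \<in> F"
proof (cases "x \<in> F")
  case True
  then have "y \<in> component_of (restrict_graph G F) x" using assms(4) cls_inside[OF assms(1,2) True] by simp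
  then show ?thesis using True by (simp add: component_of_def)
next
  case False
  then show ?thesis using assms(3,4) by (simp add: cls_outside)
qed

lemma cls_reachable_iff:
  assumes "is_graph G" "wide_subgraph F G" "x \<in> F" "y \<in> F"
  shows "cls G F x = cls G F y \<longleftrightarrow> (\<exists>p. edge_path G (src G x) p (src G y) \<and> set p \<subseteq> F)"
proof -
  note F = wide_subgraphD[OF assms(2)]
  have "cls G F x = cls G F y \<longleftrightarrow> y \<in> cls G F x"
  proof
    assume "cls G F x = cls G F y"
    then show "y \<in> cls G F x" using self_in_cls[of y G F] assms(4) F(3) by auto
  next
    assume "y \<in> cls G F x"
    then show "cls G F x = cls G F y" using cls_eq[OF assms(1,2), of x y] assms(3) F(3) by auto
  qed
  also have "\<dots> \<longleftrightarrow> (\<exists>p. edge_path G (src G x) p (src G y) \<and> set p \<subseteq> F)"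
    using assms F(1) by (simp add: cls_inside component_of_def edge_path_restrict subgraph_def)
  finally show ?thesis .
qed

lemma cells_collapse: "cells (collapse G F) = cls G F ` cells G"
  by (auto simp: collapse_def quotient_def cls_def)

lemma inv_collapse:
  assumes "is_graph G" "wide_subgraph F G" "x \<in> cells G"
  shows "inv_of (collapse G F) (cls G F x) = cls G F (inv_of G x)"
proof (cases "x \<in> F")
  case True
  note F = wide_subgraphD[OF assms(2)]
  let ?R = "restrict_graph G F"
  have R: "is_graph ?R" using assms(1) F(1) by (rule is_graph_restrict)
  let ?C = "component_of ?R x"
  have S: "subgraph ?C ?R" using R by (rule subgraph_component)
  have "inv_of G ` ?C = ?C"
  proof
    show "inv_of G ` ?C \<subseteq> ?C" using S by (auto simp: subgraph_def)
    show "?C \<subseteq> inv_of G ` ?C"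
    proof
      fix y assume y: "y \<in> ?C"
      then have "inv_of G y \<in> ?C" "y \<in> cells G" using S F(3) by (auto simp: subgraph_def)
      then show "y \<in> inv_of G ` ?C" using assms(1) by (metis image_eqI inv_inv)
    qed
  qed
  moreover have "inv_of G x \<in> ?C" using S component_self[OF R, of x] True by (simp add: subgraph_def)
  then have "component_of ?R (inv_of G x) = ?C" using component_eq[OF R] by simp
  moreover have "inv_of G x \<in> F" using True F(1) by (simp add: subgraph_def)
  ultimately show ?thesis using cls_inside[OF assms(1,2)] True by (simp add: collapse_def)
next
  case False
  then have "inv_of G x \<notin> F" using assms by (simp add: subgraph_inv_iff wide_subgraphD)
  then show ?thesis using False assms by (simp add: cls_outside inv_in_cells collapse_def)
qed

lemma src_collapse:
  assumes "is_graph G" "wide_subgraph F G" "x \<in> cells G"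
  shows "src (collapse G F) (cls G F x) = cls G F (src G x)"
proof -
  note F = wide_subgraphD[OF assms(2)]
  have R: "is_graph (restrict_graph G F)" using assms(1) F(1) by (rule is_graph_restrict)
  have "src G ` cls G F x \<subseteq> cls G F (src G x)"
  proof (cases "x \<in> F")
    case True
    let ?C = "component_of (restrict_graph G F) x"
    have S: "subgraph ?C (restrict_graph G F)" using R by (rule subgraph_component)
    have "src G x \<in> ?C" using S component_self[OF R, of x] True by (simp add: subgraph_def)
    then have "component_of (restrict_graph G F) (src G x) = ?C" using component_eq[OF R] by simp
    moreover have "src G x \<in> F" using True F(1) by (simp add: subgraph_def)
    ultimately show ?thesis
      using S cls_inside[OF assms(1,2)] True by (auto simp: subgraph_def)
  next
    case False
    then show ?thesis using assms by (simp add: cls_outside self_in_cls src_in_verts vert_in_cells)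
  qed
  moreover have "src G ` cls G F x \<noteq> {}" using self_in_cls[OF assms(3)] by auto
  moreover have "src G x \<in> cells G" using assms by (simp add: src_in_verts vert_in_cells)
  ultimately show ?thesis using collapse_rel_image[OF assms(1,2)] by (simp add: collapse_def)
qed

lemma tgt_collapse:
  "is_graph G \<Longrightarrow> wide_subgraph F G \<Longrightarrow> x \<in> cells G \<Longrightarrow>
    tgt (collapse G F) (cls G F x) = cls G F (tgt G x)"
  by (simp add: tgt_def inv_collapse src_collapse inv_in_cells)

lemma cls_in_verts_iff:
  assumes "is_graph G" "wide_subgraph F G" "x \<in> cells G"
  shows "cls G F x \<in> verts (collapse G F) \<longleftrightarrow> x \<in> F"
proof -
  have "cls G F x \<in> verts (collapse G F) \<longleftrightarrow> cls G F (inv_of G x) = cls G F x"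
    using assms by (simp add: verts_def cells_collapse inv_collapse)
  also have "\<dots> \<longleftrightarrow> x \<in> F"
  proof (cases "x \<in> F")
    case True
    have R: "is_graph (restrict_graph G F)" using assms by (simp add: is_graph_restrict wide_subgraphD)
    have "inv_of G x \<in> component_of (restrict_graph G F) x"
      using subgraph_component[OF R] component_self[OF R, of x] True by (simp add: subgraph_def)
    then have "inv_of G x \<in> cls G F x" using cls_inside[OF assms(1,2) True] by simp
    then show ?thesis using cls_eq[OF assms] True by simp
  next
    case False
    then have "inv_of G x \<notin> F" using assms by (simp add: subgraph_inv_iff wide_subgraphD)
    moreover have "x \<notin> verts G" using False assms wide_subgraphD by blast
    ultimately show ?thesis
      using False assms by (auto simp: cls_outside inv_in_cells verts_def)
  qed
  finally show ?thesis .
qed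

lemma cls_in_edges_iff:
  "is_graph G \<Longrightarrow> wide_subgraph F G \<Longrightarrow> x \<in> cells G \<Longrightarrow>
    cls G F x \<in> edges (collapse G F) \<longleftrightarrow> x \<notin> F"
  by (simp add: edges_def cls_in_verts_iff cells_collapse)

lemma edges_collapse:
  assumes "is_graph G" "wide_subgraph F G"
  shows "edges (collapse G F) = (\<lambda>e. {e}) ` (edges G - F)"
proof -
  have 1: "cells G - F = edges G - F" using wide_subgraphD[OF assms(2)] by (auto simp: edges_def)
  have "edges (collapse G F) = cls G F ` (cells G - F)"
    using cls_in_edges_iff[OF assms] cells_collapse[of G F] by (auto simp: edges_def)
  also have "\<dots> = (\<lambda>e. {e}) ` (cells G - F)" by (auto simp: cls_outside)
  finally show ?thesis by (simp add: 1)
qed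

lemma verts_collapse:
  assumes "is_graph G" "wide_subgraph F G"
  shows "verts (collapse G F) = cls G F ` verts G"
proof
  show "cls G F ` verts G \<subseteq> verts (collapse G F)"
  proof
    fix X assume "X \<in> cls G F ` verts G"
    then obtain x where x: "x \<in> verts G" "X = cls G F x" by blast
    then show "X \<in> verts (collapse G F)"
      using cls_in_verts_iff[OF assms vert_in_cells[OF x(1)]] wide_subgraphD(2)[OF assms(2)] by auto
  qed
  show "verts (collapse G F) \<subseteq> cls G F ` verts G"
  proof
    fix X assume "X \<in> verts (collapse G F)"
    moreover from this have "X \<in> cls G F ` cells G" by (simp add: vert_in_cells flip: cells_collapse)
    then obtain x where x: "X = cls G F x" "x \<in> cells G" by blast
    ultimately have xF: "x \<in> F" using cls_in_verts_iff[OF assms x(2)] by simp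
    have R: "is_graph (restrict_graph G F)" using assms by (simp add: is_graph_restrict wide_subgraphD)
    have "src G x \<in> component_of (restrict_graph G F) x"
      using subgraph_component[OF R] component_self[OF R, of x] xF by (simp add: subgraph_def)
    then have "src G x \<in> cls G F x" using cls_inside[OF assms xF] by simp
    then have "X = cls G F (src G x)" using cls_eq[OF assms x(2)] x(1) by simp
    then show "X \<in> cls G F ` verts G" using src_in_verts[OF assms(1) x(2)] by simp
  qed
qed

lemma is_graph_collapse:
  assumes "is_graph G" "wide_subgraph F G"
  shows "is_graph (collapse G F)"
  unfolding is_graph_def
proof (intro conjI ballI)
  fix X assume "X \<in> cells (collapse G F)"
  then obtain x where x: "x \<in> cells G" "X = cls G F x" by (auto simp: cells_collapse)
  show "inv_of (collapse G F) X \<in> cells (collapse G F)"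
    "inv_of (collapse G F) (inv_of (collapse G F) X) = X"
    "src (collapse G F) X \<in> verts (collapse G F)"
    using x assms
    by (auto simp: inv_collapse src_collapse cells_collapse inv_in_cells inv_inv verts_collapse src_in_verts)
next
  fix X assume "X \<in> verts (collapse G F)"
  then obtain x where x: "x \<in> verts G" "X = cls G F x" using assms by (auto simp: verts_collapse)
  then show "src (collapse G F) X = X" using assms by (simp add: src_collapse src_vert vert_in_cells)
qed

lemma edge_path_collapse:
  assumes G: "is_graph G" "wide_subgraph F G" and p: "edge_path G u p v"
  shows "\<exists>q. edge_path (collapse G F) (cls G F u) q (cls G F v)"
  using p
proof (induction p arbitrary: u)
  case Nil
  then show ?case using G by (intro exI[of _ "[]"]) (auto simp: verts_collapse)
next
  case (Cons e p)
  then obtain q where q: "edge_path (collapse G F) (cls G F (tgt G e)) q (cls G F v)" by auto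
  have e: "e \<in> edges G" "src G e = u" using Cons.prems by auto
  show ?case
  proof (cases "e \<in> F")
    case True
    have "edge_path G (src G e) [e] (src G (tgt G e))"
      using e G by (simp add: src_vert tgt_in_verts edge_in_cells)
    moreover have "src G e \<in> F" "tgt G e \<in> F"
      using e G wide_subgraphD[OF G(2)] by (auto simp: graph_simps subgraph_tgt)
    ultimately have "cls G F (src G e) = cls G F (tgt G e)"
      using cls_reachable_iff[OF G, of "src G e" "tgt G e"] True e G
      by (auto simp: src_vert graph_simps simp del: edge_path.simps)
    then show ?thesis using q e by auto
  next
    case False
    then have "edge_path (collapse G F) (cls G F u) (cls G F e # q) (cls G F v)"
      using q e G by (auto simp: cls_in_edges_iff edge_in_cells src_collapse tgt_collapse)
    then show ?thesis by blast
  qed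
qed

lemma connected_collapse:
  assumes "is_graph G" "wide_subgraph F G" "connected_graph G"
  shows "connected_graph (collapse G F)"
  unfolding connected_graph_def verts_collapse[OF assms(1,2)]
proof (intro conjI ballI)
  show "cls G F ` verts G \<noteq> {}" using assms(3) by (simp add: connected_graph_def)
  fix X Y assume "X \<in> cls G F ` verts G" "Y \<in> cls G F ` verts G"
  then obtain u v where uv: "u \<in> verts G" "X = cls G F u" "v \<in> verts G" "Y = cls G F v" by blast
  then obtain p where "edge_path G u p v" using assms(3) by (auto simp: connected_graph_def)
  then show "\<exists>q. edge_path (collapse G F) X q Y"
    using edge_path_collapse[OF assms(1,2)] uv(2,4) by simp
qed

text \<open>Two edges of the collapsed graph that follow each other are joined, before collapsing, by a path inside
  the collapsed subgraph.\<close>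

lemma edge_path_of_collapse:
  assumes G: "is_graph G" "wide_subgraph F G" and ab: "a \<in> verts G" "b \<in> verts G"
    and q: "edge_path (collapse G F) (cls G F a) q (cls G F b)"
  shows "\<exists>p. edge_path G a p b"
  using ab(1) q
proof (induction q arbitrary: a)
  case Nil
  have "a \<in> F" "b \<in> F" using Nil ab wide_subgraphD(2)[OF G(2)] by auto
  then show ?case
    using cls_reachable_iff[OF G, of a b] Nil ab src_vert[OF G(1)] by auto
next
  case (Cons E q)
  then obtain e where e: "E = {e}" "e \<in> edges G" "e \<notin> F" by (auto simp: edges_collapse[OF G])
  have E: "E = cls G F e" using e by (simp add: cls_outside edge_in_cells)
  have v: "src G e \<in> verts G" "tgt G e \<in> verts G" using e G by (simp_all add: graph_simps)
  have F: "a \<in> F" "src G e \<in> F" using Cons.prems(1) v wide_subgraphD(2)[OF G(2)] by auto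
  have "cls G F a = cls G F (src G e)"
    using Cons.prems(2) E e src_collapse[OF G, of e] by (simp add: edge_in_cells)
  then obtain p where p: "edge_path G a p (src G e)"
    using cls_reachable_iff[OF G F] Cons.prems(1) v(1) src_vert[OF G(1)] by auto
  have "edge_path (collapse G F) (cls G F (tgt G e)) q (cls G F b)"
    using Cons.prems(2) E e tgt_collapse[OF G, of e] by (simp add: edge_in_cells)
  then obtain r where r: "edge_path G (tgt G e) r b" using Cons.IH v(2) by blast
  have "edge_path G a (p @ e # r) b" using r e by (intro edge_path_appendI[OF G(1) p]) simp
  then show ?case by blast
qed

subsection \<open>Homology of the collapsed graph\<close>

definition collapse_chain :: "'a graph \<Rightarrow> 'a set \<Rightarrow> ('a \<Rightarrow>\<^sub>0 int) \<Rightarrow> ('a set \<Rightarrow>\<^sub>0 int)" where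
  "collapse_chain G F = frag_extend (\<lambda>e. if e \<in> F then 0 else frag_of {e})"

lemma coeff_collapse_chain:
  "coeff (collapse_chain G F c) X = (if \<exists>e. X = {e} \<and> e \<notin> F then coeff c (the_elem X) else 0)"
proof (cases "\<exists>e. X = {e} \<and> e \<notin> F")
  case True
  then obtain e where e: "X = {e}" "e \<notin> F" by blast
  have "coeff (collapse_chain G F c) X = (\<Sum>x\<in>Poly_Mapping.keys c. if x = e then coeff c e else 0)"
    unfolding collapse_chain_def coeff_frag_extend using e by (intro sum.cong) auto
  then show ?thesis using e by (auto simp: in_keys_iff)
next
  case False
  then show ?thesis
    unfolding collapse_chain_def coeff_frag_extend by (auto intro!: sum.neutral)
qed

lemma keys_collapse_chain:
  "Poly_Mapping.keys (collapse_chain G F c) = (\<lambda>e. {e}) ` (Poly_Mapping.keys c - F)"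
  by (auto simp: in_keys_iff coeff_collapse_chain split: if_splits)

text \<open>Dropping the edges inside \<open>F\<close> does not affect the boundary in the quotient: an edge of \<open>F\<close> and its inverse
  end in the same class and have opposite coefficients.\<close>

lemma collapse_chain_H1:
  assumes G: "is_graph G" "wide_subgraph F G" and c: "c \<in> H1 G"
  shows "collapse_chain G F c \<in> H1 (collapse G F)"
proof -
  let ?C = "collapse G F"
  have "Poly_Mapping.keys (collapse_chain G F c) \<subseteq> edges ?C"
    using H1_keys[OF c] by (auto simp: keys_collapse_chain edges_collapse[OF G])
  moreover have "coeff (collapse_chain G F c) (inv_of ?C X) = - coeff (collapse_chain G F c) X"
    if X: "X \<in> edges ?C" for X
  proof -
    obtain e where e: "X = {e}" "e \<in> edges G" "e \<notin> F" using X by (auto simp: edges_collapse[OF G])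
    have "inv_of ?C X = {inv_of G e}" using e by (simp add: collapse_def)
    moreover have "inv_of G e \<notin> F"
      using e G by (simp add: subgraph_inv_iff wide_subgraphD edge_in_cells)
    ultimately show ?thesis using e H1_antisym[OF c] by (simp add: coeff_collapse_chain)
  qed
  moreover have "boundary1 ?C (collapse_chain G F c) = 0"
  proof (rule poly_mapping_eqI)
    fix X
    let ?k = "Poly_Mapping.keys c"
    let ?d = "\<lambda>e. coeff (frag_of (cls G F (tgt G e))) X"
    have tc: "tgt ?C {e} = cls G F (tgt G e)" if "e \<in> ?k" "e \<notin> F" for e
      using that H1_keys[OF c] tgt_collapse[OF G, of e] cls_outside[of e G F] by (auto simp: edges_def)
    have "boundary1 ?C (collapse_chain G F c)
        = frag_extend (\<lambda>e. if e \<in> F then 0 else frag_of (tgt ?C {e})) c"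
      unfolding boundary1_def collapse_chain_def frag_extend_frag_extend
      by (rule frag_extend_eq) simp
    also have "\<dots> = frag_extend (\<lambda>e. if e \<in> F then 0 else frag_of (cls G F (tgt G e))) c"
      using tc by (intro frag_extend_eq) auto
    finally have "coeff (boundary1 ?C (collapse_chain G F c)) X
        = (\<Sum>e\<in>?k. coeff c e * (if e \<in> F then 0 else ?d e))"
      by (simp only: coeff_frag_extend if_distrib[of coeff] lookup_zero)
         (auto intro!: sum.cong)
    also have "\<dots> = (\<Sum>e\<in>?k. coeff c e * ?d e) - (\<Sum>e\<in>?k. if e \<in> F then coeff c e * ?d e else 0)"
      unfolding sum_subtractf[symmetric] by (intro sum.cong) auto
    also have "(\<Sum>e\<in>?k. coeff c e * ?d e) = 0"
    proof -
      have "frag_extend (\<lambda>v. frag_of (cls G F v)) (boundary1 G c) = 0" using c by (simp add: H1_def)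
      then have "frag_extend (\<lambda>e. frag_of (cls G F (tgt G e))) c = 0"
        by (simp add: boundary1_def frag_extend_frag_extend)
      then have "coeff (frag_extend (\<lambda>e. frag_of (cls G F (tgt G e))) c) X = 0" by simp
      then show ?thesis by (simp only: coeff_frag_extend)
    qed
    also have "(\<Sum>e\<in>?k. if e \<in> F then coeff c e * ?d e else 0) = (\<Sum>e\<in>?k \<inter> F. coeff c e * ?d e)"
      by (rule sum.inter_restrict[symmetric]) simp
    also have "\<dots> = 0"
    proof -
      have F: "subgraph F G" using wide_subgraphD[OF G(2)] by simp
      have kE: "e \<in> edges G" if "e \<in> ?k" for e using that H1_keys[OF c] by auto
      have "(\<Sum>e\<in>?k \<inter> F. coeff c e * ?d e) = (\<Sum>e\<in>?k \<inter> F. - (coeff c e * ?d e))"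
      proof (rule sum.reindex_bij_witness[of _ "inv_of G" "inv_of G"])
        fix e assume e: "e \<in> ?k \<inter> F"
        have eE: "e \<in> edges G" using e kE by auto
        have eF: "inv_of G e \<in> F" using e F by (auto simp: subgraph_def)
        show "inv_of G (inv_of G e) = e" "inv_of G (inv_of G e) = e" using eE G by (simp_all add: graph_simps)
        show "inv_of G e \<in> ?k \<inter> F" "inv_of G e \<in> ?k \<inter> F"
          using e eF H1_antisym[OF c eE] by (auto simp: in_keys_iff)
        have "cls G F (tgt G e) = cls G F (src G e)"
        proof -
          have "edge_path G (src G (src G e)) [e] (src G (tgt G e))"
            using eE G by (simp add: src_vert graph_simps)
          moreover have "src G e \<in> F" "tgt G e \<in> F"
            using e F by (auto simp: subgraph_def tgt_def)
          ultimately show ?thesis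
            using cls_reachable_iff[OF G, of "src G e" "tgt G e"] e by (metis IntD2 empty_set empty_subsetI insert_subset list.simps(15))
        qed
        then show "- (coeff c (inv_of G e) * ?d (inv_of G e)) = coeff c e * ?d e"
          using eE G H1_antisym[OF c eE] by (simp add: graph_simps)
      qed
      then show ?thesis by (simp add: sum_negf)
    qed
    finally show "coeff (boundary1 ?C (collapse_chain G F c)) X = coeff 0 X" by simp
  qed
  ultimately show ?thesis by (simp add: H1_def chains1_def)
qed

definition acyclic_subgraph :: "'a set \<Rightarrow> 'a graph \<Rightarrow> bool" where
  "acyclic_subgraph F G \<longleftrightarrow>
     (\<forall>u p. edge_path G u p u \<longrightarrow> reduced G p \<longrightarrow> set p \<subseteq> F \<longrightarrow> p = [])"

lemma acyclic_subgraph_cycle: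
  assumes "is_graph G" "subgraph F G" "acyclic_subgraph F G" "c \<in> H1 G" "Poly_Mapping.keys c \<subseteq> F"
  shows "c = 0"
proof (rule ccontr)
  assume "c \<noteq> 0"
  then obtain e where e: "e \<in> Poly_Mapping.keys c" by (metis ex_in_conv keys_eq_empty)
  have "c \<in> H1 (restrict_graph G F)" using assms by (simp add: H1_restrict)
  then obtain w where w: "edge_path (restrict_graph G F) (src G e) w (src G e)" "reduced G (w @ w)" "e \<in> set w"
    using cycle_edge_on_closed_path[OF is_graph_restrict[OF assms(1,2)] _ e] by auto
  then have "w = []"
    using assms(3) unfolding edge_path_restrict[OF assms(2)] acyclic_subgraph_def
    by (meson reduced_append)
  then show False using w(3) by simp
qed

lemma collapse_chain_inj:
  assumes "is_graph G" "wide_subgraph F G" "acyclic_subgraph F G" "c \<in> H1 G" "collapse_chain G F c = 0"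
  shows "c = 0"
proof -
  have "(\<lambda>e. {e}) ` (Poly_Mapping.keys c - F) = {}"
    using keys_collapse_chain[of G F c] assms(5) by simp
  then have "Poly_Mapping.keys c \<subseteq> F" by auto
  then show ?thesis using acyclic_subgraph_cycle assms wide_subgraphD by blast
qed

text \<open>A cycle of the collapsed graph lifts: replace every edge by itself followed by a path inside
  \<open>F\<close> back to a chosen root of the component where it ends.\<close>

lemma rk_collapse_le:
  assumes G: "is_graph G" "wide_subgraph F G"
  shows "rk (collapse G F) \<le> rk G"
proof -
  let ?C = "collapse G F"
  \<comment> \<open>Any choice of one vertex in each component of \<open>F\<close> will do.\<close>
  define root where "root X = (SOME r. r \<in> X \<inter> verts G)" for X
  have root: "root (cls G F v) \<in> cls G F v \<inter> verts G" if "v \<in> verts G" for v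
    unfolding root_def
    using someI[of "\<lambda>r. r \<in> cls G F v \<inter> verts G" v] that self_in_cls[of v G F]
    by (simp add: vert_in_cells)
  have "\<exists>p. edge_path G (root (cls G F v)) p v \<and> set p \<subseteq> F" if v: "v \<in> verts G" for v
  proof -
    have "cls G F (root (cls G F v)) = cls G F v"
      using cls_eq[OF G vert_in_cells[OF v]] root[OF v] by blast
    moreover have "root (cls G F v) \<in> F" "v \<in> F" using root[OF v] v wide_subgraphD[OF G(2)] by auto
    ultimately show ?thesis
      using cls_reachable_iff[OF G, of "root (cls G F v)" v] root[OF v] v src_vert[OF G(1)] by simp
  qed
  then obtain \<gamma> where \<gamma>: "\<And>v. v \<in> verts G \<Longrightarrow> edge_path G (root (cls G F v)) (\<gamma> v) v"
    "\<And>v. v \<in> verts G \<Longrightarrow> set (\<gamma> v) \<subseteq> F" by metis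
  let ?g = "\<lambda>E. path_chain G (\<gamma> (tgt G (the_elem E)))"
  let ?f = "\<lambda>E. frag_of (the_elem E) - ?g E"
  have keysC: "\<exists>e. E = {e} \<and> e \<in> edges G \<and> e \<notin> F" if "c \<in> H1 ?C" "E \<in> Poly_Mapping.keys c" for c E
    using H1_keys[OF that(1)] that(2) by (auto simp: edges_collapse[OF G])
  have gF: "Poly_Mapping.keys (?g E) \<subseteq> F" "?g E \<in> chains1 G"
    if cE: "c \<in> H1 ?C" "E \<in> Poly_Mapping.keys c" for c E
  proof -
    obtain e where e: "E = {e}" "e \<in> edges G" using keysC[OF cE] by blast
    then have t: "tgt G (the_elem E) \<in> verts G" using G by (simp add: graph_simps)
    have "inv_of G ` F \<subseteq> F" using wide_subgraphD[OF G(2)] by (auto simp: subgraph_def)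
    then show "Poly_Mapping.keys (?g E) \<subseteq> F"
      using keys_path_chain[of G "\<gamma> (tgt G (the_elem E))"] \<gamma>(2)[OF t] by blast
    show "?g E \<in> chains1 G" using path_chain_chains1[OF G(1) edge_path_edges[OF \<gamma>(1)[OF t]]] .
  qed
  have co: "coeff (frag_extend ?f c) e =
      coeff c {e} - (\<Sum>E\<in>Poly_Mapping.keys c. coeff c E * coeff (?g E) e)" if c: "c \<in> H1 ?C" for c e
  proof -
    have "coeff (frag_extend ?f c) e
        = (\<Sum>E\<in>Poly_Mapping.keys c. (if E = {e} then coeff c {e} else 0) - coeff c E * coeff (?g E) e)"
      unfolding coeff_frag_extend
    proof (rule sum.cong[OF refl])
      fix E assume "E \<in> Poly_Mapping.keys c"
      then obtain a where "E = {a}" using keysC[OF c] by blast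
      then show "coeff c E * coeff (?f E) e = (if E = {e} then coeff c {e} else 0) - coeff c E * coeff (?g E) e"
        by (auto simp: lookup_minus right_diff_distrib)
    qed
    also have "\<dots> = (\<Sum>E\<in>Poly_Mapping.keys c. if E = {e} then coeff c {e} else 0)
        - (\<Sum>E\<in>Poly_Mapping.keys c. coeff c E * coeff (?g E) e)" by (rule sum_subtractf)
    also have "(\<Sum>E\<in>Poly_Mapping.keys c. if E = {e} then coeff c {e} else 0) = coeff c {e}"
      by (auto simp: in_keys_iff)
    finally show ?thesis .
  qed
  show ?thesis
  proof (rule rk_mono_frag_extend[of _ ?f])
    fix c assume c: "c \<in> H1 ?C"
    have "Poly_Mapping.keys (frag_extend ?f c) \<subseteq> edges G"
    proof
      fix e assume "e \<in> Poly_Mapping.keys (frag_extend ?f c)"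
      then obtain E where E: "E \<in> Poly_Mapping.keys c" "e \<in> Poly_Mapping.keys (?f E)"
        using keys_frag_extend[of ?f c] by blast
      then have "e \<in> Poly_Mapping.keys (frag_of (the_elem E)) \<union> Poly_Mapping.keys (?g E)"
        using Poly_Mapping.keys_diff[of "frag_of (the_elem E)" "?g E"] by auto
      moreover have "Poly_Mapping.keys (?g E) \<subseteq> edges G" using gF(2)[OF c E(1)] by (simp add: chains1_def)
      ultimately show "e \<in> edges G" using keysC[OF c E(1)] by auto
    qed
    moreover have "coeff (frag_extend ?f c) (inv_of G e) = - coeff (frag_extend ?f c) e"
      if e: "e \<in> edges G" for e
    proof -
      have "coeff c {inv_of G e} = - coeff c {e}"
      proof (cases "e \<in> F")
        case True
        then have "inv_of G e \<in> F" using wide_subgraphD[OF G(2)] by (simp add: subgraph_def)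
        then have "{e} \<notin> Poly_Mapping.keys c" "{inv_of G e} \<notin> Poly_Mapping.keys c"
          using keysC[OF c] True by blast+
        then show ?thesis by (simp add: in_keys_iff)
      next
        case False
        then have "{e} \<in> edges ?C" using e by (simp add: edges_collapse[OF G])
        from H1_antisym[OF c this] show ?thesis by (simp add: collapse_def)
      qed
      moreover have "(\<Sum>E\<in>Poly_Mapping.keys c. coeff c E * coeff (?g E) (inv_of G e))
          = (\<Sum>E\<in>Poly_Mapping.keys c. - (coeff c E * coeff (?g E) e))"
        using gF(2)[OF c] e by (intro sum.cong) (auto simp: chains1_def)
      ultimately show ?thesis unfolding co[OF c] by (simp add: sum_negf)
    qed
    moreover have "boundary1 G (frag_extend ?f c) = 0"
    proof -
      have "boundary1 G (frag_extend ?f c) = frag_extend (\<lambda>E. frag_of (root (tgt ?C E))) c"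
        unfolding boundary1_def frag_extend_frag_extend
      proof (rule frag_extend_eq)
        fix E assume "E \<in> Poly_Mapping.keys c"
        then obtain e where e: "E = {e}" "e \<in> edges G" "e \<notin> F" using keysC[OF c] by blast
        have t: "tgt G e \<in> verts G" using e G by (simp add: graph_simps)
        have "tgt ?C E = cls G F (tgt G e)"
          using e tgt_collapse[OF G, of e] cls_outside[of e G F] by (simp add: edge_in_cells)
        then show "frag_extend (\<lambda>e. frag_of (tgt G e)) (?f E) = frag_of (root (tgt ?C E))"
          using boundary_path_chain[OF G(1) \<gamma>(1)[OF t]] e
          by (simp add: frag_extend_diff boundary1_def)
      qed
      also have "\<dots> = frag_extend (\<lambda>X. frag_of (root X)) (boundary1 ?C c)"
        by (simp add: boundary1_def frag_extend_frag_extend)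
      also have "\<dots> = 0" using c by (simp add: H1_def)
      finally show ?thesis .
    qed
    ultimately show "frag_extend ?f c \<in> H1 G" by (simp add: H1_def chains1_def)
    show "c = 0" if z: "frag_extend ?f c = 0"
    proof (rule ccontr)
      assume "c \<noteq> 0"
      then obtain E where E: "E \<in> Poly_Mapping.keys c" by (metis ex_in_conv keys_eq_empty)
      then obtain e where e: "E = {e}" "e \<notin> F" using keysC[OF c] by blast
      have "coeff (?g E') e = 0" if "E' \<in> Poly_Mapping.keys c" for E'
        using gF(1)[OF c that] e(2) by (auto simp: in_keys_iff subset_iff)
      then have "coeff (frag_extend ?f c) e = coeff c {e}" unfolding co[OF c] by simp
      then show False using z E e by (simp add: in_keys_iff)
    qed
  qed
qed

text \<open>The collapsed subgraph carries no cycles, so independent cycles of a component stay independent in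
  the collapsed graph, where they lie in the corresponding component.\<close>

lemma component_rank_le:
  fixes Q :: "'q graph"
  assumes Q: "is_graph Q" and F: "wide_subgraph F Q" "acyclic_subgraph F Q" and x: "x \<in> cells Q"
    and bound: "\<And>B. finite B \<Longrightarrow> independent B \<Longrightarrow> B \<subseteq> H1 (collapse Q F) \<Longrightarrow>
      (\<And>b. b \<in> B \<Longrightarrow> Poly_Mapping.keys b \<subseteq> component_of (collapse Q F) (cls Q F x)) \<Longrightarrow> card B \<le> n"
  shows "rk (restrict_graph Q (component_of Q x)) \<le> enat n"
proof (rule rk_le)
  let ?C = "component_of Q x"
  fix B assume B: "finite B" "B \<subseteq> H1 (restrict_graph Q ?C)" "independent B"
  have BQ: "B \<subseteq> H1 Q" "\<And>b. b \<in> B \<Longrightarrow> Poly_Mapping.keys b \<subseteq> ?C"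
    using B(2) H1_restrict[OF Q subgraph_component[OF Q]] by auto
  let ?f = "collapse_chain Q F"
  have im: "inj_on ?f B" "independent (?f ` B)"
    using independent_frag_extend[OF B(1,3) BQ(1), of "\<lambda>e. if e \<in> F then 0 else frag_of {e}"]
      collapse_chain_inj[OF Q F] unfolding collapse_chain_def by blast+
  have "card (?f ` B) \<le> n"
  proof (rule bound)
    show "finite (?f ` B)" using B(1) by simp
    show "independent (?f ` B)" by (rule im(2))
    show "?f ` B \<subseteq> H1 (collapse Q F)" using BQ(1) collapse_chain_H1[OF Q F(1)] by blast
    fix c assume "c \<in> ?f ` B"
    then obtain b where b: "b \<in> B" "c = ?f b" by blast
    show "Poly_Mapping.keys c \<subseteq> component_of (collapse Q F) (cls Q F x)"
    proof
      fix E assume "E \<in> Poly_Mapping.keys c"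
      then obtain e where e: "E = {e}" "e \<in> Poly_Mapping.keys b" "e \<notin> F"
        using b(2) by (auto simp: keys_collapse_chain)
      then have eC: "e \<in> ?C" using BQ(2)[OF b(1)] by blast
      then have ec: "e \<in> cells Q" by (simp add: component_of_def)
      obtain p where p: "edge_path Q (src Q x) p (src Q e)" using eC by (auto simp: component_of_def)
      have E: "E = cls Q F e" using e(1,3) ec by (simp add: cls_outside)
      show "E \<in> component_of (collapse Q F) (cls Q F x)"
        using edge_path_collapse[OF Q F(1) p] ec x
        by (simp add: component_of_def E cells_collapse src_collapse[OF Q F(1)])
    qed
  qed
  then show "enat (card B) \<le> enat n" using card_image[OF im(1)] by simp
qed

section \<open>Coverings\<close>

text \<open>Coverings without the demand that the graphs are connected, which a pullback need not satisfy.\<close>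

definition local_covering :: "('a \<Rightarrow> 'b) \<Rightarrow> 'a graph \<Rightarrow> 'b graph \<Rightarrow> bool" where
  "local_covering h G H \<longleftrightarrow> is_graph G \<and> is_graph H \<and> dimension_preserving h G H \<and>
     (\<forall>x \<in> verts G. bij_betw h (star G x) (star H (h x)))"

lemma covering_local: "covering f G H \<Longrightarrow> local_covering f G H"
  by (simp add: covering_def local_covering_def)

lemma local_coveringD:
  assumes "local_covering h G H"
  shows "is_graph G" "is_graph H" "dimension_preserving h G H"
  using assms by (auto simp: local_covering_def)

lemma local_covering_inj:
  assumes "local_covering h G H" "e \<in> edges G" "e' \<in> edges G" "src G e = src G e'" "h e = h e'"
  shows "e = e'"
proof -
  have "src G e \<in> verts G" using assms by (simp add: local_covering_def graph_simps)
  then have "inj_on h (star G (src G e))" using assms(1) by (auto simp: local_covering_def bij_betw_def)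
  then show ?thesis using assms by (auto simp: inj_on_def star_def)
qed

lemma local_covering_lift_edge:
  assumes "local_covering h G H" "u \<in> verts G" "d \<in> edges H" "src H d = h u"
  obtains e where "e \<in> edges G" "src G e = u" "h e = d"
proof -
  have "h ` star G u = star H (h u)" using assms by (auto simp: local_covering_def bij_betw_def)
  moreover have "d \<in> star H (h u)" using assms by (simp add: star_def)
  ultimately have "d \<in> h ` star G u" by simp
  then obtain e where "e \<in> star G u" "h e = d" by auto
  then show ?thesis using that[of e] by (simp add: star_def)
qed

text \<open>A local covering is injective on the edges at a vertex, so it creates no backtracking.\<close>

lemma reduced_map:
  assumes h: "local_covering h G H" and p: "edge_path G u p v" "reduced G p"
  shows "reduced H (map h p)"
  using p
proof (induction p arbitrary: u)
  case (Cons e p)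
  note G = local_coveringD[OF h]
  have IH: "reduced H (map h p)" using Cons by (auto simp: reduced_Cons)
  have "hd (map h p) \<noteq> inv_of H (h e)" if "p \<noteq> []"
  proof
    assume a: "hd (map h p) = inv_of H (h e)"
    have e: "e \<in> edges G" "hd p \<in> edges G" "src G (hd p) = tgt G e"
      using Cons.prems that by (auto simp: neq_Nil_conv)
    have "h (hd p) = h (inv_of G e)"
      using a that e dimension_preservingD(5)[OF G(3), of e] by (simp add: hd_map edge_in_cells)
    then have "hd p = inv_of G e"
      using local_covering_inj[OF h e(2) inv_in_edges[OF G(1) e(1)]] e(3) by (simp add: src_inv)
    then show False using Cons.prems that by (simp add: reduced_Cons)
  qed
  then show ?case using IH by (auto simp: reduced_Cons)
qed simp

lemma edge_path_lift:
  assumes h: "local_covering h G H" and u: "u \<in> verts G" and q: "edge_path H (h u) q w"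
  shows "\<exists>p v. edge_path G u p v \<and> map h p = q \<and> h v = w"
  using u q
proof (induction q arbitrary: u)
  case Nil
  then show ?case by (intro exI[of _ "[]"] exI[of _ u]) simp
next
  case (Cons d q)
  note G = local_coveringD[OF h]
  obtain e where e: "e \<in> edges G" "src G e = u" "h e = d"
    using local_covering_lift_edge[OF h] Cons.prems by auto
  have t: "tgt G e \<in> verts G" using e G by (simp add: graph_simps)
  moreover have "h (tgt G e) = tgt H d"
    using dimension_preservingD(6)[OF G(3,1)] e by (simp add: edge_in_cells)
  ultimately obtain p v where "edge_path G (tgt G e) p v" "map h p = q" "h v = w"
    using Cons.IH[of "tgt G e"] Cons.prems by auto
  then show ?case using e by (intro exI[of _ "e # p"] exI[of _ v]) simp
qed

lemma local_covering_comp: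
  assumes "local_covering h G H" "local_covering k H K"
  shows "local_covering (\<lambda>x. k (h x)) G K"
proof -
  note h = local_coveringD[OF assms(1)] and k = local_coveringD[OF assms(2)]
  note dh = dimension_preservingD[OF h(3)] and dk = dimension_preservingD[OF k(3)]
  have "dimension_preserving (\<lambda>x. k (h x)) G K"
    unfolding dimension_preserving_def graph_map_def using dh dk by auto
  moreover have "bij_betw (\<lambda>x. k (h x)) (star G v) (star K (k (h v)))" if "v \<in> verts G" for v
  proof -
    have "bij_betw h (star G v) (star H (h v))" "bij_betw k (star H (h v)) (star K (k (h v)))"
      using assms that dh(2) by (auto simp: local_covering_def)
    from bij_betw_trans[OF this] show ?thesis by (simp add: comp_def)
  qed
  ultimately show ?thesis using h k by (simp add: local_covering_def)
qed

subsection \<open>Preimages of subgraphs\<close>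

lemma wide_preimage:
  assumes "is_graph G" "dimension_preserving h G H" "wide_subgraph F H"
  shows "wide_subgraph (preimage h G F) G"
  using assms dimension_preservingD[OF assms(2)]
  by (auto simp: wide_subgraph_def subgraph_def preimage_def vert_in_cells inv_in_cells src_in_verts)

lemma acyclic_preimage:
  assumes h: "local_covering h G H" and F: "acyclic_subgraph F H"
  shows "acyclic_subgraph (preimage h G F) G"
  unfolding acyclic_subgraph_def
proof (intro allI impI)
  fix u p assume p: "edge_path G u p u" "reduced G p" "set p \<subseteq> preimage h G F"
  note G = local_coveringD[OF h]
  have "edge_path H (h u) (map h p) (h u)" using edge_path_map[OF G(1,3) p(1)] .
  moreover have "reduced H (map h p)" using reduced_map[OF h p(1,2)] .
  moreover have "set (map h p) \<subseteq> F" using p(3) by (auto simp: preimage_def)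
  ultimately have "map h p = []" using F unfolding acyclic_subgraph_def by blast
  then show "p = []" by simp
qed

text \<open>A reduced path inside the preimage between two points of one fibre would map to a reduced
  closed path of the forest.\<close>

lemma preimage_fibre_unique:
  assumes h: "local_covering h G H" and F: "wide_subgraph F H" "acyclic_subgraph F H"
    and ab: "a \<in> verts G" "b \<in> verts G" "cls G (preimage h G F) a = cls G (preimage h G F) b" "h a = h b"
  shows "a = b"
proof -
  note G = local_coveringD[OF h]
  have W: "wide_subgraph (preimage h G F) G" using wide_preimage[OF G(1,3) F(1)] .
  have "a \<in> preimage h G F" "b \<in> preimage h G F" using ab W by (auto simp: wide_subgraph_def)
  then obtain p where p: "edge_path G a p b" "set p \<subseteq> preimage h G F"
    using cls_reachable_iff[OF G(1) W, of a b] ab src_vert[OF G(1)] by auto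
  obtain q where q: "edge_path G a q b" "reduced G q" "set q \<subseteq> set p"
    using reduce_path[OF G(1) p(1)] by blast
  have "edge_path H (h a) (map h q) (h a)" using edge_path_map[OF G(1,3) q(1)] ab by simp
  moreover have "reduced H (map h q)" using reduced_map[OF h q(1,2)] .
  moreover have "set (map h q) \<subseteq> F" using q(3) p(2) by (auto simp: preimage_def)
  ultimately have "map h q = []" using F unfolding acyclic_subgraph_def by blast
  then show ?thesis using q(1) by simp
qed

subsection \<open>Induced maps of collapsed graphs\<close>

lemma induced_map_cls:
  assumes G: "is_graph G" "is_graph H" "dimension_preserving h G H" "wide_subgraph F H" and x: "x \<in> cells G"
  shows "induced_map h H F (cls G (preimage h G F) x) = cls H F (h x)"
proof -
  let ?P = "preimage h G F"
  have W: "wide_subgraph ?P G" using wide_preimage[OF G(1,3,4)] .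
  have "h ` cls G ?P x \<subseteq> cls H F (h x)"
  proof (cases "x \<in> ?P")
    case True
    show ?thesis
    proof
      fix z assume "z \<in> h ` cls G ?P x"
      then obtain y where y: "y \<in> cls G ?P x" "z = h y" by blast
      have yc: "y \<in> cells G" using y(1) cls_subset_cells[of G ?P x] by auto
      have yP: "y \<in> ?P" using cls_mem_F_iff[OF G(1) W x y(1)] True by simp
      have "cls G ?P x = cls G ?P y" using cls_eq[OF G(1) W x y(1)] by simp
      then obtain p where p: "edge_path G (src G x) p (src G y)" "set p \<subseteq> ?P"
        using cls_reachable_iff[OF G(1) W True yP] by blast
      have "edge_path H (src H (h x)) (map h p) (src H (h y))"
        using edge_path_map[OF G(1,3) p(1)] dimension_preservingD(4)[OF G(3)] x yc by simp
      moreover have "set (map h p) \<subseteq> F" using p(2) by (auto simp: preimage_def)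
      moreover have "h x \<in> F" "h y \<in> F" using True yP by (auto simp: preimage_def)
      ultimately have "cls H F (h x) = cls H F (h y)" using cls_reachable_iff[OF G(2,4)] by blast
      then show "z \<in> cls H F (h x)"
        using self_in_cls[of "h y" H F] y(2) dimension_preservingD(1)[OF G(3) yc] by simp
    qed
  next
    case False
    then show ?thesis
      using x dimension_preservingD(1)[OF G(3) x] by (simp add: cls_outside self_in_cls)
  qed
  moreover have "h ` cls G ?P x \<noteq> {}" using self_in_cls[OF x] by auto
  ultimately show ?thesis
    unfolding induced_map_def
    using collapse_rel_image[OF G(2,4) dimension_preservingD(1)[OF G(3) x]] by simp
qed

lemma induced_map_dimension_preserving:
  assumes G: "is_graph G" "is_graph H" "dimension_preserving h G H" "wide_subgraph F H"
  shows "dimension_preserving (induced_map h H F) (collapse G (preimage h G F)) (collapse H F)"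
proof -
  let ?P = "preimage h G F"
  have W: "wide_subgraph ?P G" using wide_preimage[OF G(1,3,4)] .
  note ind = induced_map_cls[OF G]
  note h = dimension_preservingD[OF G(3)]
  have vi: "induced_map h H F X \<in> verts (collapse H F) \<longleftrightarrow> X \<in> verts (collapse G ?P)"
    if X: "X \<in> cells (collapse G ?P)" for X
  proof -
    obtain x where x: "x \<in> cells G" "X = cls G ?P x" using X by (auto simp: cells_collapse)
    have "x \<in> ?P \<longleftrightarrow> h x \<in> F" using x(1) by (simp add: preimage_def)
    then show ?thesis using cls_in_verts_iff[OF G(1) W x(1)] cls_in_verts_iff[OF G(2,4) h(1)[OF x(1)]] x
      by (simp add: ind)
  qed
  have 1: "induced_map h H F X \<in> cells (collapse H F) \<and>
      induced_map h H F (src (collapse G ?P) X) = src (collapse H F) (induced_map h H F X) \<and>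
      induced_map h H F (inv_of (collapse G ?P) X) = inv_of (collapse H F) (induced_map h H F X)"
    if X: "X \<in> cells (collapse G ?P)" for X
  proof -
    obtain x where x: "x \<in> cells G" "X = cls G ?P x" using X by (auto simp: cells_collapse)
    have "src G x \<in> cells G" "inv_of G x \<in> cells G" "h x \<in> cells H"
      using x G h(1) by (auto simp: src_in_verts vert_in_cells inv_in_cells)
    then show ?thesis
      using x G W h by (simp add: ind src_collapse inv_collapse cells_collapse)
  qed
  show ?thesis
    unfolding dimension_preserving_def graph_map_def
    using 1 vi by (auto simp: edges_def vert_in_cells)
qed

text \<open>Two edges at one vertex of the collapsed graph with the same image start in one component of the
  preimage and over one vertex, hence at one vertex. For surjectivity, lift a path in \<open>F\<close> to the source of
  the given edge.\<close>

lemma local_covering_collapse: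
  assumes h: "local_covering h G H" and F: "wide_subgraph F H" "acyclic_subgraph F H"
  shows "local_covering (induced_map h H F) (collapse G (preimage h G F)) (collapse H F)"
proof -
  let ?P = "preimage h G F"
  note G = local_coveringD[OF h]
  have W: "wide_subgraph ?P G" using wide_preimage[OF G(1,3) F(1)] .
  note ind = induced_map_cls[OF G F(1)]
  let ?C = "collapse G ?P" and ?D = "collapse H F" and ?h = "induced_map h H F"
  have single: "?h {e} = {h e}" if "e \<in> edges G - ?P" for e
  proof -
    have e: "e \<in> cells G" "e \<notin> ?P" "h e \<in> cells H" using that dimension_preservingD(1)[OF G(3)] by (auto simp: edge_in_cells)
    then have "h e \<notin> F" by (simp add: preimage_def)
    then show ?thesis using ind[of e] e by (simp add: cls_outside)
  qed
  have "bij_betw ?h (star ?C X) (star ?D (?h X))" if X: "X \<in> verts ?C" for X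
  proof -
    obtain v where v: "v \<in> verts G" "X = cls G ?P v" using X verts_collapse[OF G(1) W] by auto
    have hX: "?h X = cls H F (h v)" using v ind by (simp add: vert_in_cells)
    have srcC: "src ?C {e} = cls G ?P (src G e)" if "e \<in> edges G - ?P" for e
      using src_collapse[OF G(1) W, of e] that cls_outside[of e G ?P] by (simp add: edge_in_cells)
    have srcD: "src ?D {d} = cls H F (src H d)" if "d \<in> edges H - F" for d
      using src_collapse[OF G(2) F(1), of d] that cls_outside[of d H F] by (simp add: edge_in_cells)
    have inj: "inj_on ?h (star ?C X)"
    proof (rule inj_onI)
      fix E E' assume E: "E \<in> star ?C X" "E' \<in> star ?C X" "?h E = ?h E'"
      obtain e e' where e: "E = {e}" "e \<in> edges G - ?P" "E' = {e'}" "e' \<in> edges G - ?P"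
        using E by (auto simp: star_def edges_collapse[OF G(1) W])
      have hh: "h e = h e'" using E(3) e single by simp
      have "cls G ?P (src G e) = cls G ?P (src G e')" using E(1,2) e srcC by (simp add: star_def)
      moreover have "h (src G e) = h (src G e')"
        using hh e dimension_preservingD(4)[OF G(3)] by (simp add: edge_in_cells)
      ultimately have "src G e = src G e'"
        using preimage_fibre_unique[OF h F] e G(1) by (simp add: graph_simps)
      then show "E = E'" using local_covering_inj[OF h] e hh by blast
    qed
    moreover have "?h ` star ?C X = star ?D (?h X)"
    proof
      show "?h ` star ?C X \<subseteq> star ?D (?h X)"
        using dimension_preservingD[OF induced_map_dimension_preserving[OF G F(1)]]
        by (auto simp: star_def edge_in_cells)
      show "star ?D (?h X) \<subseteq> ?h ` star ?C X"
      proof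
        fix E assume E: "E \<in> star ?D (?h X)"
        then obtain d where d: "E = {d}" "d \<in> edges H - F"
          by (auto simp: star_def edges_collapse[OF G(2) F(1)])
        have sd: "src H d \<in> verts H" "h v \<in> verts H"
          using d G(2) dimension_preservingD(2)[OF G(3) v(1)] by (auto simp: graph_simps)
        then have "src H d \<in> F" "h v \<in> F" using wide_subgraphD(2)[OF F(1)] by auto
        moreover have "cls H F (h v) = cls H F (src H d)" using E d srcD hX by (simp add: star_def)
        ultimately obtain q where q: "edge_path H (h v) q (src H d)" "set q \<subseteq> F"
          using cls_reachable_iff[OF G(2) F(1), of "h v" "src H d"] src_vert[OF G(2)] sd by auto
        obtain p w where p: "edge_path G v p w" "map h p = q" "h w = src H d"
          using edge_path_lift[OF h v(1) q(1)] by blast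
        have w: "w \<in> verts G" using p(1) by (rule edge_path_end)
        obtain e where e: "e \<in> edges G" "src G e = w" "h e = d"
          using local_covering_lift_edge[OF h w, of d] p(3) d by auto
        have eP: "e \<notin> ?P" using e d by (simp add: preimage_def)
        have "set p \<subseteq> ?P" using edge_path_edges[OF p(1)] p(2) q(2) by (auto simp: preimage_def edge_in_cells)
        then have "cls G ?P v = cls G ?P w"
          using cls_reachable_iff[OF G(1) W, of v w] p(1) v(1) w wide_subgraphD(2)[OF W] src_vert[OF G(1)]
          by auto
        then have "{e} \<in> star ?C X"
          using srcC[of e] e eP v(2) by (auto simp: star_def edges_collapse[OF G(1) W])
        moreover have "?h {e} = E" using single[of e] e eP d by simp
        ultimately show "E \<in> ?h ` star ?C X" by blast
      qed
    qed
    ultimately show ?thesis by (simp add: bij_betw_def)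
  qed
  then show ?thesis
    using is_graph_collapse[OF G(1) W] is_graph_collapse[OF G(2) F(1)] induced_map_dimension_preserving[OF G F(1)]
    by (simp add: local_covering_def)
qed

subsection \<open>Pullbacks\<close>

lemma pullback_simps [simp]:
  "inv_of (pullback G1 p1 G2 p2) = map_prod (inv_of G1) (inv_of G2)"
  "src (pullback G1 p1 G2 p2) = map_prod (src G1) (src G2)"
  by (simp_all add: pullback_def)

lemma verts_pullback:
  "verts (pullback G1 p1 G2 p2) = {(x1, x2). x1 \<in> verts G1 \<and> x2 \<in> verts G2 \<and> p1 x1 = p2 x2}"
  by (auto simp: verts_def pullback_def edges_def)

lemma edges_pullback:
  "edges (pullback G1 p1 G2 p2) = {(x1, x2). x1 \<in> edges G1 \<and> x2 \<in> edges G2 \<and> p1 x1 = p2 x2}"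
  unfolding edges_def[of "pullback G1 p1 G2 p2"] verts_pullback
  by (auto simp: pullback_def edges_def)

lemma cells_pullback:
  "cells (pullback G1 p1 G2 p2) = {(x1, x2). (x1 \<in> verts G1 \<and> x2 \<in> verts G2 \<or> x1 \<in> edges G1 \<and> x2 \<in> edges G2) \<and> p1 x1 = p2 x2}"
  by (auto simp: pullback_def)

lemma is_graph_pullback:
  assumes "is_graph G1" "is_graph G2" "dimension_preserving p1 G1 H" "dimension_preserving p2 G2 H"
  shows "is_graph (pullback G1 p1 G2 p2)"
proof -
  note d1 = dimension_preservingD[OF assms(3)] and d2 = dimension_preservingD[OF assms(4)]
  show ?thesis
    unfolding is_graph_def verts_pullback
    using assms(1,2) d1(4,5) d2(4,5)
    by (auto simp: cells_pullback inv_vert src_vert graph_simps vert_in_cells)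
qed

lemma pullback_local_coverings:
  assumes h1: "local_covering p1 G1 H" and h2: "local_covering p2 G2 H"
  shows "local_covering fst (pullback G1 p1 G2 p2) G1" "local_covering snd (pullback G1 p1 G2 p2) G2"
proof -
  let ?Q = "pullback G1 p1 G2 p2"
  note G1 = local_coveringD[OF h1] and G2 = local_coveringD[OF h2]
  have Q: "is_graph ?Q" using is_graph_pullback[OF G1(1) G2(1) G1(3) G2(3)] .
  have d: "dimension_preserving fst ?Q G1" "dimension_preserving snd ?Q G2"
    unfolding dimension_preserving_def graph_map_def verts_pullback edges_pullback
    by (auto simp: cells_pullback vert_in_cells edge_in_cells)
  have b1: "bij_betw fst (star ?Q (a, b)) (star G1 a)" if v: "(a, b) \<in> verts ?Q" for a b
  proof -
    have v: "a \<in> verts G1" "b \<in> verts G2" "p1 a = p2 b" using v by (auto simp: verts_pullback)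
    have "inj_on fst (star ?Q (a, b))"
    proof (rule inj_onI)
      fix x y assume x: "x \<in> star ?Q (a, b)" "y \<in> star ?Q (a, b)" "fst x = fst y"
      then have "snd x \<in> edges G2" "snd y \<in> edges G2" "src G2 (snd x) = src G2 (snd y)"
        "p2 (snd x) = p2 (snd y)" by (auto simp: star_def edges_pullback)
      then have "snd x = snd y" using local_covering_inj[OF h2] by blast
      then show "x = y" using x(3) by (simp add: prod_eq_iff)
    qed
    moreover have "fst ` star ?Q (a, b) = star G1 a"
    proof
      show "fst ` star ?Q (a, b) \<subseteq> star G1 a" by (auto simp: star_def edges_pullback)
      show "star G1 a \<subseteq> fst ` star ?Q (a, b)"
      proof
        fix e assume e: "e \<in> star G1 a"
        then have "p1 e \<in> edges H" "src H (p1 e) = p2 b"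
          using dimension_preservingD(3,4)[OF G1(3)] v(3) by (auto simp: star_def edge_in_cells dest: sym)
        then obtain e2 where "e2 \<in> edges G2" "src G2 e2 = b" "p2 e2 = p1 e"
          using local_covering_lift_edge[OF h2 v(2)] by blast
        then have "(e, e2) \<in> star ?Q (a, b)" using e by (auto simp: star_def edges_pullback)
        then show "e \<in> fst ` star ?Q (a, b)" by force
      qed
    qed
    ultimately show ?thesis by (simp add: bij_betw_def)
  qed
  have b2: "bij_betw snd (star ?Q (a, b)) (star G2 b)" if v: "(a, b) \<in> verts ?Q" for a b
  proof -
    have v: "a \<in> verts G1" "b \<in> verts G2" "p1 a = p2 b" using v by (auto simp: verts_pullback)
    have "inj_on snd (star ?Q (a, b))"
    proof (rule inj_onI)
      fix x y assume x: "x \<in> star ?Q (a, b)" "y \<in> star ?Q (a, b)" "snd x = snd y"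
      then have "fst x \<in> edges G1" "fst y \<in> edges G1" "src G1 (fst x) = src G1 (fst y)"
        "p1 (fst x) = p1 (fst y)" by (auto simp: star_def edges_pullback)
      then have "fst x = fst y" using local_covering_inj[OF h1] by blast
      then show "x = y" using x(3) by (simp add: prod_eq_iff)
    qed
    moreover have "snd ` star ?Q (a, b) = star G2 b"
    proof
      show "snd ` star ?Q (a, b) \<subseteq> star G2 b" by (auto simp: star_def edges_pullback)
      show "star G2 b \<subseteq> snd ` star ?Q (a, b)"
      proof
        fix e assume e: "e \<in> star G2 b"
        then have "p2 e \<in> edges H" "src H (p2 e) = p1 a"
          using dimension_preservingD(3,4)[OF G2(3)] v(3) by (auto simp: star_def edge_in_cells dest: sym)
        then obtain e1 where "e1 \<in> edges G1" "src G1 e1 = a" "p1 e1 = p2 e"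
          using local_covering_lift_edge[OF h1 v(1)] by blast
        then have "(e1, e) \<in> star ?Q (a, b)" using e by (auto simp: star_def edges_pullback)
        then show "e \<in> snd ` star ?Q (a, b)" by force
      qed
    qed
    ultimately show ?thesis by (simp add: bij_betw_def)
  qed
  show "local_covering fst ?Q G1" "local_covering snd ?Q G2"
    unfolding local_covering_def using Q G1(1) G2(1) d b1 b2 by (auto simp del: pullback_simps)
qed

section \<open>Pairs in the extended spine\<close>

text \<open>A covering of a graph \<open>R\<close> that has one vertex and the two loops \<open>y\<close> and \<open>y'\<close>: every vertex of \<open>G\<close> starts
  exactly one edge over each of \<open>y\<close>, \<open>y'\<close> and their inverses.\<close>

locale rose_covering =
  fixes G :: "'a graph" and g :: "'a \<Rightarrow> 'b" and R :: "'b graph" and y y' :: 'b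
  assumes cov: "local_covering g G R"
    and one_vertex: "\<And>z w. z \<in> edges R \<Longrightarrow> w \<in> verts R \<Longrightarrow> src R z = w"
    and loops: "edges R = {y, inv_of R y, y', inv_of R y'}" "y' \<notin> {y, inv_of R y}"
begin

lemmas gr = local_coveringD(1)[OF cov] and grR = local_coveringD(2)[OF cov]
lemmas g_map = dimension_preservingD[OF local_coveringD(3)[OF cov]]

lemma loop_edges: "y \<in> edges R" "y' \<in> edges R" "inv_of R y \<in> edges R" "inv_of R y' \<in> edges R"
  using loops by auto

lemma loops_distinct:
  "y \<noteq> inv_of R y" "y' \<noteq> inv_of R y'" "y' \<noteq> y" "y' \<noteq> inv_of R y" "inv_of R y' \<noteq> y" "inv_of R y' \<noteq> inv_of R y"
  using loops(2) inv_neq[OF loop_edges(1)] inv_neq[OF loop_edges(2)]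
    inv_inv_edge[OF grR loop_edges(1)] inv_inv_edge[OF grR loop_edges(2)] by auto

lemma g_inv: "e \<in> edges G \<Longrightarrow> g (inv_of G e) = inv_of R (g e)"
  using g_map(5) by (simp add: edge_in_cells)

lemma g_edge: "e \<in> edges G \<Longrightarrow> g e \<in> edges R"
  by (rule g_map(3))

lemma edge_unique: "e \<in> edges G \<Longrightarrow> f \<in> edges G \<Longrightarrow> src G e = src G f \<Longrightarrow> g e = g f \<Longrightarrow> e = f"
  by (rule local_covering_inj[OF cov])

lemma edge_exists:
  assumes "w \<in> verts G" "z \<in> edges R"
  obtains e where "e \<in> edges G" "src G e = w" "g e = z"
  using local_covering_lift_edge[OF cov assms] one_vertex[OF assms(2) g_map(2)[OF assms(1)]] by blast

lemma card_star:
  assumes "w \<in> verts G"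
  shows "card (star G w) = 4"
proof -
  have "star R (g w) = edges R"
    using one_vertex[OF _ g_map(2)[OF assms]] by (auto simp: star_def)
  moreover have "bij_betw g (star G w) (star R (g w))" using cov assms by (simp add: local_covering_def)
  moreover have "card (edges R) = 4" using loops_distinct by (simp add: loops(1))
  ultimately show ?thesis using bij_betw_same_card by metis
qed

lemma card_label_inv:
  assumes K: "subgraph K G" "finite K" and z: "z \<in> edges R"
  shows "card {e \<in> edges G \<inter> K. g e = inv_of R z} = card {e \<in> edges G \<inter> K. g e = z}"
proof (rule bij_betw_same_card[OF bij_betw_byWitness[where f' = "inv_of G"]])
  have i: "inv_of G e \<in> edges G \<inter> K \<and> g (inv_of G e) = inv_of R (g e) \<and> inv_of G (inv_of G e) = e"
    if "e \<in> edges G \<inter> K" for e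
    using that gr g_inv K(1) by (simp add: graph_simps subgraph_def)
  have zz: "inv_of R (inv_of R z) = z" using grR z by (rule inv_inv_edge)
  show "\<forall>e\<in>{e \<in> edges G \<inter> K. g e = inv_of R z}. inv_of G (inv_of G e) = e"
    "\<forall>e\<in>{e \<in> edges G \<inter> K. g e = z}. inv_of G (inv_of G e) = e"
    "inv_of G ` {e \<in> edges G \<inter> K. g e = inv_of R z} \<subseteq> {e \<in> edges G \<inter> K. g e = z}"
    "inv_of G ` {e \<in> edges G \<inter> K. g e = z} \<subseteq> {e \<in> edges G \<inter> K. g e = inv_of R z}"
    using i zz by auto
qed

lemma card_edges_split:
  assumes K: "subgraph K G" "finite K"
  shows "card (edges G \<inter> K) = 2 * card {e \<in> edges G \<inter> K. g e = y} + 2 * card {e \<in> edges G \<inter> K. g e = y'}"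
proof -
  let ?E = "\<lambda>z. {e \<in> edges G \<inter> K. g e = z}"
  have "edges G \<inter> K = (\<Union>z\<in>edges R. ?E z)" using g_edge by auto
  then have "card (edges G \<inter> K) = card (\<Union>z\<in>edges R. ?E z)" by (rule arg_cong)
  also have "\<dots> = (\<Sum>z\<in>edges R. card (?E z))"
    using K(2) by (intro card_UN_disjoint) (auto simp: loops(1))
  also have "\<dots> = card (?E y) + card (?E (inv_of R y)) + card (?E y') + card (?E (inv_of R y'))"
    using loops_distinct loops_distinct[symmetric] by (simp add: loops(1))
  finally show ?thesis using card_label_inv[OF K] loop_edges by simp
qed

lemma card_label_le_verts:
  assumes K: "subgraph K G" "finite K"
  shows "card {e \<in> edges G \<inter> K. g e = z} \<le> card (verts G \<inter> K)"
proof (rule card_inj_on_le[of "src G"])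
  show "inj_on (src G) {e \<in> edges G \<inter> K. g e = z}"
  proof (rule inj_onI)
    fix e f assume ef: "e \<in> {e \<in> edges G \<inter> K. g e = z}" "f \<in> {e \<in> edges G \<inter> K. g e = z}" "src G e = src G f"
    then have "e \<in> edges G" "f \<in> edges G" "g e = g f" by auto
    then show "e = f" using edge_unique ef(3) by blast
  qed
  show "src G ` {e \<in> edges G \<inter> K. g e = z} \<subseteq> verts G \<inter> K"
    using K(1) gr by (auto simp: subgraph_def graph_simps)
qed (use K(2) in simp)

lemma labelled_path_reduced:
  assumes "edge_path G u p v" "\<forall>e\<in>set p. g e = z" "z \<in> edges R"
  shows "reduced G p"
  using assms(1,2)
proof (induction p arbitrary: u)
  case (Cons e p)
  have "hd p \<noteq> inv_of G e" if "p \<noteq> []"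
  proof
    assume h: "hd p = inv_of G e"
    have "g (hd p) = z" "g e = z" using Cons.prems(2) that by auto
    then have "inv_of R z = z" using g_inv[of e] h Cons.prems(1) by simp
    then show False using inv_neq[OF assms(3)] by simp
  qed
  moreover have "reduced G p" using Cons by auto
  ultimately show ?case by (simp add: reduced_Cons)
qed simp

lemma labelled_path_prefix:
  assumes "edge_path G u p v" "edge_path G u q w" "\<forall>e\<in>set p. g e = z" "\<forall>e\<in>set q. g e = z"
  shows "\<exists>r. q = p @ r \<or> p = q @ r"
  using assms
proof (induction p arbitrary: u q)
  case (Cons e p)
  show ?case
  proof (cases q)
    case q: (Cons f q')
    have E: "e \<in> edges G" "f \<in> edges G" "src G e = src G f" "g e = g f"
      using Cons.prems q by auto
    have ef: "e = f" using E by (rule edge_unique)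
    have "edge_path G (tgt G e) p v" "edge_path G (tgt G e) q' w" "\<forall>e\<in>set p. g e = z" "\<forall>e\<in>set q'. g e = z"
      using Cons.prems q ef by auto
    then have "\<exists>r. q' = p @ r \<or> p = q' @ r" by (rule Cons.IH)
    then show ?thesis using q ef by auto
  qed simp
qed auto

end

text \<open>The set \<open>S\<close> is to be the spine of \<open>G\<close>. By convexity, an edge between two points of \<open>S\<close> lies in \<open>S\<close>, and
  a reduced path that has left \<open>S\<close> does not come back.\<close>

locale rose_core = rose_covering +
  fixes S :: "'a set"
  assumes S: "subgraph S G" "finite S"
    and convex: "\<And>u p v. edge_path G u p v \<Longrightarrow> reduced G p \<Longrightarrow> u \<in> S \<Longrightarrow> v \<in> S \<Longrightarrow> set p \<subseteq> S"
begin

abbreviation "C \<equiv> coboundary G S"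

lemma Sc: "x \<in> S \<Longrightarrow> src G x \<in> S" "x \<in> S \<Longrightarrow> tgt G x \<in> S" "x \<in> S \<Longrightarrow> inv_of G x \<in> S"
  using S(1) subgraph_tgt[OF S(1)] by (auto simp: subgraph_def)

lemma C_iff: "e \<in> C \<longleftrightarrow> e \<in> edges G \<and> src G e \<in> S \<and> e \<notin> S"
proof
  assume "e \<in> C"
  then show "e \<in> edges G \<and> src G e \<in> S \<and> e \<notin> S" using Sc(2) by (auto simp: coboundary_def)
next
  assume e: "e \<in> edges G \<and> src G e \<in> S \<and> e \<notin> S"
  have "tgt G e \<notin> S"
  proof
    assume "tgt G e \<in> S"
    then have "set [e] \<subseteq> S" using e gr by (intro convex[of "src G e" _ "tgt G e"]) (auto simp: graph_simps)
    then show False using e by simp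
  qed
  then show "e \<in> C" using e by (simp add: coboundary_def)
qed

lemma C_tgt: "e \<in> C \<Longrightarrow> tgt G e \<notin> S"
  by (simp add: coboundary_def)

lemma C_edge: "e \<in> C \<Longrightarrow> e \<in> edges G"
  by (simp add: coboundary_def)

lemma finite_C: "finite C"
proof -
  have "C \<subseteq> (\<Union>w\<in>S \<inter> verts G. star G w)"
    using gr by (auto simp: coboundary_def star_def graph_simps)
  moreover have "finite (star G w)" if "w \<in> verts G" for w
    using card_star[OF that] card.infinite by fastforce
  ultimately show ?thesis using S(2) by (meson finite_Int finite_UN_I finite_subset IntD2)
qed

text \<open>The vertices of \<open>S\<close> whose outgoing \<open>z\<close>-edge leaves \<open>S\<close> are the ends of the maximal
  \<open>z\<close>-labelled segments in \<open>S\<close>.\<close>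

lemma card_verts_split:
  assumes z: "z \<in> edges R"
  shows "card (verts G \<inter> S) = card {e \<in> edges G \<inter> S. g e = z} + card {e \<in> C. g e = z}"
proof -
  let ?A = "{e \<in> edges G \<inter> S. g e = z}" and ?B = "{e \<in> C. g e = z}"
  have img: "src G ` (?A \<union> ?B) = verts G \<inter> S"
  proof
    show "src G ` (?A \<union> ?B) \<subseteq> verts G \<inter> S" using Sc(1) gr by (auto simp: C_iff graph_simps)
    show "verts G \<inter> S \<subseteq> src G ` (?A \<union> ?B)"
    proof
      fix w assume w: "w \<in> verts G \<inter> S"
      then obtain e where "e \<in> edges G" "src G e = w" "g e = z" using edge_exists z by blast
      then have "e \<in> ?A \<union> ?B" using w by (auto simp: C_iff)
      then show "w \<in> src G ` (?A \<union> ?B)" using \<open>src G e = w\<close> by blast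
    qed
  qed
  have inj: "inj_on (src G) (?A \<union> ?B)"
  proof (rule inj_onI)
    fix e f assume ef: "e \<in> ?A \<union> ?B" "f \<in> ?A \<union> ?B" "src G e = src G f"
    then have "e \<in> edges G" "f \<in> edges G" "g e = g f" by (auto simp: C_iff)
    then show "e = f" using edge_unique ef(3) by blast
  qed
  have "card (verts G \<inter> S) = card (?A \<union> ?B)"
    using card_image[OF inj] unfolding img .
  also have "\<dots> = card ?A + card ?B"
  proof (rule card_Un_disjoint)
    show "finite ?A" using S(2) by simp
    show "finite ?B" using finite_C by simp
    show "?A \<inter> ?B = {}" by (auto simp: C_iff)
  qed
  finally show ?thesis .
qed

subsection \<open>The extended spine and its boundary\<close>

definition ext_core where "ext_core = S \<union> (\<Union>e\<in>C. {e, inv_of G e, src G e, tgt G e})"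

text \<open>If \<open>e \<noteq> f\<close>, leaving \<open>S\<close> along \<open>e\<close> and coming back along the inverse of \<open>f\<close> would be a reduced path.\<close>

lemma tgt_inj:
  assumes "e \<in> C" "f \<in> C" "tgt G e = tgt G f"
  shows "e = f"
proof (rule ccontr)
  assume "e \<noteq> f"
  have E: "e \<in> edges G" "f \<in> edges G" using assms C_edge by auto
  have "edge_path G (src G e) [e, inv_of G f] (src G f)"
    using E assms(3) gr by (simp add: graph_simps)
  moreover have "reduced G [e, inv_of G f]"
    using E \<open>e \<noteq> f\<close> gr by (auto simp: reduced_Cons) (metis inv_inv_edge)
  ultimately have "set [e, inv_of G f] \<subseteq> S" using assms(1,2) by (intro convex) (auto simp: C_iff)
  then show False using assms(1) by (simp add: C_iff)
qed

lemma ext_core_edges: "f \<in> edges G \<Longrightarrow> f \<in> ext_core \<Longrightarrow> f \<in> S \<or> f \<in> C \<or> inv_of G f \<in> C"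
  using gr C_edge verts_edges_disjoint[OF src_in_verts[OF gr]] verts_edges_disjoint[OF tgt_in_verts[OF gr]]
  by (auto simp: ext_core_def graph_simps)

lemma ext_core_verts: "w \<in> verts G \<Longrightarrow> w \<in> ext_core \<Longrightarrow> w \<in> S \<or> w \<in> tgt G ` C"
  using gr verts_edges_disjoint[of w G] by (auto simp: ext_core_def C_iff graph_simps)

lemma ext_core_edge_at_tgt:
  assumes "e \<in> C" "f \<in> edges G" "f \<in> ext_core" "src G f = tgt G e"
  shows "f = inv_of G e"
proof -
  have "src G f \<notin> S" using assms C_tgt by simp
  then have "inv_of G f \<in> C" using ext_core_edges[OF assms(2,3)] Sc(1) by (auto simp: C_iff)
  moreover have "tgt G (inv_of G f) = tgt G e" using assms gr by (simp add: graph_simps)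
  ultimately have "inv_of G f = e" using tgt_inj assms(1) by blast
  then show ?thesis using inv_inv_edge[OF gr assms(2)] by simp
qed

text \<open>From the end of \<open>e\<close>, a further edge \<open>f\<close> cannot lead to \<open>S\<close> or to the end of another edge of the coboundary
  of \<open>S\<close>: there would be a reduced path \<open>e, f\<close> or \<open>e, f, e'\<^sup>-\<^sup>1\<close> that leaves \<open>S\<close> and returns.\<close>

lemma coboundary_ext_core:
  "f \<in> coboundary G ext_core \<longleftrightarrow> f \<in> edges G \<and> (\<exists>e\<in>C. src G f = tgt G e \<and> f \<noteq> inv_of G e)"
proof
  assume f: "f \<in> coboundary G ext_core"
  then have fE: "f \<in> edges G" "src G f \<in> ext_core" "tgt G f \<notin> ext_core" by (auto simp: coboundary_def)
  have "src G f \<notin> S"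
  proof
    assume "src G f \<in> S"
    then have "f \<in> S \<or> f \<in> C" using fE by (auto simp: C_iff)
    then have "tgt G f \<in> ext_core" using Sc(2) by (auto simp: ext_core_def)
    then show False using fE by simp
  qed
  then obtain e where e: "e \<in> C" "src G f = tgt G e"
    using ext_core_verts[of "src G f"] fE gr by (auto simp: graph_simps)
  have "f \<noteq> inv_of G e"
  proof
    assume "f = inv_of G e"
    then have "tgt G f = src G e" using C_edge[OF e(1)] gr by (simp add: graph_simps)
    then show False using fE e(1) by (auto simp: ext_core_def)
  qed
  then show "f \<in> edges G \<and> (\<exists>e\<in>C. src G f = tgt G e \<and> f \<noteq> inv_of G e)" using fE e by blast
next
  assume "f \<in> edges G \<and> (\<exists>e\<in>C. src G f = tgt G e \<and> f \<noteq> inv_of G e)"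
  then obtain e where f: "f \<in> edges G" and e: "e \<in> C" "src G f = tgt G e" "f \<noteq> inv_of G e" by blast
  have eE: "e \<in> edges G" "src G e \<in> S" "e \<notin> S" using e(1) by (auto simp: C_iff)
  have tv: "tgt G f \<in> verts G" using f gr by (simp add: graph_simps)
  have "tgt G f \<notin> ext_core"
  proof
    assume "tgt G f \<in> ext_core"
    then consider "tgt G f \<in> S" | e' where "e' \<in> C" "tgt G f = tgt G e'" using ext_core_verts[OF tv] by blast
    then show False
    proof cases
      case 1
      have "edge_path G (src G e) [e, f] (tgt G f)" using eE f e tv by simp
      moreover have "reduced G [e, f]" using e by (simp add: reduced_Cons)
      ultimately have "set [e, f] \<subseteq> S" using eE(2) 1 by (intro convex)
      then show False using eE by simp
    next
      case 2
      have e'E: "e' \<in> edges G" "src G e' \<in> S" using 2 by (auto simp: C_iff)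
      have "f \<noteq> e'" using e(2) e'E(2) C_tgt[OF e(1)] by auto
      then have "inv_of G e' \<noteq> inv_of G f" using f e'E gr by (metis inv_inv_edge)
      then have "reduced G [e, f, inv_of G e']" using e by (simp add: reduced_Cons)
      moreover have "edge_path G (src G e) [e, f, inv_of G e'] (src G e')"
        using eE f e 2 e'E gr by (simp add: graph_simps)
      ultimately have "set [e, f, inv_of G e'] \<subseteq> S" using eE(2) e'E(2) by (intro convex)
      then show False using eE by simp
    qed
  qed
  then show "f \<in> coboundary G ext_core" using f e by (auto simp: coboundary_def ext_core_def)
qed

lemma boundary_verts_ext_core: "boundary_verts G ext_core = tgt G ` C"
proof
  show "tgt G ` C \<subseteq> boundary_verts G ext_core"
  proof
    fix w assume "w \<in> tgt G ` C"
    then obtain e where e: "e \<in> C" "w = tgt G e" by blast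
    have w: "w \<in> verts G" "w \<in> ext_core" using e C_edge[OF e(1)] gr by (auto simp: ext_core_def graph_simps)
    have "{f \<in> coboundary G ext_core. src G f = w} = star G w - {inv_of G e}"
    proof
      show "{f \<in> coboundary G ext_core. src G f = w} \<subseteq> star G w - {inv_of G e}"
      proof
        fix f assume f: "f \<in> {f \<in> coboundary G ext_core. src G f = w}"
        then obtain d where d: "f \<in> edges G" "d \<in> C" "src G f = tgt G d" "f \<noteq> inv_of G d"
          by (auto simp: coboundary_ext_core)
        have "tgt G d = tgt G e" using d(3) f e(2) by simp
        then have "d = e" by (rule tgt_inj[OF d(2) e(1)])
        then show "f \<in> star G w - {inv_of G e}" using d f by (simp add: star_def)
      qed
      show "star G w - {inv_of G e} \<subseteq> {f \<in> coboundary G ext_core. src G f = w}"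
        using e by (auto simp: coboundary_ext_core star_def)
    qed
    moreover have "inv_of G e \<in> star G w" using e C_edge[OF e(1)] gr by (simp add: star_def graph_simps)
    ultimately have "card {f \<in> coboundary G ext_core. src G f = w} = 3"
      using card_star[OF w(1)] by (simp add: card_Diff_singleton)
    then show "w \<in> boundary_verts G ext_core" using w by (simp add: boundary_verts_def)
  qed
  show "boundary_verts G ext_core \<subseteq> tgt G ` C"
  proof
    fix w assume "w \<in> boundary_verts G ext_core"
    then have "{f \<in> coboundary G ext_core. src G f = w} \<noteq> {}"
      unfolding boundary_verts_def by (metis (mono_tags, lifting) card.empty mem_Collect_eq zero_neq_numeral)
    then show "w \<in> tgt G ` C" by (auto simp: coboundary_ext_core)
  qed
qed

text \<open>\<open>linked e f\<close>: the segment of \<open>y\<close>-edges in \<open>S\<close> that leaves \<open>S\<close> through \<open>e\<close> at its end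
  leaves it through \<open>f\<close> at its beginning.\<close>

definition linked where
  "linked e f \<longleftrightarrow> e \<in> C \<and> g e = y \<and> f \<in> C \<and> g f = inv_of R y \<and>
     (\<exists>q. edge_path G (src G e) q (src G f) \<and> set q \<subseteq> S \<and> (\<forall>d\<in>set q. g d = inv_of R y))"

lemma linked_unique:
  assumes "linked e f" "linked e f'"
  shows "f = f'"
proof -
  obtain q q' where q: "edge_path G (src G e) q (src G f)" "set q \<subseteq> S" "\<forall>d\<in>set q. g d = inv_of R y"
    and q': "edge_path G (src G e) q' (src G f')" "set q' \<subseteq> S" "\<forall>d\<in>set q'. g d = inv_of R y"
    using assms by (auto simp: linked_def)
  have f: "f \<in> C" "f' \<in> C" "g f = inv_of R y" "g f' = inv_of R y" using assms by (auto simp: linked_def)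
  have ends: "f \<notin> S" "f' \<notin> S" "f \<in> edges G" "f' \<in> edges G" using f by (auto simp: C_iff)
  have "edge_path G (src G e) (q @ [f]) (tgt G f)" "edge_path G (src G e) (q' @ [f']) (tgt G f')"
    using q(1) q'(1) ends gr by (simp_all add: edge_path_snoc)
  moreover have "\<forall>d\<in>set (q @ [f]). g d = inv_of R y" "\<forall>d\<in>set (q' @ [f']). g d = inv_of R y"
    using q(3) q'(3) f by auto
  ultimately have "\<exists>r. q' @ [f'] = (q @ [f]) @ r \<or> q @ [f] = (q' @ [f']) @ r"
    by (rule labelled_path_prefix)
  then obtain r where "q' @ [f'] = (q @ [f]) @ r \<or> q @ [f] = (q' @ [f']) @ r" by blast
  then consider "q' @ [f'] = (q @ [f]) @ r" | "q @ [f] = (q' @ [f']) @ r" by blast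
  then show ?thesis
  proof cases
    case 1
    then show ?thesis
    proof (cases r rule: rev_cases)
      case (snoc r' x)
      then have "f \<in> set q'" using 1 by auto
      then show ?thesis using q'(2) ends by blast
    qed (use 1 in simp)
  next
    case 2
    then show ?thesis
    proof (cases r rule: rev_cases)
      case (snoc r' x)
      then have "f' \<in> set q" using 2 by auto
      then show ?thesis using q(2) ends by blast
    qed (use 2 in simp)
  qed
qed

text \<open>Going backwards from \<open>e\<close> along \<open>y\<close>-edges for ever inside the finite set \<open>S\<close> would come back to
  the start of \<open>e\<close>, because each vertex has only one incoming and one outgoing \<open>y\<close>-edge, and
  then \<open>e\<close> itself would lie in \<open>S\<close>.\<close>

lemma linked_exists:
  assumes e: "e \<in> C" "g e = y"
  shows "\<exists>f. linked e f"
proof (rule ccontr)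
  assume no: "\<not> (\<exists>f. linked e f)"
  let ?z = "inv_of R y"
  define nx where "nx w = (SOME d. d \<in> edges G \<and> src G d = w \<and> g d = ?z)" for w
  have nx: "nx w \<in> edges G" "src G (nx w) = w" "g (nx w) = ?z" if wv: "w \<in> verts G" for w
  proof -
    obtain d where "d \<in> edges G" "src G d = w" "g d = ?z"
      using edge_exists[OF wv loop_edges(3)] .
    then have "nx w \<in> edges G \<and> src G (nx w) = w \<and> g (nx w) = ?z"
      unfolding nx_def using someI[of "\<lambda>d. d \<in> edges G \<and> src G d = w \<and> g d = ?z" d] by blast
    then show "nx w \<in> edges G" "src G (nx w) = w" "g (nx w) = ?z" by auto
  qed
  define w where "w n = ((\<lambda>a. tgt G (nx a)) ^^ n) (src G e)" for n
  have w_Suc: "w (Suc n) = tgt G (nx (w n))" for n by (simp add: w_def)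
  have eE: "e \<in> edges G" "src G e \<in> S" using e by (auto simp: C_iff)
  have path: "w n \<in> verts G \<and> w n \<in> S \<and>
      (\<exists>q. edge_path G (src G e) q (w n) \<and> set q \<subseteq> S \<and> (\<forall>d\<in>set q. g d = ?z))" for n
  proof (induction n)
    case 0
    have "src G e \<in> verts G" using eE gr by (simp add: graph_simps)
    then show ?case using eE by (auto simp: w_def intro!: exI[of _ "[]"])
  next
    case (Suc n)
    then obtain q where q: "edge_path G (src G e) q (w n)" "set q \<subseteq> S" "\<forall>d\<in>set q. g d = ?z" by blast
    have v: "w n \<in> verts G" "w n \<in> S" using Suc by auto
    have "nx (w n) \<in> S"
    proof (rule ccontr)
      assume "nx (w n) \<notin> S"
      then have "nx (w n) \<in> C" using nx[OF v(1)] v by (simp add: C_iff)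
      then have "linked e (nx (w n))" using e q nx[OF v(1)] by (auto simp: linked_def)
      then show False using no by blast
    qed
    then have "w (Suc n) \<in> verts G" "w (Suc n) \<in> S"
      "edge_path G (src G e) (q @ [nx (w n)]) (w (Suc n))" "set (q @ [nx (w n)]) \<subseteq> S"
      "\<forall>d\<in>set (q @ [nx (w n)]). g d = ?z"
      using q nx[OF v(1)] gr Sc(2) by (auto simp: w_Suc edge_path_snoc graph_simps)
    then show ?case by blast
  qed
  have rev_edge: "inv_of G (nx (w n)) \<in> edges G" "src G (inv_of G (nx (w n))) = w (Suc n)"
      "g (inv_of G (nx (w n))) = y" "tgt G (inv_of G (nx (w n))) = w n" for n
  proof -
    have "w n \<in> verts G" using path by blast
    note nxn = nx[OF this]
    show "inv_of G (nx (w n)) \<in> edges G" using nxn(1) gr by (simp add: inv_in_edges)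
    show "src G (inv_of G (nx (w n))) = w (Suc n)" by (simp add: w_Suc src_inv)
    show "g (inv_of G (nx (w n))) = y"
      using g_inv[OF nxn(1)] nxn(3) inv_inv_edge[OF grR loop_edges(1)] by simp
    show "tgt G (inv_of G (nx (w n))) = w n" using nxn(1,2) gr by (simp add: tgt_inv edge_in_cells)
  qed
  \<comment> \<open>Cancelling the last step on both sides: the incoming \<open>y\<close>-edge of a vertex is unique.\<close>
  have shift: "w 0 = w k" if "w j = w (j + k)" for j k
    using that
  proof (induction j)
    case (Suc j)
    let ?d = "\<lambda>n. inv_of G (nx (w n))"
    have "w (Suc j) = w (Suc (j + k))" using Suc.prems by simp
    then have same: "src G (?d j) = src G (?d (j + k))" by (simp only: rev_edge(2))
    have "?d j = ?d (j + k)"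
      by (rule edge_unique[OF rev_edge(1) rev_edge(1) same]) (simp only: rev_edge(3))
    then have "tgt G (?d j) = tgt G (?d (j + k))" by (rule arg_cong)
    then have "w j = w (j + k)" by (simp only: rev_edge(4))
    then show ?case by (rule Suc.IH)
  qed simp
  have "range w \<subseteq> S" using path by blast
  then have "\<not> inj w" using S(2) finite_imageD[of w UNIV] finite_subset by auto
  then obtain i j where ij: "w i = w j" "i < j" unfolding inj_def by (metis linorder_neqE_nat)
  then obtain k where k: "j = i + Suc k" by (metis add_Suc_right less_imp_Suc_add)
  have "w 0 = w (Suc k)" using shift[of i "Suc k"] ij k by simp
  moreover have "w 0 = src G e" by (simp add: w_def)
  ultimately have same: "src G (inv_of G (nx (w k))) = src G e" by (simp only: rev_edge(2))
  have "inv_of G (nx (w k)) = e"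
    by (rule edge_unique[OF rev_edge(1) eE(1) same]) (simp only: rev_edge(3) e(2))
  then have "tgt G e = w k" using rev_edge(4)[of k] by simp
  then show False using C_tgt[OF e(1)] path[of k] by simp
qed

text \<open>The first and the last edge of a path between boundary vertices are forced to be the edges that join
  these vertices to \<open>S\<close>. What lies between them is reduced, because it has only one label, and hence stays in
  \<open>S\<close> by convexity. Read backwards if necessary, it is a segment of inverse \<open>y\<close>-edges.\<close>

lemma loop_pairs_ext_core: "loop_pairs G ext_core g R y = {{tgt G e, tgt G f} | e f. linked e f}"
proof
  have yy: "inv_of R (inv_of R y) = y" using inv_inv_edge[OF grR loop_edges(1)] .
  show "{{tgt G e, tgt G f} | e f. linked e f} \<subseteq> loop_pairs G ext_core g R y"
  proof
    fix P assume "P \<in> {{tgt G e, tgt G f} | e f. linked e f}"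
    then obtain e f where P: "P = {tgt G e, tgt G f}" and l: "linked e f" by blast
    obtain q where q: "edge_path G (src G e) q (src G f)" "set q \<subseteq> S" "\<forall>d\<in>set q. g d = inv_of R y"
      using l by (auto simp: linked_def)
    have ef: "e \<in> C" "g e = y" "f \<in> C" "g f = inv_of R y" using l by (auto simp: linked_def)
    have E: "e \<in> edges G" "f \<in> edges G" using ef C_edge by auto
    have tf: "tgt G f \<in> verts G" using E gr by (simp add: graph_simps)
    \<comment> \<open>The segment, extended by the two edges at which it leaves \<open>S\<close>.\<close>
    let ?es = "inv_of G e # q @ [f]"
    have "edge_path G (tgt G e) ?es (tgt G f)"
      using E q(1) gr by (simp add: edge_path_snoc graph_simps)
    moreover have "set ?es \<subseteq> ext_core" using q(2) ef by (auto simp: ext_core_def)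
    moreover have "\<forall>d\<in>set ?es. g d = inv_of R y" using q(3) ef g_inv[OF E(1)] by auto
    moreover have "tgt G e \<noteq> tgt G f" using tgt_inj[OF ef(1,3)] ef loops_distinct(1) by auto
    moreover obtain d where d: "d \<in> edges G" "src G d = tgt G f" "g d = inv_of R y"
      using edge_exists[OF tf loop_edges(3)] .
    have "d \<noteq> inv_of G f" using d(3) g_inv[OF E(2)] ef yy loops_distinct(1) by auto
    then have "d \<in> coboundary G ext_core" using d ef by (auto simp: coboundary_ext_core)
    ultimately show "P \<in> loop_pairs G ext_core g R y"
      unfolding loop_pairs_def boundary_verts_ext_core using P ef d by blast
  qed
  show "loop_pairs G ext_core g R y \<subseteq> {{tgt G e, tgt G f} | e f. linked e f}"
  proof
    fix P assume "P \<in> loop_pairs G ext_core g R y"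
    then obtain v1 v2 z es where P: "P = {v1, v2}" "v1 \<in> tgt G ` C" "v2 \<in> tgt G ` C" "v1 \<noteq> v2"
      and z: "z \<in> {y, inv_of R y}" and es: "edge_path G v1 es v2" "set es \<subseteq> ext_core" "\<forall>e\<in>set es. g e = z"
      unfolding loop_pairs_def boundary_verts_ext_core by blast
    have zR: "z \<in> edges R" using z loop_edges by auto
    obtain a b where ab: "a \<in> C" "v1 = tgt G a" "b \<in> C" "v2 = tgt G b" using P by blast
    have abE: "a \<in> edges G" "b \<in> edges G" "src G a \<in> S" "src G b \<in> S" using ab by (auto simp: C_iff)
    have "es \<noteq> []" using es(1) P(4) by auto
    then obtain e1 es1 where e1: "es = e1 # es1" by (cases es) auto
    have "e1 = inv_of G a" using ext_core_edge_at_tgt[OF ab(1), of e1] es e1 ab by auto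
    have "es1 \<noteq> []"
    proof
      assume "es1 = []"
      then have "tgt G b = src G a" using es(1) e1 \<open>e1 = inv_of G a\<close> ab abE gr by (simp add: graph_simps)
      then show False using C_tgt[OF ab(3)] abE by simp
    qed
    then obtain q e2 where q: "es1 = q @ [e2]" by (cases es1 rule: rev_cases) auto
    have path: "edge_path G (src G a) q (src G e2)" "e2 \<in> edges G" "tgt G e2 = tgt G b"
      using es(1) e1 q \<open>e1 = inv_of G a\<close> abE ab gr by (auto simp: edge_path_snoc graph_simps)
    have "inv_of G e2 \<in> ext_core"
    proof -
      have "e2 \<in> ext_core" using es(2) e1 q by auto
      then have "e2 \<in> S \<or> e2 \<in> C \<or> inv_of G e2 \<in> C" using ext_core_edges path(2) by blast
      then show ?thesis using Sc(3) by (auto simp: ext_core_def)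
    qed
    then have "inv_of G e2 = inv_of G b"
      using path gr by (intro ext_core_edge_at_tgt[OF ab(3)]) (auto simp: graph_simps)
    then have e2: "e2 = b" using path(2) abE(2) gr by (metis inv_inv_edge)
    have lab: "\<forall>d\<in>set q. g d = z" "g a = inv_of R z" "g b = z"
    proof -
      show "\<forall>d\<in>set q. g d = z" "g b = z" using es(3) e1 q e2 by auto
      have "inv_of R (g a) = z" using es(3) e1 \<open>e1 = inv_of G a\<close> g_inv[OF abE(1)] by auto
      then show "g a = inv_of R z" using inv_inv_edge[OF grR g_edge[OF abE(1)]] by simp
    qed
    have pq: "edge_path G (src G a) q (src G b)" using path(1) e2 by simp
    have qS: "set q \<subseteq> S" using convex[OF pq labelled_path_reduced[OF pq lab(1) zR]] abE by simp
    consider "z = inv_of R y" | "z = y" using z by auto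
    then have "linked a b \<or> linked b a"
    proof cases
      case 1
      then have "linked a b" using ab lab pq qS yy by (auto simp: linked_def)
      then show ?thesis ..
    next
      case 2
      have "edge_path G (src G b) (reverse_path G q) (src G a)" using edge_path_reverse[OF gr pq] .
      moreover have "set (reverse_path G q) \<subseteq> S" using qS Sc(3) by (auto simp: set_reverse_path)
      moreover have "\<forall>d\<in>set (reverse_path G q). g d = inv_of R y"
        using lab(1) edge_path_edges[OF pq] g_inv 2 by (auto simp: set_reverse_path)
      ultimately have "linked b a" using ab lab 2 unfolding linked_def by blast
      then show ?thesis ..
    qed
    then show "P \<in> {{tgt G e, tgt G f} | e f. linked e f}" using P(1) ab by (auto simp: insert_commute)
  qed
qed

text \<open>Each segment of \<open>y\<close>-edges of \<open>S\<close> has one last vertex, and the \<open>y\<close>-edges in \<open>S\<close> start at the other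
  vertices.\<close>

lemma card_loop_pairs:
  "card (loop_pairs G ext_core g R y) + card {e \<in> edges G \<inter> S. g e = y} = card (verts G \<inter> S)"
proof -
  obtain f where f: "\<And>e. e \<in> C \<Longrightarrow> g e = y \<Longrightarrow> linked e (f e)" using linked_exists by metis
  let ?B = "{e \<in> C. g e = y}"
  let ?p = "\<lambda>e. {tgt G e, tgt G (f e)}"
  have img: "loop_pairs G ext_core g R y = ?p ` ?B"
  proof
    show "loop_pairs G ext_core g R y \<subseteq> ?p ` ?B"
    proof
      fix P assume "P \<in> loop_pairs G ext_core g R y"
      then obtain e d where P: "P = {tgt G e, tgt G d}" and l: "linked e d" by (auto simp: loop_pairs_ext_core)
      have "e \<in> ?B" using l by (simp add: linked_def)
      moreover have "d = f e" using linked_unique[OF l] f calculation by blast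
      ultimately show "P \<in> ?p ` ?B" using P by blast
    qed
    show "?p ` ?B \<subseteq> loop_pairs G ext_core g R y" using f by (auto simp: loop_pairs_ext_core)
  qed
  have "inj_on ?p ?B"
  proof (rule inj_onI)
    fix e e' assume e: "e \<in> ?B" "e' \<in> ?B" "?p e = ?p e'"
    have l: "linked e' (f e')" using f e by blast
    have "tgt G e \<noteq> tgt G (f e')"
    proof
      assume "tgt G e = tgt G (f e')"
      then have "e = f e'" using tgt_inj e l by (auto simp: linked_def)
      then show False using e l loops_distinct(1) by (auto simp: linked_def)
    qed
    then have "tgt G e = tgt G e'" using e(3) by auto
    then show "e = e'" using tgt_inj e by blast
  qed
  then have "card (loop_pairs G ext_core g R y) = card ?B"
    unfolding img by (rule card_image)
  then show ?thesis using card_verts_split[OF loop_edges(1)] by simp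
qed

end

section \<open>Cycles of the pullback\<close>

text \<open>\<open>P\<close> is to be the collapsed pullback and \<open>S1\<close>, \<open>S2\<close> the spines of the two collapsed coverings. What \<open>P\<close> has
  from a pullback is that it covers both, compatibly with the labels, and that an edge is determined by its
  two projections.\<close>

locale core_product =
  one: rose_core G1 g1 R y y' S1 + two: rose_core G2 g2 R y y' S2
  for G1 :: "'a graph" and g1 and R :: "'c graph" and y y' S1
    and G2 :: "'b graph" and g2 S2 +
  fixes P :: "'p graph" and \<pi>1 :: "'p \<Rightarrow> 'a" and \<pi>2 :: "'p \<Rightarrow> 'b"
  assumes cov1: "local_covering \<pi>1 P G1" and cov2: "local_covering \<pi>2 P G2"
    and commute: "\<And>e. e \<in> edges P \<Longrightarrow> g1 (\<pi>1 e) = g2 (\<pi>2 e)"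
    and pair_inj: "\<And>e f. e \<in> edges P \<Longrightarrow> f \<in> edges P \<Longrightarrow> \<pi>1 e = \<pi>1 f \<Longrightarrow> \<pi>2 e = \<pi>2 f \<Longrightarrow> e = f"
    and closed1: "\<And>a w. edge_path G1 a w a \<Longrightarrow> reduced G1 (w @ w) \<Longrightarrow> set w \<subseteq> S1"
    and closed2: "\<And>a w. edge_path G2 a w a \<Longrightarrow> reduced G2 (w @ w) \<Longrightarrow> set w \<subseteq> S2"
begin

definition core where "core = {x \<in> cells P. \<pi>1 x \<in> S1 \<and> \<pi>2 x \<in> S2}"

lemmas grP = local_coveringD(1)[OF cov1]
lemmas map1 = local_coveringD(3)[OF cov1] and map2 = local_coveringD(3)[OF cov2]

sublocale P: rose_covering P "\<lambda>x. g1 (\<pi>1 x)" R y y'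
  using local_covering_comp[OF cov1 one.cov] one.one_vertex one.loops
  by (unfold_locales) auto

lemma subgraph_core: "subgraph core P"
  unfolding subgraph_def core_def
  using one.Sc two.Sc grP dimension_preservingD[OF map1] dimension_preservingD[OF map2]
  by (auto simp: inv_in_cells src_in_verts vert_in_cells)

lemma core_convex:
  assumes "edge_path P u p v" "reduced P p" "u \<in> core" "v \<in> core"
  shows "set p \<subseteq> core"
proof -
  have "set (map \<pi>1 p) \<subseteq> S1" "set (map \<pi>2 p) \<subseteq> S2"
    using one.convex[OF edge_path_map[OF grP map1 assms(1)] reduced_map[OF cov1 assms(1,2)]]
      two.convex[OF edge_path_map[OF grP map2 assms(1)] reduced_map[OF cov2 assms(1,2)]] assms(3,4)
    by (auto simp: core_def)
  then show ?thesis using edge_path_edges[OF assms(1)] by (auto simp: core_def edge_in_cells)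
qed

lemma cycles_in_core:
  assumes "c \<in> H1 P"
  shows "Poly_Mapping.keys c \<subseteq> core"
proof
  fix e assume e: "e \<in> Poly_Mapping.keys c"
  obtain w where w: "edge_path P (src P e) w (src P e)" "reduced P (w @ w)" "e \<in> set w"
    using cycle_edge_on_closed_path[OF grP assms e] by blast
  have ww: "edge_path P (src P e) (w @ w) (src P e)" using edge_path_appendI[OF grP w(1) w(1)] .
  have "set (map \<pi>1 w) \<subseteq> S1"
    using closed1[OF edge_path_map[OF grP map1 w(1)]] reduced_map[OF cov1 ww w(2)] by simp
  moreover have "set (map \<pi>2 w) \<subseteq> S2"
    using closed2[OF edge_path_map[OF grP map2 w(1)]] reduced_map[OF cov2 ww w(2)] by simp
  moreover have "e \<in> cells P" using edge_path_edges[OF w(1)] w(3) by (auto simp: edge_in_cells)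
  ultimately show "e \<in> core" using w(3) by (auto simp: core_def)
qed

lemma core_edges_inj:
  "inj_on (\<lambda>e. (\<pi>1 e, \<pi>2 e)) (edges P \<inter> core)"
  by (rule inj_onI) (use pair_inj in blast)

lemma finite_core_edges: "finite (edges P \<inter> core)"
proof (rule inj_on_finite[OF core_edges_inj])
  show "(\<lambda>e. (\<pi>1 e, \<pi>2 e)) ` (edges P \<inter> core) \<subseteq> S1 \<times> S2" by (auto simp: core_def)
qed (use one.S(2) two.S(2) in simp)

lemma card_core_label_le:
  "card {e \<in> edges P \<inter> core. g1 (\<pi>1 e) = z} \<le>
     card {e \<in> edges G1 \<inter> S1. g1 e = z} * card {e \<in> edges G2 \<inter> S2. g2 e = z}"
proof -
  let ?A = "{e \<in> edges G1 \<inter> S1. g1 e = z} \<times> {e \<in> edges G2 \<inter> S2. g2 e = z}"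
  have "card {e \<in> edges P \<inter> core. g1 (\<pi>1 e) = z} \<le> card ?A"
  proof (rule card_inj_on_le[of "\<lambda>e. (\<pi>1 e, \<pi>2 e)"])
    show "inj_on (\<lambda>e. (\<pi>1 e, \<pi>2 e)) {e \<in> edges P \<inter> core. g1 (\<pi>1 e) = z}"
      using core_edges_inj by (rule inj_on_subset) auto
    show "(\<lambda>e. (\<pi>1 e, \<pi>2 e)) ` {e \<in> edges P \<inter> core. g1 (\<pi>1 e) = z} \<subseteq> ?A"
      using dimension_preservingD(3)[OF map1] dimension_preservingD(3)[OF map2] commute
      by (auto simp: core_def)
    show "finite ?A" using one.S(2) two.S(2) by simp
  qed
  then show ?thesis by (simp add: card_cartesian_product)
qed

text \<open>All cycles of one component of \<open>P\<close> lie in one finite component \<open>K\<close> of the core. Its Euler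
  characteristic bounds the rank, and the \<open>y\<close>-edges of \<open>K\<close> cost nothing because there are at
  most as many of them as vertices.\<close>

lemma card_independent_le:
  assumes B: "finite B" "independent B" "B \<subseteq> H1 P"
    and x: "\<And>b. b \<in> B \<Longrightarrow> Poly_Mapping.keys b \<subseteq> component_of P x"
  shows "card B \<le> 1 + card {e \<in> edges P \<inter> core \<inter> component_of P x. g1 (\<pi>1 e) = y'}"
proof (cases "B = {}")
  case False
  then obtain b where b: "b \<in> B" by blast
  have "b \<noteq> 0" using module.dependent_zero[OF module_frag, of B] B(2) b by auto
  then obtain e0 where e0: "e0 \<in> Poly_Mapping.keys b" by (metis ex_in_conv keys_eq_empty)
  have bH: "b \<in> H1 P" using b B(3) by blast
  let ?u = "src P e0" and ?C = "component_of P x"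
  have e0': "e0 \<in> edges P" "e0 \<in> core" "e0 \<in> ?C"
    using H1_keys[OF bH] cycles_in_core[OF bH] x[OF b] e0 by auto
  have SC: "subgraph ?C P" using subgraph_component[OF grP] .
  have u: "?u \<in> verts P" "?u \<in> core" "?u \<in> ?C"
    using e0' grP subgraph_core SC by (auto simp: graph_simps subgraph_def)
  let ?R = "restrict_graph P core"
  have R: "is_graph ?R" using grP subgraph_core by (rule is_graph_restrict)
  let ?K = "component_of ?R ?u"
  have KR: "subgraph ?K ?R" using R by (rule subgraph_component)
  have core_cells: "core \<subseteq> cells P" by (auto simp: core_def)
  have Kc: "?K \<subseteq> core" by (auto simp: component_of_def)
  then have K: "subgraph ?K P" using KR core_cells by (auto simp: subgraph_def)
  have uK: "?u \<in> ?K" using component_self[OF R] u by simp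
  have conn: "connected_graph (restrict_graph P ?K)"
    using connected_component[OF R, of ?u] u(2) by (simp add: restrict_graph_def)
  have path: "\<exists>p. edge_path P ?u p (src P f) \<and> set p \<subseteq> ?K" if f: "f \<in> ?K" for f
  proof -
    obtain p where p: "edge_path ?R ?u p (src P f)"
      using f src_vert[OF grP u(1)] by (auto simp: component_of_def)
    then show ?thesis
      using edge_path_in_component[OF R uK p] by (auto simp: edge_path_restrict[OF subgraph_core])
  qed
  have KC: "?K \<subseteq> ?C"
  proof
    fix f assume f: "f \<in> ?K"
    then obtain p where "edge_path P ?u p (src P f)" using path by blast
    then have "f \<in> component_of P ?u"
      using f K src_vert[OF grP u(1)] by (auto simp: component_of_def subgraph_def)
    then show "f \<in> ?C" using component_eq[OF grP u(3)] by simp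
  qed
  have finE: "finite (edges P \<inter> ?K)" using finite_core_edges by (rule rev_finite_subset) (use Kc in auto)
  have "verts P \<inter> ?K \<subseteq> insert ?u (tgt P ` (edges P \<inter> ?K))"
  proof
    fix f assume f: "f \<in> verts P \<inter> ?K"
    then obtain p where p: "edge_path P ?u p f" "set p \<subseteq> ?K" using path[of f] src_vert[OF grP, of f] by auto
    show "f \<in> insert ?u (tgt P ` (edges P \<inter> ?K))"
    proof (cases "p = []")
      case False
      then have "last p \<in> edges P \<inter> ?K" using p edge_path_edges[OF p(1)] last_in_set by blast
      then show ?thesis using edge_path_last[OF p(1) False] by auto
    qed (use p in simp)
  qed
  then have "finite (verts P \<inter> ?K)" using finE by (meson finite_imageI finite_insert finite_subset)
  moreover have "?K = (verts P \<inter> ?K) \<union> (edges P \<inter> ?K)" using subgraph_cells[OF K] cells_split[of P] by blast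
  ultimately have finK: "finite ?K" using finE by (metis finite_UnI)
  have keys: "Poly_Mapping.keys c \<subseteq> ?K" if c: "c \<in> B" for c
  proof
    fix e assume e: "e \<in> Poly_Mapping.keys c"
    have cH: "c \<in> H1 P" using c B(3) by blast
    have e': "e \<in> edges P" "e \<in> core" "e \<in> ?C"
      using H1_keys[OF cH] cycles_in_core[OF cH] x[OF c] e by auto
    have "e \<in> component_of P ?u" using component_eq[OF grP u(3)] e'(3) by simp
    then obtain p where "edge_path P ?u p (src P e)" using src_vert[OF grP u(1)] by (auto simp: component_of_def)
    then obtain q where q: "edge_path P ?u q (src P e)" "reduced P q" using reduce_path[OF grP] by blast
    have "src P e \<in> core" using e' subgraph_core by (simp add: subgraph_def)
    then have "set q \<subseteq> core" using core_convex[OF q u(2)] by simp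
    then have "edge_path ?R ?u q (src P e)" using q(1) u(2) by (simp add: edge_path_restrict[OF subgraph_core])
    then show "e \<in> ?K" using e'(2) src_vert[OF grP u(1)] by (auto simp: component_of_def)
  qed
  have "2 * card B + 2 * card (verts P \<inter> ?K) \<le> card (edges P \<inter> ?K) + 2"
    using independent_cycles_le[OF grP u(1) K finK uK conn B keys] by blast
  moreover have "card (edges P \<inter> ?K) =
      2 * card {e \<in> edges P \<inter> ?K. g1 (\<pi>1 e) = y} + 2 * card {e \<in> edges P \<inter> ?K. g1 (\<pi>1 e) = y'}"
    using P.card_edges_split[OF K finK] .
  moreover have "card {e \<in> edges P \<inter> ?K. g1 (\<pi>1 e) = y} \<le> card (verts P \<inter> ?K)"
    using P.card_label_le_verts[OF K finK] .
  moreover have "card {e \<in> edges P \<inter> ?K. g1 (\<pi>1 e) = y'}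
      \<le> card {e \<in> edges P \<inter> core \<inter> ?C. g1 (\<pi>1 e) = y'}"
  proof (rule card_mono)
    show "finite {e \<in> edges P \<inter> core \<inter> ?C. g1 (\<pi>1 e) = y'}"
      using finite_core_edges by (rule rev_finite_subset) auto
    show "{e \<in> edges P \<inter> ?K. g1 (\<pi>1 e) = y'} \<subseteq> {e \<in> edges P \<inter> core \<inter> ?C. g1 (\<pi>1 e) = y'}"
      using Kc KC by auto
  qed
  ultimately show ?thesis by linarith
qed simp

end

section \<open>The inequality\<close>

lemma spanning_tree_wide: "spanning_tree T D \<Longrightarrow> wide_subgraph T D"
  by (simp add: spanning_tree_def wide_subgraph_def)

lemma spanning_tree_acyclic:
  assumes "is_graph D" "spanning_tree T D"
  shows "acyclic_subgraph T D"
  unfolding acyclic_subgraph_def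
proof (intro allI impI)
  fix u p assume p: "edge_path D u p u" "reduced D p" "set p \<subseteq> T"
  have T: "subgraph T D" "verts D \<subseteq> T" "simply_connected_graph (restrict_graph D T)"
    using assms(2) by (auto simp: spanning_tree_def)
  have "edge_path (restrict_graph D T) u p u"
    using p edge_path_start[OF assms(1) p(1)] T by (auto simp: edge_path_restrict)
  then show "p = []"
    using simply_connected_reduced_closed[OF T(3) is_graph_restrict[OF assms(1) T(1)]] p(2) by simp
qed

lemma collapse_spanning_tree_one_vertex:
  assumes D: "is_graph D" and T: "spanning_tree T D"
    and z: "z \<in> edges (collapse D T)" and w: "w \<in> verts (collapse D T)"
  shows "src (collapse D T) z = w"
proof -
  note W = spanning_tree_wide[OF T]
  have "src (collapse D T) z \<in> verts (collapse D T)"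
    using z is_graph_collapse[OF D W] by (simp add: graph_simps)
  then obtain a b where ab: "a \<in> verts D" "b \<in> verts D" "src (collapse D T) z = cls D T a" "w = cls D T b"
    using w by (auto simp: verts_collapse[OF D W])
  have aT: "a \<in> T" "b \<in> T" using ab wide_subgraphD(2)[OF W] by auto
  have "connected_graph (restrict_graph D T)" using T by (simp add: spanning_tree_def simply_connected_graph_def)
  then have "\<exists>p. edge_path (restrict_graph D T) a p b"
    using ab aT wide_subgraphD(3)[OF W] unfolding connected_graph_def by (simp add: verts_restrict)
  then have "cls D T a = cls D T b"
    using cls_reachable_iff[OF D W aT] ab src_vert[OF D] wide_subgraphD(1)[OF W]
    by (auto simp: edge_path_restrict)
  then show ?thesis using ab by simp
qed

lemma covering_rank_pos:
  assumes "covering p L D" "\<not> simply_connected_graph L"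
  shows "1 \<le> rk L"
proof -
  have "is_graph L" "connected_graph L" using assms by (auto simp: covering_def)
  then obtain c where "c \<in> H1 L" "c \<noteq> 0" using not_simply_connected_H1 assms(2) by blast
  then show ?thesis by (rule rk_pos)
qed

text \<open>The estimates for one covering, in terms of the numbers of edges of each label in the spine of the
  collapsed graph.\<close>

lemma spine_rose_core:
  fixes L :: "'a graph" and D :: "'d graph"
  assumes D: "is_graph D" and T: "spanning_tree T D"
    and p: "covering p L D" and u: "u \<in> verts L" and rk: "rk L < \<infinity>"
    and y: "edges (collapse D T) = {y, inv_of (collapse D T) y, y', inv_of (collapse D T) y'}"
      "y' \<notin> {y, inv_of (collapse D T) y}"
  defines "F \<equiv> preimage p L T"
  defines "G \<equiv> collapse L F" and "g \<equiv> induced_map p D T" and "S \<equiv> spine (collapse L F) (cls L F u)"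
  shows "rose_core G g (collapse D T) y y' S"
    and "\<And>a w. edge_path G a w a \<Longrightarrow> reduced G (w @ w) \<Longrightarrow> set w \<subseteq> S"
    and "spine_size L u p T = card (verts G \<inter> S)"
    and "num_pairs L u p D T y + card {e \<in> edges G \<inter> S. g e = y} = spine_size L u p T"
    and "card {e \<in> edges G \<inter> S. g e = y} + card {e \<in> edges G \<inter> S. g e = y'} + 1
      \<le> the_enat (rk L) + spine_size L u p T"
    and "card {e \<in> edges G \<inter> S. g e = y'} \<le> spine_size L u p T"
proof -
  note W = spanning_tree_wide[OF T] and A = spanning_tree_acyclic[OF D T]
  have cov: "local_covering p L D" using p by (rule covering_local)
  note L = local_coveringD[OF cov]
  have WF: "wide_subgraph F L" unfolding F_def using wide_preimage[OF L(1,3) W] .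
  have G: "is_graph G" unfolding G_def using is_graph_collapse[OF L(1) WF] .
  have conn: "connected_graph G" 
    unfolding G_def using connected_collapse[OF L(1) WF] p by (simp add: covering_def)
  have covG: "local_covering g G (collapse D T)"
    unfolding g_def G_def F_def using local_covering_collapse[OF cov W A] .
  let ?u = "cls L F u"
  have uG: "?u \<in> verts G" unfolding G_def using u verts_collapse[OF L(1) WF] by blast
  have S_def': "S = spine G ?u" by (simp add: S_def G_def)
  have rkG: "rk G \<le> rk L" unfolding G_def using rk_collapse_le[OF L(1) WF] .
  then have rkG': "rk G < \<infinity>" using rk by (rule le_less_trans)
  have sub: "subgraph S G" unfolding S_def' using subgraph_spine[OF G uG] .
  have fin: "finite S" unfolding S_def' using finite_spine[OF G conn uG rkG'] .
  show core: "rose_core G g (collapse D T) y y' S"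
  proof
    show "local_covering g G (collapse D T)" by (rule covG)
    show "\<And>z w. z \<in> edges (collapse D T) \<Longrightarrow> w \<in> verts (collapse D T) \<Longrightarrow> src (collapse D T) z = w"
      using collapse_spanning_tree_one_vertex[OF D T] .
    show "set q \<subseteq> S" if "edge_path G a q b" "reduced G q" "a \<in> S" "b \<in> S" for a q b
      using spine_convex[OF G conn uG that(1,2)] that(3,4) by (simp add: S_def')
  qed (use y sub fin in auto)
  interpret rose_core G g "collapse D T" y y' S by (rule core)
  show "\<And>a w. edge_path G a w a \<Longrightarrow> reduced G (w @ w) \<Longrightarrow> set w \<subseteq> S"
    unfolding S_def' by (rule closed_path_in_spine[OF G conn uG])
  show ss: "spine_size L u p T = card (verts G \<inter> S)"
    by (simp add: spine_size_def Let_def cls_def G_def S_def F_def)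
  have "extended_spine G ?u = ext_core" by (simp add: extended_spine_def ext_core_def flip: S_def')
  moreover have "num_pairs L u p D T y = card (loop_pairs G (extended_spine G ?u) g (collapse D T) y)"
    by (simp add: num_pairs_def Let_def cls_def G_def F_def g_def)
  ultimately show "num_pairs L u p D T y + card {e \<in> edges G \<inter> S. g e = y} = spine_size L u p T"
    using card_loop_pairs ss by simp
  have "connected_graph (restrict_graph G S)" "?u \<in> S"
    unfolding S_def' using connected_spine[OF G uG] base_in_spine by auto
  then have "card (edges G \<inter> S) + 2 \<le> 2 * the_enat (rk G) + 2 * card (verts G \<inter> S)"
    using euler_le_rk[OF G uG sub fin _ _ rkG'] by blast
  moreover have "the_enat (rk G) \<le> the_enat (rk L)" using rkG rk by (cases "rk L"; cases "rk G") auto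
  ultimately show "card {e \<in> edges G \<inter> S. g e = y} + card {e \<in> edges G \<inter> S. g e = y'} + 1
      \<le> the_enat (rk L) + spine_size L u p T"
    using card_edges_split[OF sub fin] ss by simp
  show "card {e \<in> edges G \<inter> S. g e = y'} \<le> spine_size L u p T"
    using card_label_le_verts[OF sub fin] ss by simp
qed

text \<open>If \<open>b1 < n1\<close>, the difference \<open>b1 - n1\<close> says nothing about the product of the reduced ranks beyond
  its being nonnegative, but then already \<open>b1 * b2 \<le> n1 * h2\<close>; symmetrically for \<open>b2 < n2\<close>.\<close>

lemma final_estimate:
  fixes r1 r2 b1 b2 n1 n2 h1 h2 :: int
  assumes "1 \<le> r1" "1 \<le> r2" "b1 - n1 \<le> r1 - 1" "b2 - n2 \<le> r2 - 1"
    and "0 \<le> b1" "0 \<le> b2" "0 \<le> n1" "0 \<le> n2" "b1 \<le> h1" "b2 \<le> h2" "n1 \<le> h1" "n2 \<le> h2"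
  shows "b1 * b2 \<le> (r1 - 1) * (r2 - 1) + h1 * h2 - (h1 - n1) * (h2 - n2)"
proof (cases "b1 \<ge> n1 \<and> b2 \<ge> n2")
  case True
  have "(b1 - n1) * (b2 - n2) \<le> (r1 - 1) * (r2 - 1)"
    using assms True by (intro mult_mono) auto
  moreover have "0 \<le> (h1 - b1) * n2" "0 \<le> (h2 - b2) * n1" using assms by simp_all
  ultimately show ?thesis by (simp add: algebra_simps)
next
  case False
  have r: "0 \<le> (r1 - 1) * (r2 - 1)" using assms by simp
  show ?thesis
  proof (cases "b1 < n1")
    case True
    have "b1 * b2 \<le> n1 * h2" using True assms by (intro mult_mono) auto
    moreover have "0 \<le> (h1 - n1) * n2" using assms by simp
    ultimately show ?thesis using r by (simp add: algebra_simps)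
  next
    case F: False
    then have "b2 < n2" using False by simp
    then have "b1 * b2 \<le> h1 * n2" using assms by (intro mult_mono) auto
    moreover have "0 \<le> (h2 - n2) * n1" using assms by simp
    ultimately show ?thesis using r by (simp add: algebra_simps)
  qed
qed

theorem theorem1:
  fixes D :: "'d graph" and L1 :: "'a graph" and L2 :: "'b graph"
    and v :: 'd and u1 :: 'a and u2 :: 'b
    and p1 :: "'a \<Rightarrow> 'd" and p2 :: "'b \<Rightarrow> 'd"
    and T :: "'d set" and x :: "nat \<Rightarrow> 'd set" and i :: nat
  assumes "is_graph D" and "connected_graph D" and "rk D = 2" and "v \<in> verts D"
    and "covering p1 L1 D" and "u1 \<in> verts L1" and "p1 u1 = v"
    and "rk L1 < \<infinity>" and "\<not> simply_connected_graph L1"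
    and "covering p2 L2 D" and "u2 \<in> verts L2" and "p2 u2 = v"
    and "rk L2 < \<infinity>" and "\<not> simply_connected_graph L2"
    and "spanning_tree T D" and "loop_labelling x (collapse D T)"
    and "i \<in> {1, 2}"
  defines "HH1 \<equiv> int (spine_size L1 u1 p1 T)"
    and "HH2 \<equiv> int (spine_size L2 u2 p2 T)"
    and "n1 \<equiv> int (num_pairs L1 u1 p1 D T (x i))"
    and "n2 \<equiv> int (num_pairs L2 u2 p2 D T (x i))"
    and "Omegas \<equiv> {\<Omega> \<in> graph_components (pullback L1 p1 L2 p2). \<not> simply_connected_graph \<Omega>}"
  shows "finite Omegas \<and> (\<forall>\<Omega> \<in> Omegas. rk \<Omega> < \<infinity>) \<and>
    (\<Sum>\<Omega> \<in> Omegas. int (the_enat (rk \<Omega>)) - 1)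
      \<le> (int (the_enat (rk L1)) - 1) * (int (the_enat (rk L2)) - 1)
         + HH1 * HH2 - (HH1 - n1) * (HH2 - n2)"
proof -
  note D = assms(1) and T = assms(15)
  note W = spanning_tree_wide[OF T] and A = spanning_tree_acyclic[OF D T]
  let ?R = "collapse D T"
  define y where "y = x i"
  define y' where "y' = x (3 - i)"
  have gR: "is_graph ?R" using is_graph_collapse[OF D W] .
  have lab: "edges ?R = {x 1, inv_of ?R (x 1), x 2, inv_of ?R (x 2)}" "x 2 \<notin> {x 1, inv_of ?R (x 1)}"
    using assms(16) by (auto simp: loop_labelling_def)
  have "x 1 \<notin> {x 2, inv_of ?R (x 2)}"
  proof -
    have "inv_of ?R (inv_of ?R (x 2)) = x 2" using inv_inv_edge[OF gR, of "x 2"] lab(1) by blast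
    then have "x 1 \<noteq> inv_of ?R (x 2)" using lab(2) by force
    then show ?thesis using lab(2) by auto
  qed
  then have y: "edges ?R = {y, inv_of ?R y, y', inv_of ?R y'}" "y' \<notin> {y, inv_of ?R y}"
  proof -
    assume x1: "x 1 \<notin> {x 2, inv_of ?R (x 2)}"
    consider "i = 1" | "i = 2" using assms(17) by blast
    then have "edges ?R = {y, inv_of ?R y, y', inv_of ?R y'} \<and> y' \<notin> {y, inv_of ?R y}"
    proof cases
      case 1
      then have "y = x 1" "y' = x 2" by (simp_all add: y_def y'_def)
      then show ?thesis using lab by blast
    next
      case 2
      then have "y = x 2" "y' = x 1" by (simp_all add: y_def y'_def)
      then show ?thesis using lab(1) x1 by blast
    qed
    then show "edges ?R = {y, inv_of ?R y, y', inv_of ?R y'}" "y' \<notin> {y, inv_of ?R y}" by blast+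
  qed
  define F1 where "F1 = preimage p1 L1 T"
  define F2 where "F2 = preimage p2 L2 T"
  let ?G1 = "collapse L1 F1" and ?G2 = "collapse L2 F2"
  let ?g1 = "induced_map p1 D T" and ?g2 = "induced_map p2 D T"
  let ?S1 = "spine ?G1 (cls L1 F1 u1)" and ?S2 = "spine ?G2 (cls L2 F2 u2)"
  note spine1 = spine_rose_core[OF D T assms(5,6,8) y, folded F1_def]
  note spine2 = spine_rose_core[OF D T assms(10,11,13) y, folded F2_def]
  have c1: "local_covering p1 L1 D" and c2: "local_covering p2 L2 D"
    using assms(5,10) by (auto intro: covering_local)
  note L1 = local_coveringD[OF c1] and L2 = local_coveringD[OF c2]
  have WF1: "wide_subgraph F1 L1" and WF2: "wide_subgraph F2 L2"
    unfolding F1_def F2_def using wide_preimage[OF L1(1,3) W] wide_preimage[OF L2(1,3) W] by auto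
  have AF1: "acyclic_subgraph F1 L1" and AF2: "acyclic_subgraph F2 L2"
    unfolding F1_def F2_def using acyclic_preimage[OF c1 A] acyclic_preimage[OF c2 A] by auto
  let ?Q = "pullback L1 p1 L2 p2"
  note q = pullback_local_coverings[OF c1 c2]
  note Q = local_coveringD[OF q(1)] and Q2 = local_coveringD[OF q(2)]
  \<comment> \<open>Both projections pull the collapsed forests back to the same forest of the pullback, so that they
    induce maps from one and the same collapsed graph.\<close>
  define F where "F = preimage fst ?Q F1"
  have F_snd: "F = preimage snd ?Q F2"
    by (auto simp: F_def F1_def F2_def preimage_def cells_pullback edge_in_cells vert_in_cells)
  have WF: "wide_subgraph F ?Q" unfolding F_def using wide_preimage[OF Q(1,3) WF1] .
  have AF: "acyclic_subgraph F ?Q" unfolding F_def using acyclic_preimage[OF q(1) AF1] .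
  let ?P = "collapse ?Q F"
  let ?\<pi>1 = "induced_map fst L1 F1" and ?\<pi>2 = "induced_map snd L2 F2"
  have ind1: "?\<pi>1 (cls ?Q F e) = cls L1 F1 (fst e)" if "e \<in> cells ?Q" for e
    using induced_map_cls[OF Q(1,2,3) WF1 that] by (simp add: F_def)
  have ind2: "?\<pi>2 (cls ?Q F e) = cls L2 F2 (snd e)" if "e \<in> cells ?Q" for e
    using induced_map_cls[OF Q2(1,2,3) WF2 that] by (simp add: F_snd)
  \<comment> \<open>An edge outside the forest is collapsed to a singleton, so it is still a pair of edges.\<close>
  have edgeP: "\<exists>e1 e2. E = {(e1, e2)} \<and> (e1, e2) \<in> edges ?Q \<and> ?\<pi>1 E = {e1} \<and> ?\<pi>2 E = {e2}
      \<and> ?g1 (?\<pi>1 E) = ?g2 (?\<pi>2 E)" if E: "E \<in> edges ?P" for E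
  proof -
    obtain e1 e2 where e: "E = {(e1, e2)}" "(e1, e2) \<in> edges ?Q" "(e1, e2) \<notin> F"
      using E by (auto simp: edges_collapse[OF Q(1) WF])
    have ec: "(e1, e2) \<in> cells ?Q" using e(2) by (rule edge_in_cells)
    have E': "E = cls ?Q F (e1, e2)" using e ec by (simp add: cls_outside)
    have e12: "e1 \<in> cells L1" "e2 \<in> cells L2" "p1 e1 = p2 e2" 
      using e(2) by (auto simp: edges_pullback edge_in_cells)
    have "e1 \<notin> F1" using e(3) ec by (simp add: F_def preimage_def)
    moreover have "e2 \<notin> F2" using e(3) ec by (simp add: F_snd preimage_def)
    ultimately have "?\<pi>1 E = {e1}" "?\<pi>2 E = {e2}"
      using ind1[OF ec] ind2[OF ec] E' e12 by (simp_all add: cls_outside)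
    moreover have "?g1 (?\<pi>1 E) = ?g2 (?\<pi>2 E)"
      using ind1[OF ec] ind2[OF ec] E' e12
        induced_map_cls[OF L1(1,2,3) W e12(1)] induced_map_cls[OF L2(1,2,3) W e12(2)]
      by (simp add: F1_def F2_def)
    ultimately show ?thesis using e by blast
  qed
  interpret one: rose_core ?G1 ?g1 ?R y y' ?S1 by (rule spine1(1))
  interpret two: rose_core ?G2 ?g2 ?R y y' ?S2 by (rule spine2(1))
  interpret core_product ?G1 ?g1 ?R y y' ?S1 ?G2 ?g2 ?S2 ?P ?\<pi>1 ?\<pi>2
  proof
    show "local_covering ?\<pi>1 ?P ?G1" unfolding F_def using local_covering_collapse[OF q(1) WF1 AF1] .
    show "local_covering ?\<pi>2 ?P ?G2" unfolding F_snd using local_covering_collapse[OF q(2) WF2 AF2] .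
    show "?g1 (?\<pi>1 E) = ?g2 (?\<pi>2 E)" if "E \<in> edges ?P" for E using edgeP[OF that] by blast
    show "E = E'" if "E \<in> edges ?P" "E' \<in> edges ?P" "?\<pi>1 E = ?\<pi>1 E'" "?\<pi>2 E = ?\<pi>2 E'" for E E'
      using edgeP[OF that(1)] edgeP[OF that(2)] that(3,4) by auto
    show "set w \<subseteq> ?S1" if "edge_path ?G1 a w a" "reduced ?G1 (w @ w)" for a w
      using spine1(2)[OF that] .
    show "set w \<subseteq> ?S2" if "edge_path ?G2 a w a" "reduced ?G2 (w @ w)" for a w
      using spine2(2)[OF that] .
  qed
  \<comment> \<open>The edges with the other label that are charged to the component \<open>\<Omega>\<close>.\<close>
  let ?N = "\<lambda>\<Omega>. {E \<in> edges ?P \<inter> core. ?g1 (?\<pi>1 E) = y' \<and> the_elem E \<in> cells \<Omega>}"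
  have Om: "\<exists>c. c \<in> cells ?Q \<and> \<Omega> = restrict_graph ?Q (component_of ?Q c)" if "\<Omega> \<in> Omegas" for \<Omega>
    using that by (auto simp: Omegas_def graph_components_def)
  have finN: "finite (?N \<Omega>)" for \<Omega> :: "('a \<times> 'b) graph"
    using finite_core_edges by (rule rev_finite_subset) auto
  have rank: "rk \<Omega> \<le> enat (1 + card (?N \<Omega>))" if \<Omega>: "\<Omega> \<in> Omegas" for \<Omega>
  proof -
    obtain c where c: "c \<in> cells ?Q" "\<Omega> = restrict_graph ?Q (component_of ?Q c)" using Om[OF \<Omega>] by blast
    \<comment> \<open>Edges in one component of the collapsed pullback come from one component of the pullback.\<close>
    have "{E \<in> edges ?P \<inter> core \<inter> component_of ?P (cls ?Q F c). ?g1 (?\<pi>1 E) = y'} \<subseteq> ?N \<Omega>"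
    proof
      fix E assume E: "E \<in> {E \<in> edges ?P \<inter> core \<inter> component_of ?P (cls ?Q F c). ?g1 (?\<pi>1 E) = y'}"
      then obtain e where e: "E = {e}" "e \<in> edges ?Q" "e \<notin> F" by (auto simp: edges_collapse[OF Q(1) WF])
      have ec: "e \<in> cells ?Q" using e(2) by (rule edge_in_cells)
      have E': "E = cls ?Q F e" using e ec by (simp add: cls_outside)
      obtain r where "edge_path ?P (src ?P (cls ?Q F c)) r (src ?P E)" using E by (auto simp: component_of_def)
      then have "edge_path ?P (cls ?Q F (src ?Q c)) r (cls ?Q F (src ?Q e))"
        using c(1) ec by (simp only: E' src_collapse[OF Q(1) WF])
      then have "\<exists>r. edge_path ?Q (src ?Q c) r (src ?Q e)"
        by (rule edge_path_of_collapse[OF Q(1) WF src_in_verts[OF Q(1) c(1)] src_in_verts[OF Q(1) ec]])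
      then have "e \<in> component_of ?Q c" using ec by (simp add: component_of_def)
      then show "E \<in> ?N \<Omega>" using E e c(2) by simp
    qed
    then have "card {E \<in> edges ?P \<inter> core \<inter> component_of ?P (cls ?Q F c). ?g1 (?\<pi>1 E) = y'} \<le> card (?N \<Omega>)"
      by (rule card_mono[OF finN])
    then have "card B \<le> 1 + card (?N \<Omega>)" if "finite B" "independent B" "B \<subseteq> H1 ?P"
      "\<And>b. b \<in> B \<Longrightarrow> Poly_Mapping.keys b \<subseteq> component_of ?P (cls ?Q F c)" for B
      using card_independent_le[OF that] by linarith
    then show ?thesis unfolding c(2) by (rule component_rank_le[OF Q(1) WF AF c(1)])
  qed
  \<comment> \<open>Each of these components has a nonzero cycle, hence contains one of the finitely many edges over
    the product of the spines.\<close>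
  have "finite Omegas"
  proof (rule finite_subset)
    show "Omegas \<subseteq> (\<lambda>E. restrict_graph ?Q (component_of ?Q (the_elem E))) ` (edges ?P \<inter> core)"
    proof
      fix \<Omega> assume \<Omega>: "\<Omega> \<in> Omegas"
      obtain c where c: "c \<in> cells ?Q" "\<Omega> = restrict_graph ?Q (component_of ?Q c)" using Om[OF \<Omega>] by blast
      have sub: "subgraph (component_of ?Q c) ?Q" using subgraph_component[OF Q(1)] .
      have "\<not> simply_connected_graph \<Omega>" using \<Omega> by (simp add: Omegas_def)
      then obtain k where k: "k \<in> H1 \<Omega>" "k \<noteq> 0"
        using not_simply_connected_H1[of \<Omega>] is_graph_restrict[OF Q(1) sub] connected_component[OF Q(1) c(1)] c(2)
        by blast
      then have kQ: "k \<in> H1 ?Q" "Poly_Mapping.keys k \<subseteq> component_of ?Q c"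
        using c(2) H1_restrict[OF Q(1) sub] by auto
      let ?k = "collapse_chain ?Q F k"
      have "?k \<noteq> 0" using collapse_chain_inj[OF Q(1) WF AF kQ(1)] k(2) by blast
      then obtain E where E: "E \<in> Poly_Mapping.keys ?k" by (metis ex_in_conv keys_eq_empty)
      then obtain e where e: "E = {e}" "e \<in> Poly_Mapping.keys k" by (auto simp: keys_collapse_chain)
      have kP: "?k \<in> H1 ?P" using collapse_chain_H1[OF Q(1) WF kQ(1)] .
      have "E \<in> edges ?P \<inter> core" using cycles_in_core[OF kP] H1_keys[OF kP] E by blast
      moreover have "component_of ?Q e = component_of ?Q c"
        using component_eq[OF Q(1)] kQ(2) e(2) by blast
      ultimately show "\<Omega> \<in> (\<lambda>E. restrict_graph ?Q (component_of ?Q (the_elem E))) ` (edges ?P \<inter> core)"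
        using c(2) e(1) by (intro image_eqI[of _ _ E]) simp_all
    qed
  qed (use finite_core_edges in simp)
  have "(\<Sum>\<Omega>\<in>Omegas. int (the_enat (rk \<Omega>)) - 1) \<le> (\<Sum>\<Omega>\<in>Omegas. int (card (?N \<Omega>)))"
  proof (rule sum_mono)
    fix \<Omega> assume "\<Omega> \<in> Omegas"
    from rank[OF this] show "int (the_enat (rk \<Omega>)) - 1 \<le> int (card (?N \<Omega>))"
      by (cases "rk \<Omega>") auto
  qed
  also have "\<dots> = int (card (\<Union>\<Omega>\<in>Omegas. ?N \<Omega>))"
  proof -
    have "?N \<Omega> \<inter> ?N \<Omega>' = {}"
      if \<Omega>: "\<Omega> \<in> Omegas" "\<Omega>' \<in> Omegas" "\<Omega> \<noteq> \<Omega>'" for \<Omega> \<Omega>'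
    proof -
      obtain c c' where c: "\<Omega> = restrict_graph ?Q (component_of ?Q c)"
        "\<Omega>' = restrict_graph ?Q (component_of ?Q c')"
        using Om[OF \<Omega>(1)] Om[OF \<Omega>(2)] by blast
      have "\<Omega> = \<Omega>'" if "e \<in> component_of ?Q c" "e \<in> component_of ?Q c'" for e
        using component_eq[OF Q(1) that(1)] component_eq[OF Q(1) that(2)] c by simp
      then have "component_of ?Q c \<inter> component_of ?Q c' = {}" using \<Omega>(3) by blast
      moreover have "cells \<Omega> = component_of ?Q c" "cells \<Omega>' = component_of ?Q c'" using c by simp_all
      ultimately show ?thesis by blast
    qed
    then have "card (\<Union>\<Omega>\<in>Omegas. ?N \<Omega>) = (\<Sum>\<Omega>\<in>Omegas. card (?N \<Omega>))"
      using \<open>finite Omegas\<close> finN by (intro card_UN_disjoint) blast+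
    then show ?thesis by simp
  qed
  also have "\<dots> \<le> int (card {E \<in> edges ?P \<inter> core. ?g1 (?\<pi>1 E) = y'})"
  proof -
    have "finite {E \<in> edges ?P \<inter> core. ?g1 (?\<pi>1 E) = y'}"
      using finite_core_edges by (rule rev_finite_subset) auto
    then show ?thesis by (simp only: of_nat_le_iff) (rule card_mono, auto)
  qed
  also have "\<dots> \<le> int (card {e \<in> edges ?G1 \<inter> ?S1. ?g1 e = y'}) * int (card {e \<in> edges ?G2 \<inter> ?S2. ?g2 e = y'})"
    using card_core_label_le[of y'] by (simp only: of_nat_mult[symmetric] of_nat_le_iff)
  also have "\<dots> \<le> (int (the_enat (rk L1)) - 1) * (int (the_enat (rk L2)) - 1)
         + HH1 * HH2 - (HH1 - n1) * (HH2 - n2)"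
  proof (rule final_estimate)
    show "1 \<le> int (the_enat (rk L1))" "1 \<le> int (the_enat (rk L2))"
      using covering_rank_pos[OF assms(5,9)] covering_rank_pos[OF assms(10,14)] assms(8,13)
      by (auto simp: one_enat_def)
  qed (use spine1(4-6) spine2(4-6) in \<open>simp_all add: HH1_def HH2_def n1_def n2_def flip: y_def\<close>)
  finally have "(\<Sum>\<Omega> \<in> Omegas. int (the_enat (rk \<Omega>)) - 1)
      \<le> (int (the_enat (rk L1)) - 1) * (int (the_enat (rk L2)) - 1)
         + HH1 * HH2 - (HH1 - n1) * (HH2 - n2)" .
  moreover have "rk \<Omega> < \<infinity>" if "\<Omega> \<in> Omegas" for \<Omega>
    using rank[OF that] by (rule le_less_trans) simp
  ultimately show ?thesis using \<open>finite Omegas\<close> by blast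
qed

end
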